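(* Let $(t_0,p_0)\in[0,T)\times\Delta(I)$, $p_0=(p_1,\dots,p_I)$, and let $\bar{\mathbf P}\in\mathbf M(t_0,p_0)$ be optimal, i.e. $\mathbf E_{\bar{\mathbf P}}[\int_{t_0}^TH(s,\mathbf p(s))ds]=\inf_{\mathbf P\in\mathbf M(t_0,p_0)}\mathbf E_{\mathbf P}[\int_{t_0}^TH(s,\mathbf p(s))ds]$ (this infimum equals $\mathbf V(t_0,p_0)$). For $i=1,\dots,I$ set $E_i=\{\mathbf p(T)=e_i\}$ and let $\bar{\mathbf P}_i$ be the probability measure $\bar{\mathbf P}_i(A)=\bar{\mathbf P}(A\cap E_i)/p_i$ if $p_i>0$, and $\bar{\mathbf P}_i=P$ for an arbitrary $P\in\mathbf M(t_0,p_0)$ if $p_i=0$. Let $\bar{\mathbf u}(t)=u^*(t,\mathbf p(t))$ and let $\bar{\mathbf u}_i$ be the random control $((\mathbf D(t_0),\mathcal G,\bar{\mathbf P}_i),\bar{\mathbf u})$. Then playing the random controls $(\bar{\mathbf u}_i)_{i=1,\dots,I}$ is optimal for Player 1 in $\mathbf V(t_0,p_0)$, namely $$\mathbf V(t_0,p_0)=\sup_{\beta\in\mathcal B_r(t_0)}\sum_{i=1}^I p_i\,\mathbf E_{\bar{\mathbf u}_i\beta}\left[\int_{t_0}^T\ell_i\big(s,\bar{\mathbf u}_i(s),\beta(\bar{\mathbf u}_i)(s)\big)ds\right].$$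
   Context: Data. $I\ge 2$ is an integer, $T>0$, $U$ and $V$ are compact subsets of finite-dimensional spaces, and $\ell_i:[0,T]\times U\times V\to\mathbb R$ ($i=1,\dots,I$) are continuous. $\Delta(I)=\{p\in\mathbb R^I: p_i\ge 0,\ \sum_i p_i=1\}$, and $e_1,\dots,e_I$ is the canonical basis of $\mathbb R^I$. Isaacs' condition is assumed: for all $(t,p)\in[0,T]\times\Delta(I)$, $$H(t,p):=\min_{u\in U}\max_{v\in V}\sum_{i=1}^I p_i\ell_i(t,u,v)=\max_{v\in V}\min_{u\in U}\sum_{i=1}^I p_i\ell_i(t,u,v).$$ $u^*:[0,T]\times\Delta(I)\to U$ is a Borel measurable selection of minimizers: $\max_{v\in V}\sum_ip_i\ell_i(t,u^*(t,p),v)=H(t,p)$. The game and its value. For $t_0<T$, $\mathcal U(t_0)$ (resp. $\mathcal V(t_0)$) is the set of Lebesgue measurable maps $[t_0,T]\to U$ (resp. $[t_0,T]\to V$), with the $L^1$-distance and its Borel $\sigma$-field. Fix a non-trivial set $\mathcal E$ of probability spaces, stable by product, and containing the spaces $(\mathbf D(t_0),\mathcal G,\bar{\mathbf P}_i)$ used in the claim. A random control of Player 1 is a pair $((\Omega_u,\mathcal F_u,\mathbf P_u),u)$ with the probability space in $\mathcal E$ and $u:\Omega_u\to\mathcal U(t_0)$ measurable. A random strategy for Player 1 is a pair $((\Omega_\alpha,\mathcal F_\alpha,\mathbf P_\alpha),\alpha)$ with $(\Omega_\alpha,\mathcal F_\alpha,\mathbf P_\alpha)\in\mathcal E$ and $\alpha:\Omega_\alpha\times\mathcal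 V(t_0)\to\mathcal U(t_0)$ measurable, such that there is a partition $t_0<t_1<\dots<t_k=T$ with: for all $\omega$, all $v_1,v_2$ and all $i\in\{0,\dots,k-1\}$, if $v_1=v_2$ a.e. on $[t_0,t_i]$ then $\alpha(\omega,v_1)=\alpha(\omega,v_2)$ a.e. on $[t_0,t_{i+1}]$. The set of these is $\mathcal A_r(t_0)$; random controls are the random strategies not depending on $v$. Random strategies $\beta:\Omega_\beta\times\mathcal U(t_0)\to\mathcal V(t_0)$ of Player 2 are defined symmetrically; their set is $\mathcal B_r(t_0)$. For $(\alpha,\beta)\in\mathcal A_r(t_0)\times\mathcal B_r(t_0)$ and $\omega=(\omega_1,\omega_2)\in\Omega_\alpha\times\Omega_\beta$ there is a unique pair $(u_\omega,v_\omega)$ with $\alpha(\omega_1,v_\omega)=u_\omega$, $\beta(\omega_2,u_\omega)=v_\omega$, depending measurably on $\omega$; one sets $\mathbf E_{\alpha\beta}\big[\int_{t_0}^T\ell_i(s,\alpha(s),\beta(s))ds\big]=\int_{\Omega_\alpha\times\Omega_\beta}\int_{t_0}^T\ell_i(s,u_\omega(s),v_\omega(s))\,ds\,d(\mathbf P_\alpha\otimes\mathbf P_\beta)(\omega)$. For a random control $u$, this means $u_\omega=u(\omega_1)$, $v_\omega=\beta(\omega_2,u(\omega_1))$. The value is $$\mathbf V(t_0,p)=\inf_{(\alpha_i)\in\mathcal A_r(t_0)^I}\sup_{\beta\in\mathcal B_r(t_0)}\sum_{i=1}^I p_i\mathbf E_{\alpha_i\beta}\Big[\int_{t_0}^T\ell_i(s,\alpha_i(s),\beta(s))ds\Big],$$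 which is known to equal the corresponding $\sup_\beta\inf_{(\alpha_i)}$ and not to depend on $\mathcal E$. Martingale measures. $\mathbf D(t_0)$ is the set of càdlàg functions $\mathbb R\to\Delta(I)$ that are constant on $(-\infty,t_0)$ and on $[T,+\infty)$; $t\mapsto\mathbf p(t)$ is the coordinate process, $(\mathcal G_t)$ the filtration it generates and $\mathcal G$ the $\sigma$-field it generates. $\mathbf M(t_0,p_0)$ is the set of probability measures $\mathbf P$ on $\mathbf D(t_0)$ under which $(\mathbf p(t))_{t\in\mathbb R}$ is a martingale and, $\mathbf P$-a.s., $\mathbf p(t)=p_0$ for $t<t_0$ and $\mathbf p(t)\in\{e_1,\dots,e_I\}$ for $t\ge T$. $\mathbf E_{\mathbf P}$ is expectation under $\mathbf P$. *)

theory Defs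
  imports "HOL-Probability.Probability"
begin

definition prob_simplex :: "(real ^ 'i::finite) set" where
  "prob_simplex = {p. (\<forall>i. 0 \<le> p $ i) \<and> (\<Sum>i\<in>UNIV. p $ i) = 1}"

text \<open>For compact nonempty action sets and continuous payoffs the infimum and the supremum below
  are attained, so they are the minimum and the maximum of the usual definition.\<close>

definition hamiltonian ::
  "'a set \<Rightarrow> 'b set \<Rightarrow> ('i::finite \<Rightarrow> real \<Rightarrow> 'a \<Rightarrow> 'b \<Rightarrow> real) \<Rightarrow> real \<Rightarrow> real ^ 'i \<Rightarrow> real" where
  "hamiltonian U V l t p = (INF u\<in>U. SUP v\<in>V. \<Sum>i\<in>UNIV. p $ i * l i t u v)"

definition isaacs ::
  "real \<Rightarrow> 'a set \<Rightarrow> 'b set \<Rightarrow> ('i::finite \<Rightarrow> real \<Rightarrow> 'a \<Rightarrow> 'b \<Rightarrow> real) \<Rightarrow> bool" where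
  "isaacs T U V l \<longleftrightarrow> (\<forall>t\<in>{0..T}. \<forall>p\<in>prob_simplex.
     (INF u\<in>U. SUP v\<in>V. \<Sum>i\<in>UNIV. p $ i * l i t u v) =
     (SUP v\<in>V. INF u\<in>U. \<Sum>i\<in>UNIV. p $ i * l i t u v))"

definition minimizer_selection ::
  "real \<Rightarrow> 'a::euclidean_space set \<Rightarrow> 'b set \<Rightarrow> ('i::finite \<Rightarrow> real \<Rightarrow> 'a \<Rightarrow> 'b \<Rightarrow> real)
    \<Rightarrow> (real \<Rightarrow> real ^ 'i \<Rightarrow> 'a) \<Rightarrow> bool" where
  "minimizer_selection T U V l ustar \<longleftrightarrow>
     (\<lambda>(t, p). ustar t p) \<in> restrict_space borel ({0..T} \<times> prob_simplex) \<rightarrow>\<^sub>M restrict_space borel U \<and>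
     (\<forall>t\<in>{0..T}. \<forall>p\<in>prob_simplex.
        (SUP v\<in>V. \<Sum>i\<in>UNIV. p $ i * l i t (ustar t p) v) = hamiltonian U V l t p)"


section \<open>Controls, random strategies and the value\<close>

text \<open>Controls are honest functions (extensional outside \<open>[t0, T]\<close>), not classes modulo
  a.e. equality, so the \<open>L\<^sup>1\<close>-distance is only a pseudometric. Its open sets are saturated
  under a.e. equality, so the \<open>\<sigma>\<close>-field is that of the quotient.\<close>

definition control_set :: "real \<Rightarrow> real \<Rightarrow> 'a::euclidean_space set \<Rightarrow> (real \<Rightarrow> 'a) set" where
  "control_set t0 T A = {u \<in> {t0..T} \<rightarrow>\<^sub>E A. u \<in> lebesgue_on {t0..T} \<rightarrow>\<^sub>M borel}"

definition L1_dist :: "real \<Rightarrow> real \<Rightarrow> (real \<Rightarrow> 'a::euclidean_space) \<Rightarrow> (real \<Rightarrow> 'a) \<Rightarrow> real" where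
  "L1_dist t0 T u w = (LINT s|lebesgue_on {t0..T}. dist (u s) (w s))"

definition L1_open :: "real \<Rightarrow> real \<Rightarrow> 'a::euclidean_space set \<Rightarrow> (real \<Rightarrow> 'a) set \<Rightarrow> bool" where
  "L1_open t0 T A G \<longleftrightarrow> G \<subseteq> control_set t0 T A \<and>
     (\<forall>u\<in>G. \<exists>e>0. \<forall>w\<in>control_set t0 T A. L1_dist t0 T u w < e \<longrightarrow> w \<in> G)"

definition control_space :: "real \<Rightarrow> real \<Rightarrow> 'a::euclidean_space set \<Rightarrow> (real \<Rightarrow> 'a) measure" where
  "control_space t0 T A = sigma (control_set t0 T A) {G. L1_open t0 T A G}"

definition ae_eq_upto :: "real \<Rightarrow> real \<Rightarrow> (real \<Rightarrow> 'a) \<Rightarrow> (real \<Rightarrow> 'a) \<Rightarrow> bool" where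
  "ae_eq_upto t0 t u w \<longleftrightarrow> (AE s in lebesgue_on {t0..t}. u s = w s)"

definition nonanticipative_with_delay ::
  "real \<Rightarrow> real \<Rightarrow> 'b::euclidean_space set \<Rightarrow> 'w set
    \<Rightarrow> ('w \<Rightarrow> (real \<Rightarrow> 'b) \<Rightarrow> (real \<Rightarrow> 'a::euclidean_space)) \<Rightarrow> bool" where
  "nonanticipative_with_delay t0 T B \<Omega> \<alpha> \<longleftrightarrow>
     (\<exists>(k::nat) \<tau>. \<tau> 0 = t0 \<and> \<tau> k = T \<and> (\<forall>j<k. \<tau> j < \<tau> (Suc j)) \<and>
       (\<forall>\<omega>\<in>\<Omega>. \<forall>v1\<in>control_set t0 T B. \<forall>v2\<in>control_set t0 T B. \<forall>j<k.
          ae_eq_upto t0 (\<tau> j) v1 v2 \<longrightarrow> ae_eq_upto t0 (\<tau> (Suc j)) (\<alpha> \<omega> v1) (\<alpha> \<omega> v2)))"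

type_synonym ('w, 'b, 'a) rand_strategy =
  "'w measure \<times> ('w \<Rightarrow> (real \<Rightarrow> 'b) \<Rightarrow> (real \<Rightarrow> 'a))"

text \<open>\<open>B\<close> is the opponent's action set and \<open>A\<close> the player's own: Player 1's strategies are
  \<open>rand_strategies E t0 T V U\<close>, those of Player 2 are \<open>rand_strategies E t0 T U V\<close>.\<close>

definition rand_strategies ::
  "'w measure set \<Rightarrow> real \<Rightarrow> real \<Rightarrow> 'b::euclidean_space set \<Rightarrow> 'a::euclidean_space set
    \<Rightarrow> ('w, 'b, 'a) rand_strategy set" where
  "rand_strategies E t0 T B A = {(M, \<alpha>). M \<in> E \<and>
     (\<lambda>(\<omega>, v). \<alpha> \<omega> v) \<in> (M \<Otimes>\<^sub>M control_space t0 T B) \<rightarrow>\<^sub>M control_space t0 T A \<and>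
     nonanticipative_with_delay t0 T B (space M) \<alpha>}"

definition strategy_of_control ::
  "'w measure \<times> ('w \<Rightarrow> real \<Rightarrow> 'a) \<Rightarrow> ('w, 'b, 'a) rand_strategy" where
  "strategy_of_control c = (fst c, \<lambda>\<omega> v. snd c \<omega>)"

text \<open>For strategies with delay the pair exists and is unique up to a.e. equality, so the
  choice made here does not affect the payoff.\<close>

definition outcome ::
  "real \<Rightarrow> real \<Rightarrow> 'a::euclidean_space set \<Rightarrow> 'b::euclidean_space set
    \<Rightarrow> ((real \<Rightarrow> 'b) \<Rightarrow> (real \<Rightarrow> 'a)) \<Rightarrow> ((real \<Rightarrow> 'a) \<Rightarrow> (real \<Rightarrow> 'b))
    \<Rightarrow> (real \<Rightarrow> 'a) \<times> (real \<Rightarrow> 'b)" where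
  "outcome t0 T U V a b = (SOME (u, v). u \<in> control_set t0 T U \<and> v \<in> control_set t0 T V \<and>
     ae_eq_upto t0 T (a v) u \<and> ae_eq_upto t0 T (b u) v)"

text \<open>The two probability spaces may live on different types.\<close>

definition expected_payoff ::
  "real \<Rightarrow> real \<Rightarrow> 'a::euclidean_space set \<Rightarrow> 'b::euclidean_space set
    \<Rightarrow> (real \<Rightarrow> 'a \<Rightarrow> 'b \<Rightarrow> real)
    \<Rightarrow> ('w1, 'b, 'a) rand_strategy \<Rightarrow> ('w2, 'a, 'b) rand_strategy \<Rightarrow> real" where
  "expected_payoff t0 T U V f \<alpha> \<beta> =
     (LINT \<omega>|(fst \<alpha> \<Otimes>\<^sub>M fst \<beta>).
        (case outcome t0 T U V (snd \<alpha> (fst \<omega>)) (snd \<beta> (snd \<omega>)) of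
          (u, v) \<Rightarrow> LINT s|lebesgue_on {t0..T}. f s (u s) (v s)))"

definition game_value ::
  "'w measure set \<Rightarrow> real \<Rightarrow> 'a::euclidean_space set \<Rightarrow> 'b::euclidean_space set
    \<Rightarrow> ('i::finite \<Rightarrow> real \<Rightarrow> 'a \<Rightarrow> 'b \<Rightarrow> real) \<Rightarrow> real \<Rightarrow> real ^ 'i \<Rightarrow> real" where
  "game_value E T U V l t0 p =
     (INF \<alpha> \<in> {\<alpha>. \<forall>i. \<alpha> i \<in> rand_strategies E t0 T V U}.
        SUP \<beta> \<in> rand_strategies E t0 T U V.
          \<Sum>i\<in>UNIV. p $ i * expected_payoff t0 T U V (l i) (\<alpha> i) \<beta>)"


section \<open>Families of probability spaces\<close>

definition isomorphic_measure_spaces :: "'a measure \<Rightarrow> 'b measure \<Rightarrow> bool" where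
  "isomorphic_measure_spaces M N \<longleftrightarrow>
     (\<exists>f g. f \<in> M \<rightarrow>\<^sub>M N \<and> g \<in> N \<rightarrow>\<^sub>M M \<and>
        (\<forall>x\<in>space M. g (f x) = x) \<and> (\<forall>y\<in>space N. f (g y) = y) \<and> distr M N f = N)"

text \<open>All members of the family live on one type \<open>'w\<close>, while a product lives on \<open>'w \<times> 'w\<close>;
  membership of a space on another type is therefore understood up to isomorphism.\<close>

definition member_upto_iso :: "'a measure \<Rightarrow> 'w measure set \<Rightarrow> bool" where
  "member_upto_iso N E \<longleftrightarrow> (\<exists>K\<in>E. isomorphic_measure_spaces K N)"

definition prob_space_family :: "'w measure set \<Rightarrow> bool" where
  "prob_space_family E \<longleftrightarrow> E \<noteq> {} \<and> (\<forall>M\<in>E. prob_space M) \<and>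
     (\<forall>M\<in>E. \<forall>N\<in>E. member_upto_iso (M \<Otimes>\<^sub>M N) E)"


section \<open>Martingale measures on the path space\<close>

definition cadlag :: "(real \<Rightarrow> 'a::topological_space) \<Rightarrow> bool" where
  "cadlag x \<longleftrightarrow> (\<forall>t. (x \<longlongrightarrow> x t) (at_right t) \<and> (\<exists>y. (x \<longlongrightarrow> y) (at_left t)))"

definition paths :: "real \<Rightarrow> real \<Rightarrow> (real \<Rightarrow> real ^ 'i::finite) set" where
  "paths t0 T = {x. (\<forall>t. x t \<in> prob_simplex) \<and> cadlag x \<and>
     x constant_on {..<t0} \<and> x constant_on {T..}}"

definition path_space :: "real \<Rightarrow> real \<Rightarrow> (real \<Rightarrow> real ^ 'i::finite) measure" where
  "path_space t0 T = sigma (paths t0 T) {{x \<in> paths t0 T. x s \<in> B} | s B. B \<in> sets borel}"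

definition path_filtration :: "real \<Rightarrow> real \<Rightarrow> real \<Rightarrow> (real \<Rightarrow> real ^ 'i::finite) measure" where
  "path_filtration t0 T t =
     sigma (paths t0 T) {{x \<in> paths t0 T. x s \<in> B} | s B. s \<le> t \<and> B \<in> sets borel}"

definition martingale :: "'c measure \<Rightarrow> (real \<Rightarrow> 'c measure) \<Rightarrow> (real \<Rightarrow> 'c \<Rightarrow> real) \<Rightarrow> bool" where
  "martingale P F X \<longleftrightarrow> filtration (space P) F \<and> (\<forall>t. subalgebra P (F t)) \<and>
     (\<forall>t. X t \<in> borel_measurable (F t) \<and> integrable P (X t)) \<and>
     (\<forall>s t. s \<le> t \<longrightarrow> (AE x in P. real_cond_exp P (F s) (X t) x = X s x))"

definition martingale_measures ::
  "real \<Rightarrow> real \<Rightarrow> real ^ 'i::finite \<Rightarrow> (real \<Rightarrow> real ^ 'i) measure set" where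
  "martingale_measures t0 T p0 = {P. prob_space P \<and> sets P = sets (path_space t0 T) \<and>
     (\<forall>i. martingale P (path_filtration t0 T) (\<lambda>t x. x t $ i)) \<and>
     (AE x in P. (\<forall>t<t0. x t = p0) \<and> (\<forall>t\<ge>T. x t \<in> range (\<lambda>i. axis i 1)))}"

definition running_cost ::
  "real \<Rightarrow> 'a set \<Rightarrow> 'b set \<Rightarrow> ('i::finite \<Rightarrow> real \<Rightarrow> 'a \<Rightarrow> 'b \<Rightarrow> real) \<Rightarrow> real
    \<Rightarrow> (real \<Rightarrow> real ^ 'i) measure \<Rightarrow> real" where
  "running_cost T U V l t0 P =
     (LINT x|P. LINT s|lebesgue_on {t0..T}. hamiltonian U V l s (x s))"

definition optimal_martingale_measure ::
  "real \<Rightarrow> 'a set \<Rightarrow> 'b set \<Rightarrow> ('i::finite \<Rightarrow> real \<Rightarrow> 'a \<Rightarrow> 'b \<Rightarrow> real) \<Rightarrow> real \<Rightarrow> real ^ 'i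
    \<Rightarrow> (real \<Rightarrow> real ^ 'i) measure \<Rightarrow> bool" where
  "optimal_martingale_measure T U V l t0 p0 P \<longleftrightarrow> P \<in> martingale_measures t0 T p0 \<and>
     running_cost T U V l t0 P = (INF Q\<in>martingale_measures t0 T p0. running_cost T U V l t0 Q)"

text \<open>The laws \<open>Q i\<close> of the path given that it ends in \<open>e\<^sub>i\<close>; arbitrary if \<open>p0 $ i = 0\<close>.\<close>

definition conditional_laws ::
  "real \<Rightarrow> real \<Rightarrow> real ^ 'i::finite \<Rightarrow> (real \<Rightarrow> real ^ 'i) measure
    \<Rightarrow> ('i \<Rightarrow> (real \<Rightarrow> real ^ 'i) measure) \<Rightarrow> bool" where
  "conditional_laws t0 T p0 P Q \<longleftrightarrow> (\<forall>i.
     (p0 $ i > 0 \<longrightarrow> sets (Q i) = sets (path_space t0 T) \<and>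
        (\<forall>A\<in>sets (path_space t0 T).
           emeasure (Q i) A = emeasure P (A \<inter> {x \<in> paths t0 T. x T = axis i 1}) / ennreal (p0 $ i))) \<and>
     (p0 $ i = 0 \<longrightarrow> Q i \<in> martingale_measures t0 T p0))"

definition feedback_control ::
  "real \<Rightarrow> real \<Rightarrow> (real \<Rightarrow> real ^ 'i::finite \<Rightarrow> 'a) \<Rightarrow> (real \<Rightarrow> real ^ 'i) \<Rightarrow> (real \<Rightarrow> 'a)" where
  "feedback_control t0 T ustar x = (\<lambda>t\<in>{t0..T}. ustar t (x t))"

end

theory Submission
  imports Defs
begin

text \<open>Let \<open>W\<close> be the infimum of the running cost over martingale measures, which \<open>Pbar\<close> attains.

  Against the feedback controls no strategy of Player 2 yields more than \<open>W\<close>. On each interval of its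
  delay partition a reply depends on the past path only, and the law \<open>Pbari i\<close> is \<open>Pbar\<close> weighted by
  \<open>x T $ i / p0 $ i\<close>. By the martingale property the weight \<open>x T $ i\<close> may be replaced by \<open>x s $ i\<close> at
  time \<open>s\<close>, and \<open>\<Sum>\<^sub>i x s $ i * l i s (ustar s (x s)) v \<le> H s (x s)\<close> by the choice of \<open>ustar\<close>.

  Conversely, whatever \<open>\<alpha>\<close> Player 1 uses, Player 2 secures \<open>W\<close> up to any error. On a fine time grid he
  observes rounded values of the payoffs of the past periods, computes the posterior belief about the
  type, and plays in the next period an almost optimal action of Isaacs' game at this belief. There are
  only finitely many histories, so the beliefs, completed by a jump to the true type at time \<open>T\<close>, form a
  martingale with an elementary law. Using the old belief instead of the new one
  costs at most the expected variation of the beliefs times the mesh; as martingale increments are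
  orthogonal, this is of the order of the square root of the mesh.\<close>

section \<open>Controls with the L1-distance\<close>

text \<open>Two measurability obstacles shape the development. The value of a control at one time is
  in general not a measurable function of the control, yet the change of weights must be made time
  by time; replies are therefore first rounded to a countable dense family, and uniform continuity
  of the payoff in L1 removes the rounding. Moreover \<open>outcome\<close> is a mere choice; since
  the grid strategy produces only finitely many replies, the event that a history \<open>h\<close>
  occurs is expressed by letting Player 1's strategy answer the fixed plan belonging to
  \<open>h\<close>.

  Player 2 observes payoffs, not controls: the payoffs of all types over one period are all that the
  estimate needs, and after rounding the posteriors are quotients of finitely many masses, so no
  regular conditional laws occur.

  The variation of the beliefs enters through |d| \<le> \<mu>/2 + d^2/(2\<mu>): the expected squares
  telescope to at most 1 per type, and each period carries a payoff of order 1/N, which leaves an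
  error of order \<mu> + 1/(\<mu> N). Hence \<mu> is fixed first and the number N of periods
  afterwards.\<close>

lemma space_control_space [simp]: "space (control_space t0 T A) = control_set t0 T A"
  by (auto simp: control_space_def L1_open_def intro!: space_measure_of)

lemma L1_open_sets: "L1_open t0 T A G \<Longrightarrow> G \<in> sets (control_space t0 T A)"
  unfolding control_space_def
  by (subst sets_measure_of) (auto simp: L1_open_def intro: sigma_sets.Basic)

lemma lebesgue_on_Icc_finite [simp, intro]: "finite_measure (lebesgue_on {a..b::real})"
  by (simp add: finite_measure_lebesgue_on)

lemma control_set_measurable:
  "u \<in> control_set t0 T A \<Longrightarrow> u \<in> borel_measurable (lebesgue_on {t0..T})"
  by (simp add: control_set_def)

lemma control_set_mem: "u \<in> control_set t0 T A \<Longrightarrow> s \<in> {t0..T} \<Longrightarrow> u s \<in> A"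
  by (auto simp: control_set_def PiE_def)

lemma control_setI:
  "(\<And>s. s \<in> {t0..T} \<Longrightarrow> u s \<in> A) \<Longrightarrow> (\<And>s. s \<notin> {t0..T} \<Longrightarrow> u s = undefined) \<Longrightarrow>
   u \<in> borel_measurable (lebesgue_on {t0..T}) \<Longrightarrow> u \<in> control_set t0 T A"
  by (auto simp: control_set_def PiE_def extensional_def)

lemma integrable_bounded_on_Icc:
  fixes f :: "real \<Rightarrow> real"
  assumes "f \<in> borel_measurable (lebesgue_on {a..b})" "\<And>s. s \<in> {a..b} \<Longrightarrow> \<bar>f s\<bar> \<le> C"
  shows "integrable (lebesgue_on {a..b}) f"
proof -
  interpret finite_measure "lebesgue_on {a..b}" by simp
  show ?thesis by (rule integrable_const_bound[where B=C]) (use assms in auto)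
qed

lemma integrable_control_dist:
  assumes "bounded A" "u \<in> control_set t0 T A" "w \<in> control_set t0 T A"
  shows "integrable (lebesgue_on {t0..T}) (\<lambda>s. dist (u s) (w s))"
proof -
  obtain C where C: "\<And>x y. x \<in> A \<Longrightarrow> y \<in> A \<Longrightarrow> dist x y \<le> C"
    using assms(1) by (meson bounded_two_points)
  show ?thesis
    by (rule integrable_bounded_on_Icc[where C=C])
       (use assms C control_set_mem[of _ t0 T A] control_set_measurable[of _ t0 T A] in \<open>auto intro!: borel_measurable_dist\<close>)
qed

lemma L1_dist_commute: "L1_dist t0 T u w = L1_dist t0 T w u"
  by (simp add: L1_dist_def dist_commute)

lemma L1_dist_triangle:
  assumes "bounded A" "u \<in> control_set t0 T A" "v \<in> control_set t0 T A" "w \<in> control_set t0 T A"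
  shows "L1_dist t0 T u w \<le> L1_dist t0 T u v + L1_dist t0 T v w"
proof -
  have "L1_dist t0 T u w \<le> (LINT s|lebesgue_on {t0..T}. dist (u s) (v s) + dist (v s) (w s))"
    unfolding L1_dist_def using assms
    by (intro integral_mono Bochner_Integration.integrable_add integrable_control_dist)
       (auto simp: dist_triangle)
  also have "\<dots> = L1_dist t0 T u v + L1_dist t0 T v w"
    unfolding L1_dist_def using assms
    by (intro Bochner_Integration.integral_add integrable_control_dist) auto
  finally show ?thesis .
qed

lemma L1_continuous_measurable:
  fixes f :: "(real \<Rightarrow> 'a::euclidean_space) \<Rightarrow> real"
  assumes "\<And>u e. u \<in> control_set t0 T A \<Longrightarrow> e > 0 \<Longrightarrow>
    \<exists>d>0. \<forall>w\<in>control_set t0 T A. L1_dist t0 T u w < d \<longrightarrow> \<bar>f u - f w\<bar> < e"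
  shows "f \<in> borel_measurable (control_space t0 T A)"
proof (rule borel_measurableI_greater)
  fix a
  have "L1_open t0 T A {u \<in> control_set t0 T A. a < f u}"
    unfolding L1_open_def
  proof safe
    fix u assume u: "u \<in> control_set t0 T A" "a < f u"
    obtain d where d: "d > 0" "\<forall>w\<in>control_set t0 T A. L1_dist t0 T u w < d \<longrightarrow> \<bar>f u - f w\<bar> < f u - a"
      using assms[OF u(1), of "f u - a"] u by auto
    show "\<exists>d>0. \<forall>w\<in>control_set t0 T A. L1_dist t0 T u w < d \<longrightarrow> w \<in> {u \<in> control_set t0 T A. a < f u}"
      using d by (intro exI[of _ d]) force
  qed
  then show "{x \<in> space (control_space t0 T A). a < f x} \<in> sets (control_space t0 T A)"
    using L1_open_sets by simp
qed

lemma L1_dist_measurable: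
  assumes "bounded A" "d \<in> control_set t0 T A"
  shows "(\<lambda>u. L1_dist t0 T u d) \<in> borel_measurable (control_space t0 T A)"
proof (rule L1_continuous_measurable)
  fix u and e :: real assume u: "u \<in> control_set t0 T A" "e > 0"
  show "\<exists>d'>0. \<forall>w\<in>control_set t0 T A. L1_dist t0 T u w < d' \<longrightarrow> \<bar>L1_dist t0 T u d - L1_dist t0 T w d\<bar> < e"
  proof (intro exI[of _ e] conjI ballI impI)
    fix w assume w: "w \<in> control_set t0 T A" "L1_dist t0 T u w < e"
    have "L1_dist t0 T w d \<le> L1_dist t0 T w u + L1_dist t0 T u d"
      "L1_dist t0 T u d \<le> L1_dist t0 T u w + L1_dist t0 T w d"
      using assms u w by (auto intro: L1_dist_triangle)
    then show "\<bar>L1_dist t0 T u d - L1_dist t0 T w d\<bar> < e"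
      using w by (simp add: L1_dist_commute abs_less_iff)
  qed (use u in auto)
qed

section \<open>Rational step functions are dense among the controls\<close>

definition rational_unions :: "real set set" where
  "rational_unions = (\<lambda>F. \<Union>(p, q)\<in>set F. {p<..<q}) ` lists (\<rat> \<times> \<rat>)"

lemma countable_rational_unions: "countable rational_unions"
  unfolding rational_unions_def
  by (intro countable_image countable_lists countable_SIGMA) (auto simp: countable_rat)

lemma rational_unions_open: "Q \<in> rational_unions \<Longrightarrow> open Q"
  by (auto simp: rational_unions_def)

text \<open>Outer regularity gives an open \<open>G\<close> around \<open>B\<close> with small
  excess. \<open>G\<close> is a countable union of rational intervals, and finite partial unions
  exhaust its measure. Thus a countable family of sets suffices for the switching regions of step
  controls.\<close>

lemma rational_unions_approx:
  assumes "B \<in> lmeasurable" "e > 0"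
  shows "\<exists>Q\<in>rational_unions. Q \<in> lmeasurable \<and> measure lebesgue ((B - Q) \<union> (Q - B)) < e"
proof -
  obtain G where G: "open G" "B \<subseteq> G" "G - B \<in> lmeasurable" "emeasure lebesgue (G - B) < ennreal (e/2)"
    using sets_lebesgue_outer_open[of B "e/2"] assms by auto
  have GBm: "measure lebesgue (G - B) < e/2"
    using G(3,4) assms(2) by (simp add: emeasure_eq_measure2 ennreal_less_iff)
  have "B \<union> (G - B) \<in> lmeasurable"
    using fmeasurable.Un[OF assms(1) G(3)] .
  then have Gl: "G \<in> lmeasurable" using G(2) by (simp add: Un_absorb1)
  define D where "D = {pq \<in> \<rat> \<times> \<rat>. {fst pq<..<snd pq} \<subseteq> G}"
  have cD: "countable D" 
    unfolding D_def by (rule countable_subset[of _ "\<rat> \<times> \<rat>"]) (auto intro!: countable_SIGMA simp: countable_rat)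
  have GD: "G = (\<Union>pq\<in>D. {fst pq<..<snd pq})"
  proof safe
    fix x assume "x \<in> G"
    then obtain d where d: "d > 0" "ball x d \<subseteq> G" using G(1) open_contains_ball by blast
    obtain p where p: "p \<in> \<rat>" "x - d < p" "p < x" using Rats_dense_in_real[of "x - d" x] d by auto
    obtain q where q: "q \<in> \<rat>" "x < q" "q < x + d" using Rats_dense_in_real[of x "x + d"] d by auto
    have "{p<..<q} \<subseteq> ball x d" using p q by (auto simp: dist_real_def)
    then have "(p,q) \<in> D" using d p q by (auto simp: D_def)
    then show "x \<in> (\<Union>pq\<in>D. {fst pq<..<snd pq})" using p q by force
  qed (auto simp: D_def)
  show ?thesis
  \<comment> \<open>\<open>from_nat_into D\<close> enumerates \<open>D\<close> only when
    \<open>D\<close> is nonempty; if it is empty, so are \<open>G\<close> and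
    \<open>B\<close>.\<close>
  proof (cases "D = {}")
    case True
    then have "G = {}" using GD by auto
    then have "B = {}" using G by auto
    then show ?thesis using assms(2) by (intro bexI[of _ "{}"]) (auto simp: rational_unions_def image_iff intro!: bexI[of _ "[]"])
  next
    case False
    define c where "c = from_nat_into D"
    have c: "range c = D" using cD False by (simp add: c_def range_from_nat_into)
    define Q where "Q n = (\<Union>k<n. {fst (c k)<..<snd (c k)})" for n
    have Qr: "Q n \<in> rational_unions" for n
    proof -
      have "c k \<in> \<rat> \<times> \<rat>" for k using c by (auto simp: D_def)
      then show ?thesis unfolding rational_unions_def Q_def
        by (intro image_eqI[of _ _ "map c [0..<n]"]) (auto simp: in_lists_conv_set case_prod_beta)
    qed
    have QG: "(\<Union>n. Q n) = G"
      unfolding Q_def GD c[symmetric] by (auto intro!: exI[of _ "Suc _"])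
    have incQ: "incseq Q" by (auto simp: incseq_def Q_def intro: order_less_le_trans)
    have Qs: "Q n \<in> sets lebesgue" for n using rational_unions_open[OF Qr] by auto
    have "(\<lambda>n. measure lebesgue (Q n)) \<longlonglongrightarrow> measure lebesgue (\<Union>n. Q n)"
    proof (rule Lim_measure_incseq)
      show "range Q \<subseteq> sets lebesgue" using Qs by auto
      show "emeasure lebesgue (\<Union>n. Q n) \<noteq> \<infinity>" unfolding QG using Gl by (auto simp: fmeasurable_def)
    qed (rule incQ)
    then have "eventually (\<lambda>n. measure lebesgue (Q n) > measure lebesgue G - e/2) sequentially"
      unfolding QG using assms(2) by (intro order_tendstoD) auto
    then obtain n where n: "measure lebesgue (Q n) > measure lebesgue G - e/2"
      by (auto simp: eventually_sequentially)
    have QGn: "Q n \<subseteq> G" using QG by auto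
    have Ql: "Q n \<in> lmeasurable" by (rule fmeasurableI2[OF Gl QGn Qs])
    have "measure lebesgue ((B - Q n) \<union> (Q n - B)) \<le> measure lebesgue ((G - Q n) \<union> (G - B))"
      using G(2) QGn assms(1) Gl Ql G(3) by (intro measure_mono_fmeasurable) (auto intro!: fmeasurable.Un fmeasurable.Diff sets.Un sets.Diff dest: fmeasurableD)
    also have "\<dots> \<le> measure lebesgue (G - Q n) + measure lebesgue (G - B)"
      using Gl Ql G(3) by (intro measure_Un_le) auto
    also have "measure lebesgue (G - Q n) = measure lebesgue G - measure lebesgue (Q n)"
      by (intro measurable_measure_Diff Gl QGn) (use Qs in auto)
    finally show ?thesis using n GBm Qr Ql by (intro bexI[of _ "Q n"]) auto
  qed
qed

text \<open>A priority list: the first set containing \<open>s\<close> decides, so the sets need not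
  be disjoint, and prepending an entry changes the function only on the new set.\<close>

primrec step_fun :: "'a \<Rightarrow> ('a \<times> real set) list \<Rightarrow> real \<Rightarrow> 'a" where
  "step_fun a0 [] s = a0"
| "step_fun a0 (x # r) s = (if s \<in> snd x then fst x else step_fun a0 r s)"

lemma step_fun_control:
  fixes A :: "'a::euclidean_space set"
  assumes "a0 \<in> A" "set r \<subseteq> A \<times> rational_unions"
  shows "restrict (step_fun a0 r) {t0..T} \<in> control_set t0 T A"
proof (rule control_setI)
  show "s \<in> {t0..T} \<Longrightarrow> restrict (step_fun a0 r) {t0..T} s \<in> A" for s
    using assms by (induction r) auto
  have "step_fun a0 r \<in> borel_measurable borel"
    using assms(2)
  proof (induction r)
    case (Cons x r)
    then have "snd x \<in> sets borel" using rational_unions_open by auto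
    with Cons show ?case by (simp add: measurable_If_set)
  next
    case Nil
    have "step_fun a0 [] = (\<lambda>_. a0)" by (rule ext) simp
    then show ?case by simp
  qed
  then have "step_fun a0 r \<in> borel_measurable (lebesgue_on {t0..T})"
    by (intro measurable_restrict_space1) (auto intro: measurable_completion)
  then show "restrict (step_fun a0 r) {t0..T} \<in> borel_measurable (lebesgue_on {t0..T})"
    by (rule measurable_cong[THEN iffD1, rotated]) auto
qed auto

text \<open>Induction over the centres. Let \<open>B\<close> be the set where \<open>u\<close> is
  near the new centre and \<open>Q\<close> its approximation, put in front of the list. On the
  intersection of \<open>B\<close> and \<open>Q\<close> the new value is right, off both sets the
  old list decides, so the exceptional set grows only by the symmetric difference.\<close>

lemma step_fun_approx:
  fixes u :: "real \<Rightarrow> 'a::euclidean_space"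
  assumes u: "u \<in> borel_measurable (lebesgue_on {t0..T})" and "e > 0" "d > 0"
  shows "\<exists>r. set r \<subseteq> set as \<times> rational_unions \<and> (\<exists>N. N \<in> lmeasurable \<and> measure lebesgue N < e \<and>
     {s \<in> {t0..T}. (\<exists>a\<in>set as. dist (u s) a < d) \<and> dist (u s) (step_fun a0 r s) \<ge> d} \<subseteq> N)"
  using \<open>e > 0\<close>
proof (induction as arbitrary: e)
  case Nil
  then show ?case by (intro exI[of _ "[]"] exI[of _ "{}"] conjI) auto
next
  case (Cons a as)
  obtain r N where r: "set r \<subseteq> set as \<times> rational_unions" and N: "N \<in> lmeasurable" "measure lebesgue N < e/2"
     "{s \<in> {t0..T}. (\<exists>a\<in>set as. dist (u s) a < d) \<and> dist (u s) (step_fun a0 r s) \<ge> d} \<subseteq> N"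
    using Cons.IH[of "e/2"] Cons.prems by auto
  define B where "B = {s \<in> {t0..T}. dist (u s) a < d}"
  have "{s \<in> space (lebesgue_on {t0..T}). dist (u s) a < d} \<in> sets (lebesgue_on {t0..T})"
    using u by measurable
  then have "B \<in> sets (lebesgue_on {t0..T})" by (simp add: B_def)
  then have "B \<in> sets lebesgue" by (subst (asm) sets_restrict_space_iff) auto
  then have Bl: "B \<in> lmeasurable" by (rule fmeasurableI2[OF lmeasurable_interval(1)[of t0 T], rotated]) (auto simp: B_def)
  obtain Q where Q: "Q \<in> rational_unions" and Ql: "Q \<in> lmeasurable" and Qm: "measure lebesgue ((B - Q) \<union> (Q - B)) < e/2"
    using rational_unions_approx[OF Bl, of "e/2"] Cons.prems by auto
  show ?case
  proof (intro exI[of _ "(a,Q) # r"] exI[of _ "((B - Q) \<union> (Q - B)) \<union> N"] conjI)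
    show "(B - Q) \<union> (Q - B) \<union> N \<in> lmeasurable"
      using Bl Ql N by (auto intro!: fmeasurable.Un fmeasurable.Diff)
    show "{s \<in> {t0..T}. (\<exists>a'\<in>set (a # as). dist (u s) a' < d) \<and> d \<le> dist (u s) (step_fun a0 ((a, Q) # r) s)}
      \<subseteq> (B - Q) \<union> (Q - B) \<union> N"
      using N(3) by (fastforce simp: B_def)
    show "set ((a, Q) # r) \<subseteq> set (a # as) \<times> rational_unions" using r Q by auto
    have "measure lebesgue ((B - Q) \<union> (Q - B) \<union> N) \<le> measure lebesgue ((B - Q) \<union> (Q - B)) + measure lebesgue N"
      using Bl Ql N by (intro measure_Un_le) (auto dest!: fmeasurableD)
    then show "measure lebesgue ((B - Q) \<union> (Q - B) \<union> N) < e" using N Qm by simp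
  qed
qed

text \<open>By compactness finitely many centres from a countable dense subset of \<open>A\<close>
  suffice. The step function with these centres is near \<open>u\<close> off a set of small measure,
  and on that set the distance is at most the diameter bound \<open>D\<close>.\<close>

lemma control_separable:
  fixes A :: "'a::euclidean_space set"
  assumes "compact A" "A \<noteq> {}"
  obtains d :: "nat \<Rightarrow> real \<Rightarrow> 'a" where "\<And>k. d k \<in> control_set t0 T A"
    "\<And>u e. u \<in> control_set t0 T A \<Longrightarrow> e > 0 \<Longrightarrow> \<exists>k. L1_dist t0 T u (d k) < e"
proof -
  obtain C where C: "countable C" "C \<subseteq> A" "A \<subseteq> closure C"
    using separable[of A] by metis
  obtain a0 where a0: "a0 \<in> A" using assms by auto
  define S where "S = (\<lambda>r. restrict (step_fun a0 r) {t0..T}) ` lists (C \<times> rational_unions)"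
  have Sc: "countable S" unfolding S_def
    using C(1) countable_rational_unions by (intro countable_image countable_lists countable_SIGMA) auto
  have Sn: "S \<noteq> {}" unfolding S_def by auto
  have Scs: "f \<in> control_set t0 T A" if "f \<in> S" for f
    using that C a0 unfolding S_def by (auto intro!: step_fun_control simp: lists_eq_set)
  have approx: "\<exists>f\<in>S. L1_dist t0 T u f < e" if u: "u \<in> control_set t0 T A" and e: "e > 0" for u e
  proof -
    obtain D0 where D0: "\<And>x y. x \<in> A \<Longrightarrow> y \<in> A \<Longrightarrow> dist x y \<le> D0"
      using compact_imp_bounded[OF assms(1)] by (meson bounded_two_points)
    define D where "D = max D0 1"
    have D: "D > 0" "\<And>x y. x \<in> A \<Longrightarrow> y \<in> A \<Longrightarrow> dist x y \<le> D"
      using D0 by (force simp: D_def)+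
    \<comment> \<open>The order of \<open>t0\<close> and \<open>T\<close> is not assumed, so this
      bound for the length of the interval is made positive in every case. The errors off and on the
      exceptional set are \<open>\<delta> * L = e / 4\<close> and
      \<open>D * (e / (4 * D)) = e / 4\<close>.\<close>
    define L where "L = \<bar>T - t0\<bar> + 1"
    define \<delta> where "\<delta> = e / (4 * L)"
    have L: "L > 0" by (auto simp: L_def)
    then have \<delta>: "\<delta> > 0" using e by (simp add: \<delta>_def)
    have "A \<subseteq> (\<Union>c\<in>C. ball c \<delta>)"
      using C(3) \<delta> by (fastforce simp: closure_approachable dist_commute)
    then obtain C' where C': "C' \<subseteq> C" "finite C'" "A \<subseteq> (\<Union>c\<in>C'. ball c \<delta>)"
      using compactE_image[OF assms(1), of C "\<lambda>c. ball c \<delta>"] by auto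
    obtain as where as: "set as = C'" using C'(2) finite_list by blast
    obtain r N where r: "set r \<subseteq> set as \<times> rational_unions" and N: "N \<in> lmeasurable" "measure lebesgue N < e / (4 * D)"
      "{s \<in> {t0..T}. (\<exists>a\<in>set as. dist (u s) a < \<delta>) \<and> dist (u s) (step_fun a0 r s) \<ge> \<delta>} \<subseteq> N"
      using step_fun_approx[OF control_set_measurable[OF u], of "e / (4 * D)" \<delta> as a0] e D \<delta> by auto
    let ?f = "restrict (step_fun a0 r) {t0..T}"
    have fS: "?f \<in> S" using r as C' unfolding S_def by (intro image_eqI[of _ _ r]) (auto simp: lists_eq_set)
    have fc: "?f \<in> control_set t0 T A" by (rule Scs[OF fS])
    let ?M = "lebesgue_on {t0..T}"
    interpret finite_measure ?M by simp
    have NM: "N \<inter> {t0..T} \<in> sets ?M" using N(1) by (auto simp: sets_restrict_space)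
    have "L1_dist t0 T u ?f \<le> (LINT s|?M. \<delta> + D * indicator (N \<inter> {t0..T}) s)"
      unfolding L1_dist_def
    proof (rule integral_mono)
      show "integrable ?M (\<lambda>s. dist (u s) (?f s))"
        by (rule integrable_control_dist[OF compact_imp_bounded[OF assms(1)] u fc])
      show "integrable ?M (\<lambda>s. \<delta> + D * indicator (N \<inter> {t0..T}) s)"
        using NM by (intro Bochner_Integration.integrable_add integrable_mult_right integrable_real_indicator)
           (auto simp: less_top[symmetric])
      fix s assume "s \<in> space ?M"
      then have s: "s \<in> {t0..T}" by simp
      show "dist (u s) (?f s) \<le> \<delta> + D * indicator (N \<inter> {t0..T}) s"
      proof (cases "s \<in> N")
        case True
        then show ?thesis using D(2)[of "u s" "?f s"] control_set_mem[OF u s] control_set_mem[OF fc s] \<delta> s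
          by (auto simp: indicator_def)
      next
        case False
        have "\<exists>a\<in>set as. dist (u s) a < \<delta>"
          using subsetD[OF C'(3) control_set_mem[OF u s]] as by (auto simp: dist_commute)
        then show ?thesis using False N(3) s by (auto simp: not_le intro: less_imp_le)
      qed
    qed
    also have "\<dots> = \<delta> * measure ?M {t0..T} + D * measure ?M (N \<inter> {t0..T})"
      using NM by (subst Bochner_Integration.integral_add) (auto simp: less_top[symmetric] intro!: integrable_mult_right integrable_real_indicator)
    also have "\<dots> \<le> \<delta> * L + D * (e / (4 * D))"
    proof (intro add_mono mult_left_mono)
      have "measure ?M (N \<inter> {t0..T}) = measure lebesgue (N \<inter> {t0..T})"
        by (rule measure_restrict_space) auto
      also have "\<dots> \<le> measure lebesgue N"
        using N(1) by (intro measure_mono_fmeasurable) auto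
      finally show "measure ?M (N \<inter> {t0..T}) \<le> e / (4 * D)" using N by simp
      show "measure ?M {t0..T} \<le> L"
        by (subst measure_restrict_space) (auto simp: L_def)
    qed (use \<delta> D in auto)
    also have "\<dots> < e" using L D e by (simp add: \<delta>_def)
    finally show ?thesis using fS by blast
  qed
  show ?thesis
  proof (rule that[of "from_nat_into S"])
    show "from_nat_into S k \<in> control_set t0 T A" for k
      using Scs from_nat_into[OF Sn] by auto
    fix u e assume "u \<in> control_set t0 T A" "(e::real) > 0"
    then obtain f where "f \<in> S" "L1_dist t0 T u f < e" using approx by blast
    moreover obtain k where "from_nat_into S k = f"
      using from_nat_into_surj[OF Sc \<open>f \<in> S\<close>] by blast
    ultimately show "\<exists>k. L1_dist t0 T u (from_nat_into S k) < e" by blast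
  qed
qed

text \<open>Measurable rounding of controls to a countable family. It makes evaluation at a fixed
  time measurable, which it is in general not on the control space itself, whose measurable sets do
  not distinguish a.e. equal controls.\<close>

lemma control_space_discretization:
  fixes A :: "'a::euclidean_space set"
  assumes "compact A" "A \<noteq> {}"
  obtains d :: "nat \<Rightarrow> real \<Rightarrow> 'a" and \<kappa> :: "nat \<Rightarrow> (real \<Rightarrow> 'a) \<Rightarrow> nat"
  where "\<And>k. d k \<in> control_set t0 T A"
    "\<And>n. \<kappa> n \<in> control_space t0 T A \<rightarrow>\<^sub>M count_space UNIV"
    "\<And>u n. u \<in> control_set t0 T A \<Longrightarrow> L1_dist t0 T u (d (\<kappa> n u)) < inverse (Suc n)"
proof -
  obtain d :: "nat \<Rightarrow> real \<Rightarrow> 'a" where d: "\<And>k. d k \<in> control_set t0 T A"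
    "\<And>u e. u \<in> control_set t0 T A \<Longrightarrow> e > 0 \<Longrightarrow> \<exists>k. L1_dist t0 T u (d k) < e"
    using control_separable[OF assms] by metis
  define \<kappa> where "\<kappa> n u = (LEAST k. L1_dist t0 T u (d k) < inverse (real (Suc n)))" for n u
  have [measurable]: "(\<lambda>u. L1_dist t0 T u (d k)) \<in> borel_measurable (control_space t0 T A)" for k
    using compact_imp_bounded[OF assms(1)] d by (intro L1_dist_measurable)
  show ?thesis
  proof (rule that[of d \<kappa>])
    show "\<kappa> n \<in> control_space t0 T A \<rightarrow>\<^sub>M count_space UNIV" for n
      unfolding \<kappa>_def by measurable
    show "L1_dist t0 T u (d (\<kappa> n u)) < inverse (Suc n)" if "u \<in> control_set t0 T A" for u n
      unfolding \<kappa>_def by (rule LeastI_ex) (use d(2)[OF that] in simp)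
  qed (rule d)
qed

text \<open>By separability every L1-open set is a countable union of balls around dense controls,
  so the distances to fixed controls already generate the \<sigma>-field.\<close>

lemma measurable_control_spaceI:
  fixes A :: "'a::euclidean_space set"
  assumes A: "compact A" "A \<noteq> {}"
    and f: "\<And>x. x \<in> space M \<Longrightarrow> f x \<in> control_set t0 T A"
    and m: "\<And>d. d \<in> control_set t0 T A \<Longrightarrow> (\<lambda>x. L1_dist t0 T (f x) d) \<in> borel_measurable M"
  shows "f \<in> M \<rightarrow>\<^sub>M control_space t0 T A"
  unfolding control_space_def
proof (rule measurable_measure_of)
  fix G assume "G \<in> {G. L1_open t0 T A G}"
  then have G: "L1_open t0 T A G" by simp
  obtain d :: "nat \<Rightarrow> real \<Rightarrow> 'a" where d: "\<And>k. d k \<in> control_set t0 T A"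
    "\<And>u e. u \<in> control_set t0 T A \<Longrightarrow> e > 0 \<Longrightarrow> \<exists>k. L1_dist t0 T u (d k) < e"
    using control_separable[OF A] by metis
  define I where "I = {(k, n::nat). {u \<in> control_set t0 T A. L1_dist t0 T u (d k) < inverse (Suc n)} \<subseteq> G}"
  have "f -` G \<inter> space M = (\<Union>z\<in>I. {x \<in> space M. L1_dist t0 T (f x) (d (fst z)) < inverse (Suc (snd z))})"
  proof (intro equalityI subsetI)
    fix x assume "x \<in> f -` G \<inter> space M"
    then have x: "x \<in> space M" "f x \<in> G" by auto
    obtain e where e: "e > 0" "\<forall>w\<in>control_set t0 T A. L1_dist t0 T (f x) w < e \<longrightarrow> w \<in> G"
      using G x by (auto simp: L1_open_def)
    obtain n :: nat where n: "inverse (Suc n) < e / 2" using e reals_Archimedean[of "e/2"] by auto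
    obtain k where k: "L1_dist t0 T (f x) (d k) < inverse (Suc n)"
      using d(2)[OF f[OF x(1)], of "inverse (Suc n)"] by auto
    have "(k, n) \<in> I" unfolding I_def
    proof safe
      fix w assume w: "w \<in> control_set t0 T A" "L1_dist t0 T w (d k) < inverse (Suc n)"
      have "L1_dist t0 T (f x) w \<le> L1_dist t0 T (f x) (d k) + L1_dist t0 T (d k) w"
        by (intro L1_dist_triangle[OF compact_imp_bounded[OF A(1)]] f x d w)
      then have "L1_dist t0 T (f x) w < e" using w k n by (simp add: L1_dist_commute)
      then show "w \<in> G" using e w by auto
    qed
    then show "x \<in> (\<Union>z\<in>I. {x \<in> space M. L1_dist t0 T (f x) (d (fst z)) < inverse (Suc (snd z))})"
      using k x by (intro UN_I[of "(k, n)"]) auto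
  next
    fix x assume "x \<in> (\<Union>z\<in>I. {x \<in> space M. L1_dist t0 T (f x) (d (fst z)) < inverse (Suc (snd z))})"
    then show "x \<in> f -` G \<inter> space M" using f by (force simp: I_def)
  qed
  also have "\<dots> \<in> sets M"
  proof (intro sets.countable_UN' image_subsetI)
    fix z :: "nat \<times> nat"
    have [measurable]: "(\<lambda>x. L1_dist t0 T (f x) (d (fst z))) \<in> borel_measurable M" by (rule m[OF d(1)])
    show "{x \<in> space M. L1_dist t0 T (f x) (d (fst z)) < inverse (Suc (snd z))} \<in> sets M"
      by measurable
  qed auto
  finally show "f -` G \<inter> space M \<in> sets M" .
qed (use f in \<open>auto simp: L1_open_def\<close>)

text \<open>The target is the product of the two \<sigma>-fields. Rounding both arguments turns
  \<open>F\<close> into a function of two measurable indices in a countable set, and by uniform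
  continuity these functions converge pointwise to \<open>F\<close>.\<close>

lemma L1_uniformly_continuous_measurable:
  fixes A :: "'a::euclidean_space set" and B :: "'b::euclidean_space set"
    and F :: "(real \<Rightarrow> 'a) \<Rightarrow> (real \<Rightarrow> 'b) \<Rightarrow> real"
  assumes A: "compact A" "A \<noteq> {}" and B: "compact B" "B \<noteq> {}"
    and F: "\<And>e. e > 0 \<Longrightarrow> \<exists>\<delta>>0. \<forall>u\<in>control_set t0 T A. \<forall>u'\<in>control_set t0 T A.
      \<forall>v\<in>control_set t0 T B. \<forall>v'\<in>control_set t0 T B.
      L1_dist t0 T u u' < \<delta> \<longrightarrow> L1_dist t0 T v v' < \<delta> \<longrightarrow> \<bar>F u v - F u' v'\<bar> < e"
  shows "(\<lambda>(u, v). F u v) \<in> borel_measurable (control_space t0 T A \<Otimes>\<^sub>M control_space t0 T B)"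
proof -
  obtain d1 :: "nat \<Rightarrow> real \<Rightarrow> 'a" and k1 where 1: "\<And>k. d1 k \<in> control_set t0 T A"
    and [measurable]: "\<And>n. k1 n \<in> control_space t0 T A \<rightarrow>\<^sub>M count_space UNIV"
    and 11: "\<And>u n. u \<in> control_set t0 T A \<Longrightarrow> L1_dist t0 T u (d1 (k1 n u)) < inverse (Suc n)"
    using control_space_discretization[OF A, of t0 T] by blast
  obtain d2 :: "nat \<Rightarrow> real \<Rightarrow> 'b" and k2 where 2: "\<And>k. d2 k \<in> control_set t0 T B"
    and [measurable]: "\<And>n. k2 n \<in> control_space t0 T B \<rightarrow>\<^sub>M count_space UNIV"
    and 22: "\<And>u n. u \<in> control_set t0 T B \<Longrightarrow> L1_dist t0 T u (d2 (k2 n u)) < inverse (Suc n)"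
    using control_space_discretization[OF B, of t0 T] by blast
  let ?M = "control_space t0 T A \<Otimes>\<^sub>M control_space t0 T B"
  show ?thesis
  proof (rule borel_measurable_LIMSEQ_real)
    show "(\<lambda>p. F (d1 (k1 n (fst p))) (d2 (k2 n (snd p)))) \<in> borel_measurable ?M" for n
    proof -
      have "(\<lambda>p. (\<lambda>(a,b). F (d1 a) (d2 b)) (k1 n (fst p), k2 n (snd p))) \<in> borel_measurable ?M"
        by (rule measurable_compose[where N="count_space UNIV \<Otimes>\<^sub>M count_space UNIV"], measurable)
      then show ?thesis by simp
    qed
    fix p assume "p \<in> space ?M"
    then have p: "fst p \<in> control_set t0 T A" "snd p \<in> control_set t0 T B"
      by (auto simp: space_pair_measure)
    show "(\<lambda>n. F (d1 (k1 n (fst p))) (d2 (k2 n (snd p)))) \<longlonglongrightarrow> (case p of (u, v) \<Rightarrow> F u v)"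
    proof (rule LIMSEQ_I)
      fix e :: real assume "e > 0"
      from F[OF this] obtain \<delta> where \<delta>: "\<delta> > 0" "\<forall>u\<in>control_set t0 T A. \<forall>u'\<in>control_set t0 T A.
        \<forall>v\<in>control_set t0 T B. \<forall>v'\<in>control_set t0 T B.
        L1_dist t0 T u u' < \<delta> \<longrightarrow> L1_dist t0 T v v' < \<delta> \<longrightarrow> \<bar>F u v - F u' v'\<bar> < e" by blast
      obtain m :: nat where m: "inverse (Suc m) < \<delta>" using \<delta> reals_Archimedean by blast
      show "\<exists>m. \<forall>n\<ge>m. norm (F (d1 (k1 n (fst p))) (d2 (k2 n (snd p))) - (case p of (u, v) \<Rightarrow> F u v)) < e"
      proof (intro exI[of _ m] allI impI)
        fix n assume "m \<le> n"
        then have "inverse (real (Suc n)) \<le> inverse (Suc m)" by (simp add: field_simps)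
        then have n: "inverse (Suc n) < \<delta>" using m by linarith
        have "\<bar>F (fst p) (snd p) - F (d1 (k1 n (fst p))) (d2 (k2 n (snd p)))\<bar> < e"
          using \<delta>(2) p 1 2 11[OF p(1), of n] 22[OF p(2), of n] n by (meson less_trans)
        then show "norm (F (d1 (k1 n (fst p))) (d2 (k2 n (snd p))) - (case p of (u, v) \<Rightarrow> F u v)) < e"
          by (simp add: case_prod_beta abs_minus_commute)
      qed
    qed
  qed
qed

section \<open>Delayed maps and their fixed points\<close>

lemma ae_eq_upto_iff:
  "ae_eq_upto t0 t u w \<longleftrightarrow> (AE s in lebesgue. t0 \<le> s \<and> s \<le> t \<longrightarrow> u s = w s)"
  unfolding ae_eq_upto_def by (subst AE_restrict_space_iff) auto

lemma ae_eq_upto_refl [simp]: "ae_eq_upto t0 t u u"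
  by (simp add: ae_eq_upto_def)

lemma ae_eq_upto_sym: "ae_eq_upto t0 t u w \<Longrightarrow> ae_eq_upto t0 t w u"
  unfolding ae_eq_upto_def by (erule eventually_mono) simp

lemma ae_eq_upto_trans [trans]:
  "ae_eq_upto t0 t u v \<Longrightarrow> ae_eq_upto t0 t v w \<Longrightarrow> ae_eq_upto t0 t u w"
  unfolding ae_eq_upto_def by (erule (1) eventually_elim2) simp

lemma ae_eq_upto_mono: "ae_eq_upto t0 t u w \<Longrightarrow> t' \<le> t \<Longrightarrow> ae_eq_upto t0 t' u w"
  unfolding ae_eq_upto_iff by (erule eventually_mono) auto

text \<open>The endpoint is a null set; equality on the half-open interval is what stopped paths and
  plans provide.\<close>

lemma ae_eq_uptoI:
  assumes "\<And>s. t0 \<le> s \<Longrightarrow> s < t \<Longrightarrow> u s = w s"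
  shows "ae_eq_upto t0 t u w"
proof -
  have "AE s in lebesgue. s \<noteq> t"
    by (rule AE_I[of _ _ "{t}"]) auto
  then show ?thesis unfolding ae_eq_upto_iff by eventually_elim (use assms in auto)
qed

lemma ae_eq_upto_start [simp]: "ae_eq_upto t0 t0 u w"
  by (rule ae_eq_uptoI) auto

definition time_partition :: "real \<Rightarrow> real \<Rightarrow> nat \<Rightarrow> (nat \<Rightarrow> real) \<Rightarrow> bool" where
  "time_partition t0 T k \<tau> \<longleftrightarrow> \<tau> 0 = t0 \<and> \<tau> k = T \<and> (\<forall>j<k. \<tau> j < \<tau> (Suc j))"

lemma time_partition_mono:
  assumes "time_partition t0 T k \<tau>" "m \<le> n" "n \<le> k"
  shows "\<tau> m \<le> \<tau> n"
  using assms(2,3)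
proof (induction n rule: dec_induct)
  case (step n)
  then have "\<tau> n < \<tau> (Suc n)" using assms(1) by (auto simp: time_partition_def)
  with step show ?case by auto
qed simp

text \<open>Delay for a single realisation of a random strategy. The partition is a parameter
  because it is common to all realisations.\<close>

definition delayed_map ::
  "real \<Rightarrow> (nat \<Rightarrow> real) \<Rightarrow> nat \<Rightarrow> (real \<Rightarrow> 'b) set \<Rightarrow> (real \<Rightarrow> 'a) set \<Rightarrow> ((real \<Rightarrow> 'b) \<Rightarrow> (real \<Rightarrow> 'a)) \<Rightarrow> bool" where
  "delayed_map t0 \<tau> k CB CA f \<longleftrightarrow> f \<in> CB \<rightarrow> CA \<and>
     (\<forall>v1\<in>CB. \<forall>v2\<in>CB. \<forall>j<k. ae_eq_upto t0 (\<tau> j) v1 v2 \<longrightarrow> ae_eq_upto t0 (\<tau> (Suc j)) (f v1) (f v2))"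

lemma delayed_map_in: "delayed_map t0 \<tau> k CB CA f \<Longrightarrow> v \<in> CB \<Longrightarrow> f v \<in> CA"
  by (auto simp: delayed_map_def)

lemma delayed_map_step:
  "delayed_map t0 \<tau> k CB CA f \<Longrightarrow> v1 \<in> CB \<Longrightarrow> v2 \<in> CB \<Longrightarrow> j < k \<Longrightarrow>
   ae_eq_upto t0 (\<tau> j) v1 v2 \<Longrightarrow> ae_eq_upto t0 (\<tau> (Suc j)) (f v1) (f v2)"
  by (auto simp: delayed_map_def)

text \<open>If \<open>t\<close> lies after \<open>\<tau> m\<close> and not after
  \<open>\<tau> (Suc m)\<close>, agreement up to \<open>t\<close> contains agreement up to
  \<open>\<tau> m\<close>, which the delay extends past \<open>t\<close>. The gain is given up, but
  \<open>t\<close> is now arbitrary and may come from the opponent's partition.\<close>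

lemma delayed_map_causal:
  assumes p: "time_partition t0 T k \<tau>" and f: "delayed_map t0 \<tau> k CB CA f"
    and v: "v1 \<in> CB" "v2 \<in> CB" and t: "t \<le> T" and eq: "ae_eq_upto t0 t v1 v2"
  shows "ae_eq_upto t0 t (f v1) (f v2)"
proof (cases "t \<le> t0")
  case True
  then show ?thesis using ae_eq_upto_mono[OF ae_eq_upto_start] by blast
next
  case False
  define j where "j = (LEAST j. t \<le> \<tau> j)"
  have ex: "t \<le> \<tau> k" using p t by (simp add: time_partition_def)
  have j: "t \<le> \<tau> j" unfolding j_def by (rule LeastI[of _ k]) (rule ex)
  have jk: "j \<le> k" unfolding j_def by (rule Least_le) (rule ex)
  have "j \<noteq> 0" using j False p by (metis time_partition_def)
  then obtain m where m: "j = Suc m" by (cases j) auto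
  have "\<not> t \<le> \<tau> m" using not_less_Least[of m "\<lambda>j. t \<le> \<tau> j"] m by (simp add: j_def)
  then have "ae_eq_upto t0 (\<tau> m) v1 v2" using ae_eq_upto_mono[OF eq] by simp
  then have "ae_eq_upto t0 (\<tau> j) (f v1) (f v2)"
    unfolding m using delayed_map_step[OF f v] jk m by auto
  then show ?thesis using ae_eq_upto_mono j by blast
qed

lemma delayed_map_const: "u \<in> CA \<Longrightarrow> delayed_map t0 \<tau> k CB CA (\<lambda>_. u)"
  by (simp add: delayed_map_def)

text \<open>Induction along the partition of \<open>a\<close> alone: the delay of \<open>a\<close>
  advances the agreement by one interval, while \<open>b\<close> has only to preserve it. No common
  refinement of the two partitions is required.\<close>

lemma delayed_fixed_point_unique:
  assumes p: "time_partition t0 T k \<tau>" and a: "delayed_map t0 \<tau> k CB CA a"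
    and p': "time_partition t0 T k' \<tau>'" and b: "delayed_map t0 \<tau>' k' CA CB b"
    and m: "u \<in> CA" "v \<in> CB" "ae_eq_upto t0 T (a v) u" "ae_eq_upto t0 T (b u) v"
    and m': "u' \<in> CA" "v' \<in> CB" "ae_eq_upto t0 T (a v') u'" "ae_eq_upto t0 T (b u') v'"
  shows "ae_eq_upto t0 T u u'" "ae_eq_upto t0 T v v'"
proof -
  have "ae_eq_upto t0 (\<tau> n) u u' \<and> ae_eq_upto t0 (\<tau> n) v v'" if "n \<le> k" for n
    using that
  proof (induction n)
    case 0
    then show ?case using p by (simp add: time_partition_def)
  next
    case (Suc n)
    have le: "\<tau> (Suc n) \<le> T" using time_partition_mono[OF p, of "Suc n" k] Suc p by (auto simp: time_partition_def)
    have "ae_eq_upto t0 (\<tau> (Suc n)) u (a v)" using ae_eq_upto_mono[OF ae_eq_upto_sym[OF m(3)] le] .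
    also have "ae_eq_upto t0 (\<tau> (Suc n)) (a v) (a v')"
      using Suc by (intro delayed_map_step[OF a m(2) m'(2)]) auto
    also have "ae_eq_upto t0 (\<tau> (Suc n)) (a v') u'" using ae_eq_upto_mono[OF m'(3) le] .
    finally have u: "ae_eq_upto t0 (\<tau> (Suc n)) u u'" .
    have "ae_eq_upto t0 (\<tau> (Suc n)) v (b u)" using ae_eq_upto_mono[OF ae_eq_upto_sym[OF m(4)] le] .
    also have "ae_eq_upto t0 (\<tau> (Suc n)) (b u) (b u')"
      by (rule delayed_map_causal[OF p' b m(1) m'(1) le u])
    also have "ae_eq_upto t0 (\<tau> (Suc n)) (b u') v'" using ae_eq_upto_mono[OF m'(4) le] .
    finally show ?case using u by simp
  qed
  from this[of k] show "ae_eq_upto t0 T u u'" "ae_eq_upto t0 T v v'"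
    using p by (auto simp: time_partition_def)
qed

text \<open>Iteration of the composed map: each application of \<open>a\<close> extends the stretch
  on which successive iterates agree by one interval of its partition, so after \<open>k\<close>
  rounds the iterate is a fixed point almost everywhere.\<close>

lemma delayed_fixed_point_exists:
  assumes p: "time_partition t0 T k \<tau>" and a: "delayed_map t0 \<tau> k CB CA a"
    and p': "time_partition t0 T k' \<tau>'" and b: "delayed_map t0 \<tau>' k' CA CB b"
    and "CB \<noteq> {}"
  obtains u v where "u \<in> CA" "v \<in> CB" "ae_eq_upto t0 T (a v) u" "ae_eq_upto t0 T (b u) v"
proof -
  obtain v0 where v0: "v0 \<in> CB" using \<open>CB \<noteq> {}\<close> by auto
  define w where "w n = ((\<lambda>v. b (a v)) ^^ n) v0" for n
  have wS: "w (Suc n) = b (a (w n))" for n by (simp add: w_def)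
  have w: "w n \<in> CB" for n
    by (induction n) (use v0 a b in \<open>auto simp: w_def delayed_map_def\<close>)
  have aw: "a (w n) \<in> CA" for n using delayed_map_in[OF a w] .
  have "ae_eq_upto t0 (\<tau> n) (w n) (w (Suc n))" if "n \<le> k" for n
    using that
  proof (induction n)
    case 0
    then show ?case using p by (simp add: time_partition_def)
  next
    case (Suc n)
    have le: "\<tau> (Suc n) \<le> T" using time_partition_mono[OF p, of "Suc n" k] Suc p by (auto simp: time_partition_def)
    have "ae_eq_upto t0 (\<tau> (Suc n)) (a (w n)) (a (w (Suc n)))"
      using Suc by (intro delayed_map_step[OF a w w]) auto
    from delayed_map_causal[OF p' b aw aw le this] show ?case by (simp only: wS)
  qed
  from this[of k] have "ae_eq_upto t0 T (w k) (b (a (w k)))" using p wS by (simp add: time_partition_def)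
  then have "ae_eq_upto t0 T (b (a (w k))) (w k)" by (rule ae_eq_upto_sym)
  then show ?thesis using that[of "a (w k)" "w k"] aw w by simp
qed

lemma rand_strategies_delayed:
  assumes "\<beta> \<in> rand_strategies E t0 T B A"
  obtains k \<tau> where "time_partition t0 T k \<tau>"
    "\<And>\<omega>. \<omega> \<in> space (fst \<beta>) \<Longrightarrow> delayed_map t0 \<tau> k (control_set t0 T B) (control_set t0 T A) (snd \<beta> \<omega>)"
proof -
  have "nonanticipative_with_delay t0 T B (space (fst \<beta>)) (snd \<beta>)"
    using assms by (auto simp: rand_strategies_def)
  then obtain k :: nat and \<tau> where *: "\<tau> 0 = t0" "\<tau> k = T" "\<forall>j<k. \<tau> j < \<tau> (Suc j)"
    "\<forall>\<omega>\<in>space (fst \<beta>). \<forall>v1\<in>control_set t0 T B. \<forall>v2\<in>control_set t0 T B. \<forall>j<k.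
        ae_eq_upto t0 (\<tau> j) v1 v2 \<longrightarrow> ae_eq_upto t0 (\<tau> (Suc j)) (snd \<beta> \<omega> v1) (snd \<beta> \<omega> v2)"
    unfolding nonanticipative_with_delay_def by (elim exE conjE) (rule that)
  have "snd \<beta> \<omega> v \<in> control_set t0 T A" if "\<omega> \<in> space (fst \<beta>)" "v \<in> control_set t0 T B" for \<omega> v
  proof -
    have "(\<lambda>(\<omega>, v). snd \<beta> \<omega> v) \<in> (fst \<beta> \<Otimes>\<^sub>M control_space t0 T B) \<rightarrow>\<^sub>M control_space t0 T A"
      using assms by (auto simp: rand_strategies_def)
    from measurable_space[OF this, of "(\<omega>, v)"] show ?thesis
      using that by (auto simp: space_pair_measure)
  qed
  then have "delayed_map t0 \<tau> k (control_set t0 T B) (control_set t0 T A) (snd \<beta> \<omega>)"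
    if "\<omega> \<in> space (fst \<beta>)" for \<omega>
    unfolding delayed_map_def using that *(4) by simp
  then show ?thesis using * by (intro that[of k \<tau>]) (simp_all add: time_partition_def)
qed

lemma outcome_spec:
  assumes p: "time_partition t0 T k \<tau>" and a: "delayed_map t0 \<tau> k (control_set t0 T V) (control_set t0 T U) a"
    and p': "time_partition t0 T k' \<tau>'" and b: "delayed_map t0 \<tau>' k' (control_set t0 T U) (control_set t0 T V) b"
    and ne: "control_set t0 T V \<noteq> {}"
  obtains u v where "outcome t0 T U V a b = (u, v)" "u \<in> control_set t0 T U" "v \<in> control_set t0 T V"
    "ae_eq_upto t0 T (a v) u" "ae_eq_upto t0 T (b u) v"
    "\<And>u' v'. u' \<in> control_set t0 T U \<Longrightarrow> v' \<in> control_set t0 T V \<Longrightarrow>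
       ae_eq_upto t0 T (a v') u' \<Longrightarrow> ae_eq_upto t0 T (b u') v' \<Longrightarrow>
       ae_eq_upto t0 T u u' \<and> ae_eq_upto t0 T v v'"
proof -
  let ?P = "\<lambda>(u, v). u \<in> control_set t0 T U \<and> v \<in> control_set t0 T V \<and>
     ae_eq_upto t0 T (a v) u \<and> ae_eq_upto t0 T (b u) v"
  obtain u v where "?P (u, v)"
    by (rule delayed_fixed_point_exists[OF p a p' b ne]) (auto simp: case_prod_conv)
  then have "\<exists>x. ?P x" by blast
  then have "?P (outcome t0 T U V a b)" unfolding outcome_def by (rule someI_ex)
  then obtain u v where o: "outcome t0 T U V a b = (u, v)" and uv: "u \<in> control_set t0 T U" "v \<in> control_set t0 T V"
    "ae_eq_upto t0 T (a v) u" "ae_eq_upto t0 T (b u) v"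
    by (cases "outcome t0 T U V a b") auto
  show ?thesis
    by (rule that[OF o uv]) (rule conjI; rule delayed_fixed_point_unique[OF p a p' b uv]; assumption)
qed

lemma const_control: "a \<in> A \<Longrightarrow> restrict (\<lambda>_. a) {t0..T} \<in> control_set t0 T A"
proof (rule control_setI)
  show "restrict (\<lambda>_. a) {t0..T} \<in> borel_measurable (lebesgue_on {t0..T})"
    by (rule measurable_cong[THEN iffD1, of _ "\<lambda>_. a"]) auto
qed auto

section \<open>Payoffs and the Hamiltonian\<close>

text \<open>The bounds by \<open>c\<close> guarantee that the infima and suprema of reals are
  meaningful. With \<open>e\<close> a modulus of continuity it yields continuity of the Hamiltonian;
  against a zero payoff it yields its bound.\<close>

lemma INF_SUP_diff_le:
  fixes f g :: "'a \<Rightarrow> 'b \<Rightarrow> real"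
  assumes ne: "U \<noteq> {}" "V \<noteq> {}" 
    and f: "\<And>u v. u \<in> U \<Longrightarrow> v \<in> V \<Longrightarrow> \<bar>f u v\<bar> \<le> c" and g: "\<And>u v. u \<in> U \<Longrightarrow> v \<in> V \<Longrightarrow> \<bar>g u v\<bar> \<le> c"
    and fg: "\<And>u v. u \<in> U \<Longrightarrow> v \<in> V \<Longrightarrow> f u v \<le> g u v + e"
  shows "(INF u\<in>U. SUP v\<in>V. f u v) \<le> (INF u\<in>U. SUP v\<in>V. g u v) + e"
proof -
  have bf: "bdd_above (f u ` V)" and bg: "bdd_above (g u ` V)" if "u \<in> U" for u
    using f[OF that] g[OF that] by (auto intro!: bdd_aboveI[of _ c] dest: abs_le_D1)
  have lo: "- c \<le> (SUP v\<in>V. f u v)" if "u \<in> U" for u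
  proof -
    obtain v where "v \<in> V" using ne by auto
    then have "- c \<le> f u v" using f[OF that \<open>v \<in> V\<close>] by linarith
    also have "\<dots> \<le> (SUP v\<in>V. f u v)" by (rule cSUP_upper[OF \<open>v \<in> V\<close> bf[OF that]])
    finally show ?thesis .
  qed
  have "(INF u\<in>U. SUP v\<in>V. f u v) - e \<le> (INF u\<in>U. SUP v\<in>V. g u v)"
  proof (rule cINF_greatest[OF ne(1)])
    fix u assume u: "u \<in> U"
    have "(INF u\<in>U. SUP v\<in>V. f u v) \<le> (SUP v\<in>V. f u v)"
      using lo by (intro cINF_lower[OF bdd_belowI[of _ "-c"] u]) auto
    also have "\<dots> \<le> (SUP v\<in>V. g u v) + e"
    proof (rule cSUP_least[OF ne(2)])
      fix v assume v: "v \<in> V"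
      have "g u v \<le> (SUP v\<in>V. g u v)" by (rule cSUP_upper[OF v bg[OF u]])
      then show "f u v \<le> (SUP v\<in>V. g u v) + e" using fg[OF u v] by linarith
    qed
    finally show "(INF u\<in>U. SUP v\<in>V. f u v) - e \<le> (SUP v\<in>V. g u v)" by simp
  qed
  then show ?thesis by simp
qed

locale game =
  fixes l :: "'i::finite \<Rightarrow> real \<Rightarrow> 'a::euclidean_space \<Rightarrow> 'b::euclidean_space \<Rightarrow> real"
    and U :: "'a set" and V :: "'b set" and T t0 :: real
  assumes U: "compact U" "U \<noteq> {}" and V: "compact V" "V \<noteq> {}"
    and l_cont: "\<And>i. continuous_on ({0..T} \<times> U \<times> V) (\<lambda>(t, u, v). l i t u v)"
    and t0: "0 \<le> t0" "t0 < T"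
begin

abbreviation ctlU :: "(real \<Rightarrow> 'a) set" where "ctlU \<equiv> control_set t0 T U"
abbreviation ctlV :: "(real \<Rightarrow> 'b) set" where "ctlV \<equiv> control_set t0 T V"
abbreviation spU :: "(real \<Rightarrow> 'a) measure" where "spU \<equiv> control_space t0 T U"
abbreviation spV :: "(real \<Rightarrow> 'b) measure" where "spV \<equiv> control_space t0 T V"
abbreviation timeM :: "real measure" where "timeM \<equiv> lebesgue_on {t0..T}"

lemma ctlV_nonempty: "ctlV \<noteq> {}"
  using V const_control by (metis empty_iff equals0I)

lemma l_measurable:
  assumes "f \<in> borel_measurable M" "a \<in> borel_measurable M" "b \<in> borel_measurable M"
    and "\<And>x. x \<in> space M \<Longrightarrow> f x \<in> {0..T} \<and> a x \<in> U \<and> b x \<in> V"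
  shows "(\<lambda>x. l i (f x) (a x) (b x)) \<in> borel_measurable M"
proof -
  have "(\<lambda>x. (f x, a x, b x)) \<in> M \<rightarrow>\<^sub>M restrict_space borel ({0..T} \<times> U \<times> V)"
    using assms by (intro measurable_restrict_space2 borel_measurable_Pair) auto
  from measurable_compose[OF this borel_measurable_continuous_on_restrict[OF l_cont[of i]]]
  show ?thesis by simp
qed

definition lbound :: real where
  "lbound = (SOME C. C > 0 \<and> (\<forall>i. \<forall>s\<in>{0..T}. \<forall>u\<in>U. \<forall>v\<in>V. \<bar>l i s u v\<bar> \<le> C))"

lemma lbound: "lbound > 0" "s \<in> {0..T} \<Longrightarrow> u \<in> U \<Longrightarrow> v \<in> V \<Longrightarrow> \<bar>l i s u v\<bar> \<le> lbound"
proof -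
  have cpt: "compact ({0..T} \<times> U \<times> V)" using U V by (intro compact_Times) auto
  have "\<exists>C. \<forall>s\<in>{0..T}. \<forall>u\<in>U. \<forall>v\<in>V. \<bar>l i s u v\<bar> \<le> C" for i
  proof -
    have "bounded ((\<lambda>(t, u, v). l i t u v) ` ({0..T} \<times> U \<times> V))"
      by (intro compact_imp_bounded compact_continuous_image l_cont cpt)
    then obtain C where "\<forall>y\<in>(\<lambda>(t, u, v). l i t u v) ` ({0..T} \<times> U \<times> V). \<bar>y\<bar> \<le> C"
      by (auto simp: bounded_real)
    then show ?thesis by (intro exI[of _ C]) force
  qed
  then obtain C where C: "\<And>i. \<forall>s\<in>{0..T}. \<forall>u\<in>U. \<forall>v\<in>V. \<bar>l i s u v\<bar> \<le> C i" by metis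
  define C' where "C' = 1 + (\<Sum>i\<in>UNIV. \<bar>C i\<bar>)"
  have CC: "C i \<le> C'" for i
  proof -
    have "\<bar>C i\<bar> \<le> (\<Sum>i\<in>UNIV. \<bar>C i\<bar>)" by (rule member_le_sum) auto
    then show ?thesis by (simp add: C'_def)
  qed
  have C'0: "C' > 0" by (simp add: C'_def add_pos_nonneg sum_nonneg)
  have "\<forall>i. \<forall>s\<in>{0..T}. \<forall>u\<in>U. \<forall>v\<in>V. \<bar>l i s u v\<bar> \<le> C'"
    using C CC by (meson order_trans)
  then have "\<exists>C. C > 0 \<and> (\<forall>i. \<forall>s\<in>{0..T}. \<forall>u\<in>U. \<forall>v\<in>V. \<bar>l i s u v\<bar> \<le> C)" using C'0 by blast
  from someI_ex[OF this] show "lbound > 0" "s \<in> {0..T} \<Longrightarrow> u \<in> U \<Longrightarrow> v \<in> V \<Longrightarrow> \<bar>l i s u v\<bar> \<le> lbound"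
    unfolding lbound_def by auto
qed

lemma l_uniformly_continuous:
  assumes "e > 0"
  obtains \<delta> where "\<delta> > 0" "\<And>i s s' u u' v v'. s \<in> {0..T} \<Longrightarrow> s' \<in> {0..T} \<Longrightarrow> u \<in> U \<Longrightarrow> u' \<in> U \<Longrightarrow>
    v \<in> V \<Longrightarrow> v' \<in> V \<Longrightarrow> \<bar>s - s'\<bar> < \<delta> \<Longrightarrow> dist u u' < \<delta> \<Longrightarrow> dist v v' < \<delta> \<Longrightarrow>
    \<bar>l i s u v - l i s' u' v'\<bar> < e"
proof -
  have cpt: "compact ({0..T} \<times> U \<times> V)" using U V by (intro compact_Times) auto
  have "\<exists>\<delta>>0. \<forall>x\<in>{0..T} \<times> U \<times> V. \<forall>y\<in>{0..T} \<times> U \<times> V. dist y x < \<delta> \<longrightarrow>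
     dist ((\<lambda>(t, u, v). l i t u v) y) ((\<lambda>(t, u, v). l i t u v) x) < e" for i
    using compact_uniformly_continuous[OF l_cont[of i] cpt] assms
    unfolding uniformly_continuous_on_def by blast
  then obtain d where d0: "\<And>i. d i > 0" and d: "\<And>i x y. x\<in>{0..T} \<times> U \<times> V \<Longrightarrow> y\<in>{0..T} \<times> U \<times> V \<Longrightarrow> dist y x < d i \<Longrightarrow>
     dist ((\<lambda>(t, u, v). l i t u v) y) ((\<lambda>(t, u, v). l i t u v) x) < e" by metis
  \<comment> \<open>The product distance is at most the sum of the three coordinate distances, and
    \<open>3 * \<delta> < 4 * \<delta>\<close>; the minimum makes \<open>\<delta>\<close> common to
    all types.\<close>
  define \<delta> where "\<delta> = Min (range d) / 4"
  have \<delta>: "\<delta> > 0" "4 * \<delta> \<le> d i" for i using d0 by (auto simp: \<delta>_def)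
  show ?thesis
  proof (rule that[OF \<delta>(1)])
    fix i s s' u u' v v' assume *: "s \<in> {0..T}" "s' \<in> {0..T}" "u \<in> U" "u' \<in> U"
      "v \<in> V" "v' \<in> V" "\<bar>s - s'\<bar> < \<delta>" "dist u u' < \<delta>" "dist v v' < \<delta>"
    have "dist (s, u, v) (s', u', v') \<le> dist s s' + (dist u u' + dist v v')"
      unfolding dist_Pair_Pair
      by (intro order_trans[OF sqrt_sum_squares_le_sum] add_mono order_refl) auto
    also have "\<dots> < d i" using * \<delta>(2)[of i] \<delta>(1) by (simp add: dist_real_def)
    finally show "\<bar>l i s u v - l i s' u' v'\<bar> < e"
      using d[of "(s', u', v')" "(s, u, v)" i] * by (simp add: dist_real_def)
  qed
qed

section \<open>Payoffs collected over a set of times\<close>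

definition pay :: "'i \<Rightarrow> real set \<Rightarrow> (real \<Rightarrow> 'a) \<Rightarrow> (real \<Rightarrow> 'b) \<Rightarrow> real" where
  "pay i S u v = (LINT s|timeM. indicator S s * l i s (u s) (v s))"

lemma time_ident_measurable [measurable]: "(\<lambda>s. s) \<in> borel_measurable timeM"
  by (intro measurable_restrict_space1 measurable_completion) auto

lemma indicator_time_measurable [measurable]: "S \<in> sets borel \<Longrightarrow> indicator S \<in> borel_measurable timeM"
  by (intro measurable_restrict_space1 measurable_completion) auto

lemma pay_integrand_measurable [measurable]:
  assumes "u \<in> ctlU" "v \<in> ctlV"
  shows "(\<lambda>s. l i s (u s) (v s)) \<in> borel_measurable timeM"
  using t0 control_set_mem[OF assms(1)] control_set_mem[OF assms(2)]
  by (intro l_measurable time_ident_measurable control_set_measurable[OF assms(1)] control_set_measurable[OF assms(2)]) auto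

lemma l_ctl_bound: "u \<in> ctlU \<Longrightarrow> v \<in> ctlV \<Longrightarrow> s \<in> {t0..T} \<Longrightarrow> \<bar>l i s (u s) (v s)\<bar> \<le> lbound"
  using t0 by (intro lbound) (auto simp: control_set_mem)

lemma pay_integrable:
  assumes "u \<in> ctlU" "v \<in> ctlV" and [measurable]: "S \<in> sets borel"
  shows "integrable timeM (\<lambda>s. indicator S s * l i s (u s) (v s))"
proof (rule integrable_bounded_on_Icc[where C=lbound])
  note [measurable] = pay_integrand_measurable[OF assms(1,2)]
  show "(\<lambda>s. indicator S s * l i s (u s) (v s)) \<in> borel_measurable timeM" by measurable
qed (use l_ctl_bound[OF assms(1,2)] lbound(1) in \<open>auto simp: indicator_def\<close>)

lemma pay_interval_bound:
  assumes "u \<in> ctlU" "v \<in> ctlV" "t0 \<le> a" "a \<le> b" "b \<le> T"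
  shows "\<bar>pay i {a..<b} u v\<bar> \<le> lbound * (b - a)"
proof -
  interpret finite_measure timeM by simp
  have [simp]: "{a..<b} \<in> sets timeM" by (subst sets_restrict_space_iff) (use assms in auto)
  have "\<bar>pay i {a..<b} u v\<bar> \<le> (LINT s|timeM. lbound * indicator {a..<b} s)"
    unfolding pay_def
    using l_ctl_bound[OF assms(1,2)]
    by (intro integral_abs_bound_integral pay_integrable assms integrable_mult_right integrable_real_indicator)
       (auto simp: indicator_def less_top[symmetric])
  also have "\<dots> = lbound * measure timeM ({a..<b} \<inter> {t0..T})" by simp
  also have "measure timeM ({a..<b} \<inter> {t0..T}) = measure lebesgue ({a..<b} \<inter> {t0..T})"
    by (rule measure_restrict_space) auto
  also have "{a..<b} \<inter> {t0..T} = {a..<b}" using assms by auto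
  finally show ?thesis using assms by simp
qed

lemma pay_bound:
  assumes "u \<in> ctlU" "v \<in> ctlV" and [measurable]: "S \<in> sets borel"
  shows "\<bar>pay i S u v\<bar> \<le> lbound * (T - t0)"
proof -
  have "\<bar>pay i S u v\<bar> \<le> (LINT s|timeM. lbound)"
    unfolding pay_def
    using l_ctl_bound[OF assms(1,2)] lbound(1)
    by (intro integral_abs_bound_integral pay_integrable assms)
       (auto simp: indicator_def)
  also have "\<dots> = lbound * (T - t0)"
    using t0 by (simp add: measure_restrict_space mult.commute)
  finally show ?thesis .
qed

lemma pay_cong:
  assumes "ae_eq_upto t0 t u u'" "ae_eq_upto t0 t v v'" "S \<subseteq> {..t}" "t \<le> T"
    "u \<in> ctlU" "v \<in> ctlV" "u' \<in> ctlU" "v' \<in> ctlV" "S \<in> sets borel"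
  shows "pay i S u v = pay i S u' v'"
  unfolding pay_def
proof (rule integral_cong_AE)
  have "AE s in lebesgue. s \<in> {t0..T} \<longrightarrow> indicator S s * l i s (u s) (v s) = indicator S s * l i s (u' s) (v' s)"
    using assms(1,2) unfolding ae_eq_upto_iff
  proof eventually_elim
    case (elim s)
    then show ?case using assms(3) by (auto simp: indicator_def)
  qed
  then show "AE s in timeM. indicator S s * l i s (u s) (v s) = indicator S s * l i s (u' s) (v' s)"
    by (subst AE_restrict_space_iff) auto
qed (use assms in \<open>auto intro!: borel_measurable_integrable[OF pay_integrable]\<close>)

lemma pay_drop_endpoint:
  "pay i {t0..<T} u v = pay i UNIV u v" if "u \<in> ctlU" "v \<in> ctlV"
  unfolding pay_def
proof (rule integral_cong_AE)
  have "AE s in lebesgue. s \<noteq> T" by (rule AE_I[of _ _ "{T}"]) auto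
  then show "AE s in timeM. indicator {t0..<T} s * l i s (u s) (v s) = indicator UNIV s * l i s (u s) (v s)"
    by (subst AE_restrict_space_iff, simp, elim eventually_mono) (auto simp: indicator_def)
qed (use that in \<open>auto intro!: borel_measurable_integrable[OF pay_integrable]\<close>)

lemma pay_split:
  assumes "u \<in> ctlU" "v \<in> ctlV" "a \<le> b" "b \<le> c"
  shows "pay i {a..<c} u v = pay i {a..<b} u v + pay i {b..<c} u v"
proof -
  have "indicator {a..<c} s = (indicator {a..<b} s + indicator {b..<c} s :: real)" for s
    using assms by (auto simp: indicator_def)
  then show ?thesis unfolding pay_def
    using assms by (simp add: distrib_right pay_integrable)
qed

text \<open>Where both pairs of controls are within \<open>d\<close>, uniform continuity of the
  payoff rates applies. Elsewhere the rates differ by at most \<open>2 * lbound = K * d\<close>,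
  which is dominated by \<open>K\<close> times the distance of the controls, as in Markov's
  inequality.\<close>

lemma pay_uniformly_continuous:
  assumes "e > 0" and S[measurable]: "S \<in> sets borel"
  shows "\<exists>\<delta>>0. \<forall>u\<in>ctlU. \<forall>u'\<in>ctlU. \<forall>v\<in>ctlV. \<forall>v'\<in>ctlV.
      L1_dist t0 T u u' < \<delta> \<longrightarrow> L1_dist t0 T v v' < \<delta> \<longrightarrow> \<bar>pay i S u v - pay i S u' v'\<bar> < e"
proof -
  define L where "L = T - t0"
  have L: "L > 0" using t0 by (simp add: L_def)
  obtain d where d: "d > 0" and ld: "\<And>i s s' u u' v v'. s \<in> {0..T} \<Longrightarrow> s' \<in> {0..T} \<Longrightarrow> u \<in> U \<Longrightarrow> u' \<in> U \<Longrightarrow>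
    v \<in> V \<Longrightarrow> v' \<in> V \<Longrightarrow> \<bar>s - s'\<bar> < d \<Longrightarrow> dist u u' < d \<Longrightarrow> dist v v' < d \<Longrightarrow>
    \<bar>l i s u v - l i s' u' v'\<bar> < e / (2 * L)"
    using l_uniformly_continuous[of "e / (2 * L)"] assms(1) L by auto
  define K where "K = 2 * lbound / d"
  have K: "K > 0" using d lbound(1) by (simp add: K_def)
  define \<delta> where "\<delta> = e / (4 * K)"
  show ?thesis
  proof (intro exI[of _ \<delta>] conjI ballI impI)
    show "\<delta> > 0" using K assms(1) by (simp add: \<delta>_def)
    fix u u' v v' assume m: "u \<in> ctlU" "u' \<in> ctlU" "v \<in> ctlV" "v' \<in> ctlV"
      and dd: "L1_dist t0 T u u' < \<delta>" "L1_dist t0 T v v' < \<delta>"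
    note iu = integrable_control_dist[OF compact_imp_bounded[OF U(1)] m(1,2)]
    note iv = integrable_control_dist[OF compact_imp_bounded[OF V(1)] m(3,4)]
    have "\<bar>pay i S u v - pay i S u' v'\<bar> = \<bar>LINT s|timeM. indicator S s * l i s (u s) (v s) - indicator S s * l i s (u' s) (v' s)\<bar>"
      unfolding pay_def using m by (subst Bochner_Integration.integral_diff) (auto intro: pay_integrable)
    also have "\<dots> \<le> (LINT s|timeM. e / (2 * L) + (K * dist (u s) (u' s) + K * dist (v s) (v' s)))"
    proof (rule integral_abs_bound_integral)
      show "integrable timeM (\<lambda>s. indicator S s * l i s (u s) (v s) - indicator S s * l i s (u' s) (v' s))"
        using m by (intro Bochner_Integration.integrable_diff pay_integrable) auto
      show "integrable timeM (\<lambda>s. e / (2 * L) + (K * dist (u s) (u' s) + K * dist (v s) (v' s)))"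
        using iu iv by auto
      fix s assume "s \<in> space timeM"
      then have s: "s \<in> {t0..T}" "s \<in> {0..T}" using t0 by auto
      note mm = control_set_mem[OF m(1) s(1)] control_set_mem[OF m(2) s(1)] control_set_mem[OF m(3) s(1)] control_set_mem[OF m(4) s(1)]
      have "\<bar>l i s (u s) (v s) - l i s (u' s) (v' s)\<bar> \<le> e / (2 * L) + (K * dist (u s) (u' s) + K * dist (v s) (v' s))"
      proof (cases "dist (u s) (u' s) < d \<and> dist (v s) (v' s) < d")
        case True
        then have "\<bar>l i s (u s) (v s) - l i s (u' s) (v' s)\<bar> < e / (2 * L)"
          using d by (intro ld s mm) auto
        moreover have "0 \<le> K * dist (u s) (u' s) + K * dist (v s) (v' s)" using K by simp
        ultimately show ?thesis by linarith
      next
        case False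
        have "\<bar>l i s (u s) (v s) - l i s (u' s) (v' s)\<bar> \<le> 2 * lbound"
          using lbound(2)[OF s(2) mm(1) mm(3), of i] lbound(2)[OF s(2) mm(2) mm(4), of i] by linarith
        also have "2 * lbound = K * d" using d by (simp add: K_def)
        also have "\<dots> \<le> K * (dist (u s) (u' s) + dist (v s) (v' s))"
          using K False by (intro mult_left_mono) (smt (verit) zero_le_dist)+
        also have "\<dots> \<le> e / (2 * L) + K * (dist (u s) (u' s) + dist (v s) (v' s))" using L assms(1) by simp
        finally show ?thesis by (simp add: distrib_left)
      qed
      then show "\<bar>indicator S s * l i s (u s) (v s) - indicator S s * l i s (u' s) (v' s)\<bar>
          \<le> e / (2 * L) + (K * dist (u s) (u' s) + K * dist (v s) (v' s))"
        using L K assms(1) by (auto simp: indicator_def)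
    qed
    also have "\<dots> = e / 2 + (K * L1_dist t0 T u u' + K * L1_dist t0 T v v')"
    proof -
      have "measure timeM {t0..T} = L" using t0 by (simp add: measure_restrict_space L_def)
      then show ?thesis unfolding L1_dist_def using iu iv L by simp
    qed
    also have "\<dots> < e / 2 + (K * \<delta> + K * \<delta>)"
      using dd K by (intro add_strict_left_mono add_strict_mono mult_strict_left_mono)
    also have "\<dots> = e" using K by (simp add: \<delta>_def)
    finally show "\<bar>pay i S u v - pay i S u' v'\<bar> < e" .
  qed
qed

lemma pay_measurable:
  assumes "S \<in> sets borel"
  shows "(\<lambda>(u, v). pay i S u v) \<in> borel_measurable (spU \<Otimes>\<^sub>M spV)"
  by (rule L1_uniformly_continuous_measurable[OF U V]) (rule pay_uniformly_continuous[OF _ assms])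

lemma pay_measurable_left:
  assumes "S \<in> sets borel" "v \<in> ctlV"
  shows "(\<lambda>u. pay i S u v) \<in> borel_measurable spU"
  using measurable_compose[OF measurable_Pair2', OF _ pay_measurable[OF assms(1), of i], of v] assms
  by simp

section \<open>The Hamiltonian and Isaacs' condition\<close>

abbreviation H :: "real \<Rightarrow> real ^ 'i \<Rightarrow> real" where "H \<equiv> hamiltonian U V l"

definition mixed :: "real \<Rightarrow> real ^ 'i \<Rightarrow> 'a \<Rightarrow> 'b \<Rightarrow> real" where
  "mixed s p u v = (\<Sum>i\<in>UNIV. p $ i * l i s u v)"

lemma H_eq: "H s p = (INF u\<in>U. SUP v\<in>V. mixed s p u v)"
  by (simp add: hamiltonian_def mixed_def)

lemma simplex_sum_le:
  assumes "p \<in> prob_simplex" "\<And>i. f i \<le> c"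
  shows "(\<Sum>i\<in>UNIV. p $ i * f i) \<le> (c::real)"
proof -
  have "(\<Sum>i\<in>UNIV. p $ i * f i) \<le> (\<Sum>i\<in>UNIV. p $ i * c)"
    using assms by (intro sum_mono mult_left_mono) (auto simp: prob_simplex_def)
  then show ?thesis using assms by (simp add: prob_simplex_def sum_distrib_right[symmetric])
qed

lemma simplex_sum_abs_le:
  assumes "p \<in> prob_simplex" "\<And>i. \<bar>f i\<bar> \<le> c"
  shows "\<bar>\<Sum>i\<in>UNIV. p $ i * f i\<bar> \<le> (c::real)"
proof -
  have "(\<Sum>i\<in>UNIV. p $ i * - f i) \<le> c" "(\<Sum>i\<in>UNIV. p $ i * f i) \<le> c"
    using assms(2) by (intro simplex_sum_le assms(1); force simp: abs_le_iff)+
  then show ?thesis by (simp add: sum_negf abs_le_iff)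
qed

lemma mixed_bound:
  "p \<in> prob_simplex \<Longrightarrow> s \<in> {0..T} \<Longrightarrow> u \<in> U \<Longrightarrow> v \<in> V \<Longrightarrow> \<bar>mixed s p u v\<bar> \<le> lbound"
  unfolding mixed_def by (intro simplex_sum_abs_le lbound)

lemma mixed_le_SUP:
  "p \<in> prob_simplex \<Longrightarrow> s \<in> {0..T} \<Longrightarrow> u \<in> U \<Longrightarrow> v \<in> V \<Longrightarrow> mixed s p u v \<le> (SUP v\<in>V. mixed s p u v)"
  by (rule cSUP_upper) (auto intro!: bdd_aboveI[of _ lbound] dest: mixed_bound simp: abs_le_iff)

lemma H_bound:
  assumes "p \<in> prob_simplex" "s \<in> {0..T}"
  shows "\<bar>H s p\<bar> \<le> lbound"
proof -
  have b: "- lbound \<le> mixed s p u v" "mixed s p u v \<le> lbound" if "u \<in> U" "v \<in> V" for u v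
    using mixed_bound[OF assms that] by linarith+
  have "H s p \<le> (INF u\<in>U. SUP v\<in>V. (0::real)) + lbound"
    unfolding H_eq by (rule INF_SUP_diff_le[OF U(2) V(2), where c=lbound])
      (use b lbound(1) in \<open>force simp: abs_le_iff\<close>)+
  moreover have "(INF u\<in>U. SUP v\<in>V. (0::real)) \<le> H s p + lbound"
    unfolding H_eq by (rule INF_SUP_diff_le[OF U(2) V(2), where c=lbound])
      (use b lbound(1) in \<open>force simp: abs_le_iff\<close>)+
  ultimately show ?thesis using U V by simp
qed

lemma H_uniformly_continuous:
  assumes "e > 0"
  obtains \<delta> where "\<delta> > 0" "\<And>s s' p p'. s \<in> {0..T} \<Longrightarrow> s' \<in> {0..T} \<Longrightarrow> p \<in> prob_simplex \<Longrightarrow> p' \<in> prob_simplex \<Longrightarrow>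
    \<bar>s - s'\<bar> < \<delta> \<Longrightarrow> dist p p' < \<delta> \<Longrightarrow> \<bar>H s p - H s' p'\<bar> \<le> e"
proof -
  obtain d where d: "d > 0" and ld: "\<And>i s s' u u' v v'. s \<in> {0..T} \<Longrightarrow> s' \<in> {0..T} \<Longrightarrow> u \<in> U \<Longrightarrow> u' \<in> U \<Longrightarrow>
    v \<in> V \<Longrightarrow> v' \<in> V \<Longrightarrow> \<bar>s - s'\<bar> < d \<Longrightarrow> dist u u' < d \<Longrightarrow> dist v v' < d \<Longrightarrow>
    \<bar>l i s u v - l i s' u' v'\<bar> < e / 2"
    using l_uniformly_continuous[of "e / 2"] assms(1) by auto
  define n where "n = real CARD('i)"
  have n: "n > 0" by (simp add: n_def)
  \<comment> \<open>Half of \<open>e\<close> pays for the change of time. The other half pays for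
    the change of belief: each of the \<open>n\<close> components moves by at most
    \<open>e / (2 * lbound * n)\<close> and is multiplied by a rate bounded by
    \<open>lbound\<close>.\<close>
  define \<delta> where "\<delta> = min d (e / (2 * lbound * n))"
  have \<delta>: "\<delta> > 0" using d n lbound(1) assms by (simp add: \<delta>_def)
  have *: "mixed s p u v \<le> mixed s' p' u v + e" if "s \<in> {0..T}" "s' \<in> {0..T}" "p \<in> prob_simplex" "p' \<in> prob_simplex"
    "\<bar>s - s'\<bar> < \<delta>" "dist p p' < \<delta>" "u \<in> U" "v \<in> V" for s s' p p' u v
  proof -
    have "mixed s p u v - mixed s' p' u v = (\<Sum>i\<in>UNIV. p $ i * (l i s u v - l i s' u v)) + (\<Sum>i\<in>UNIV. (p $ i - p' $ i) * l i s' u v)"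
      by (simp add: mixed_def sum.distrib[symmetric] sum_subtractf[symmetric] algebra_simps)
    also have "\<dots> \<le> e / 2 + (\<Sum>i\<in>(UNIV::'i set). (e / (2 * lbound * n)) * lbound)"
    proof (intro add_mono simplex_sum_le sum_mono)
      fix i
      have "\<bar>l i s u v - l i s' u v\<bar> < e / 2" using that d by (intro ld) (auto simp: \<delta>_def)
      then show "l i s u v - l i s' u v \<le> e / 2" by linarith
      have "\<bar>p $ i - p' $ i\<bar> \<le> e / (2 * lbound * n)"
        using component_le_norm_cart[of "p - p'" i] that(6) by (simp add: dist_norm \<delta>_def)
      then have "\<bar>(p $ i - p' $ i) * l i s' u v\<bar> \<le> (e / (2 * lbound * n)) * lbound"
        unfolding abs_mult using lbound that n by (intro mult_mono) auto
      then show "(p $ i - p' $ i) * l i s' u v \<le> (e / (2 * lbound * n)) * lbound" by linarith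
    qed (rule that)
    also have "\<dots> = e" using n lbound(1) by (simp add: n_def)
    finally show ?thesis by simp
  qed
  show ?thesis
  proof (rule that[OF \<delta>])
    fix s s' :: real and p p' :: "real ^ 'i" assume h: "s \<in> {0..T}" "s' \<in> {0..T}" "p \<in> prob_simplex" "p' \<in> prob_simplex"
      "\<bar>s - s'\<bar> < \<delta>" "dist p p' < \<delta>"
    have "H s p \<le> H s' p' + e"
      unfolding H_eq by (rule INF_SUP_diff_le[OF U(2) V(2), where c=lbound])
        (use h * in \<open>auto intro!: mixed_bound\<close>)
    moreover have "H s' p' \<le> H s p + e"
      unfolding H_eq by (rule INF_SUP_diff_le[OF U(2) V(2), where c=lbound])
        (use h *[of s' s p' p] in \<open>auto intro!: mixed_bound simp: dist_commute abs_minus_commute\<close>)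
    ultimately show "\<bar>H s p - H s' p'\<bar> \<le> e" by linarith
  qed
qed

lemma H_continuous: "continuous_on ({0..T} \<times> prob_simplex) (\<lambda>(s, p). H s p)"
  unfolding continuous_on_iff
proof (intro ballI allI impI)
  fix x :: "real \<times> (real ^ 'i)" and e :: real assume x: "x \<in> {0..T} \<times> prob_simplex" and e: "e > 0"
  obtain \<delta> where \<delta>: "\<delta> > 0" "\<And>s s' p p'. s \<in> {0..T} \<Longrightarrow> s' \<in> {0..T} \<Longrightarrow> p \<in> prob_simplex \<Longrightarrow> p' \<in> prob_simplex \<Longrightarrow>
    \<bar>s - s'\<bar> < \<delta> \<Longrightarrow> dist p p' < \<delta> \<Longrightarrow> \<bar>H s p - H s' p'\<bar> \<le> e / 2"
    using H_uniformly_continuous[of "e/2"] e by auto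
  show "\<exists>d>0. \<forall>x'\<in>{0..T} \<times> prob_simplex. dist x' x < d \<longrightarrow> dist (case x' of (s, p) \<Rightarrow> H s p) (case x of (s, p) \<Rightarrow> H s p) < e"
  proof (intro exI[of _ \<delta>] conjI ballI impI)
    fix y assume y: "y \<in> {0..T} \<times> prob_simplex" "dist y x < \<delta>"
    have "\<bar>H (fst y) (snd y) - H (fst x) (snd x)\<bar> \<le> e / 2"
      using x y dist_fst_le[of y x] dist_snd_le[of y x] by (intro \<delta>(2)) (auto simp: dist_real_def)
    then show "dist (case y of (s, p) \<Rightarrow> H s p) (case x of (s, p) \<Rightarrow> H s p) < e"
      using e by (simp add: case_prod_beta dist_real_def)
  qed (rule \<delta>)
qed

lemma H_measurable:
  assumes "f \<in> borel_measurable M" "q \<in> borel_measurable M"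
    and "\<And>x. x \<in> space M \<Longrightarrow> f x \<in> {0..T} \<and> q x \<in> prob_simplex"
  shows "(\<lambda>x. H (f x) (q x)) \<in> borel_measurable M"
proof -
  have "(\<lambda>x. (f x, q x)) \<in> M \<rightarrow>\<^sub>M restrict_space borel ({0..T} \<times> prob_simplex)"
    using assms by (intro measurable_restrict_space2 borel_measurable_Pair) auto
  from measurable_compose[OF this borel_measurable_continuous_on_restrict[OF H_continuous]]
  show ?thesis by simp
qed

text \<open>The place where Isaacs' condition enters: in the sup-inf form Player 2 can commit to
  \<open>w\<close> before \<open>u\<close> is known. The slack \<open>e\<close> replaces attainment
  of the supremum.\<close>

lemma isaacs_response:
  assumes "isaacs T U V l" "p \<in> prob_simplex" "s \<in> {0..T}" "e > 0"
  obtains w where "w \<in> V" "\<And>u. u \<in> U \<Longrightarrow> mixed s p u w \<ge> H s p - e"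
proof -
  have bb: "bdd_below ((\<lambda>u. mixed s p u v) ` U)" if "v \<in> V" for v
    using mixed_bound[OF assms(2,3)] that by (force intro!: bdd_belowI[of _ "-lbound"] simp: abs_le_iff)
  have ba: "bdd_above ((\<lambda>v. INF u\<in>U. mixed s p u v) ` V)"
  proof (rule bdd_aboveI[of _ lbound], safe)
    fix v assume v: "v \<in> V"
    obtain u where u: "u \<in> U" using U by auto
    have "(INF u\<in>U. mixed s p u v) \<le> mixed s p u v" by (rule cINF_lower[OF bb[OF v] u])
    then show "(INF u\<in>U. mixed s p u v) \<le> lbound" using mixed_bound[OF assms(2,3) u v] by linarith
  qed
  have "H s p = (SUP v\<in>V. INF u\<in>U. mixed s p u v)"
    using assms(1-3) by (simp add: isaacs_def hamiltonian_def mixed_def)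
  then have "H s p - e < (SUP v\<in>V. INF u\<in>U. mixed s p u v)" using assms by simp
  then obtain w where w: "w \<in> V" "H s p - e < (INF u\<in>U. mixed s p u w)"
    using less_cSUP_iff[OF V(2) ba] by auto
  show ?thesis
  proof (rule that[OF w(1)])
    fix u assume u: "u \<in> U"
    have "(INF u\<in>U. mixed s p u w) \<le> mixed s p u w" by (rule cINF_lower[OF bb[OF w(1)] u])
    then show "mixed s p u w \<ge> H s p - e" using w by linarith
  qed
qed

text \<open>One action serves a whole short period: it is chosen at time \<open>t\<close>, and a
  third of \<open>e\<close> each goes to its near optimality at \<open>t\<close>, to the drift of
  the payoff and to the drift of the Hamiltonian. Both drifts are uniform in the belief, so
  \<open>\<delta>\<close> depends neither on \<open>p\<close> nor on \<open>t\<close>.\<close>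

lemma isaacs_response_uniform:
  assumes "isaacs T U V l" "e > 0"
  obtains \<delta> where "\<delta> > 0" "\<And>p t. p \<in> prob_simplex \<Longrightarrow> t \<in> {0..T} \<Longrightarrow>
    \<exists>w\<in>V. \<forall>s\<in>{0..T}. \<bar>s - t\<bar> < \<delta> \<longrightarrow> (\<forall>u\<in>U. mixed s p u w \<ge> H s p - e)"
proof -
  obtain d1 where d1: "d1 > 0" and ld: "\<And>i s s' u u' v v'. s \<in> {0..T} \<Longrightarrow> s' \<in> {0..T} \<Longrightarrow> u \<in> U \<Longrightarrow> u' \<in> U \<Longrightarrow>
    v \<in> V \<Longrightarrow> v' \<in> V \<Longrightarrow> \<bar>s - s'\<bar> < d1 \<Longrightarrow> dist u u' < d1 \<Longrightarrow> dist v v' < d1 \<Longrightarrow>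
    \<bar>l i s u v - l i s' u' v'\<bar> < e / 3"
    using l_uniformly_continuous[of "e / 3"] assms by auto
  obtain d2 where d2: "d2 > 0" and Hd: "\<And>s s' p p'. s \<in> {0..T} \<Longrightarrow> s' \<in> {0..T} \<Longrightarrow> p \<in> prob_simplex \<Longrightarrow> p' \<in> prob_simplex \<Longrightarrow>
    \<bar>s - s'\<bar> < d2 \<Longrightarrow> dist p p' < d2 \<Longrightarrow> \<bar>H s p - H s' p'\<bar> \<le> e / 3"
    using H_uniformly_continuous[of "e / 3"] assms by auto
  show ?thesis
  proof (rule that[of "min d1 d2"])
    fix p :: "real ^ 'i" and t :: real assume p: "p \<in> prob_simplex" and t: "t \<in> {0..T}"
    obtain w where w: "w \<in> V" "\<And>u. u \<in> U \<Longrightarrow> mixed t p u w \<ge> H t p - e / 3"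
      using isaacs_response[OF assms(1) p t, of "e/3"] assms(2) by auto
    show "\<exists>w\<in>V. \<forall>s\<in>{0..T}. \<bar>s - t\<bar> < min d1 d2 \<longrightarrow> (\<forall>u\<in>U. mixed s p u w \<ge> H s p - e)"
    proof (intro bexI[OF _ w(1)] ballI impI)
      fix s u assume s: "s \<in> {0..T}" "\<bar>s - t\<bar> < min d1 d2" and u: "u \<in> U"
      have "\<bar>\<Sum>i\<in>UNIV. p $ i * (l i s u w - l i t u w)\<bar> \<le> e / 3"
        using ld[OF s(1) t u u w(1) w(1)] s d1 by (intro simplex_sum_abs_le[OF p]) (auto intro: less_imp_le)
      then have "\<bar>mixed s p u w - mixed t p u w\<bar> \<le> e / 3"
        by (simp add: mixed_def sum_subtractf[symmetric] algebra_simps)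
      moreover have "\<bar>H s p - H t p\<bar> \<le> e / 3"
        using Hd[OF s(1) t p p] s d2 by simp
      ultimately show "mixed s p u w \<ge> H s p - e" using w(2)[OF u] by linarith
    qed
  qed (use d1 d2 in auto)
qed

end

section \<open>Path space and feedback controls\<close>

lemma space_path_space [simp]: "space (path_space t0 T) = paths t0 T"
  unfolding path_space_def by (rule space_measure_of) auto

lemma space_path_filtration [simp]: "space (path_filtration t0 T t) = paths t0 T"
  unfolding path_filtration_def by (rule space_measure_of) auto

lemma sets_path_space:
  "sets (path_space t0 T) = sigma_sets (paths t0 T) {{x \<in> paths t0 T. x s \<in> B} | s B. B \<in> sets borel}"
  unfolding path_space_def by (rule sets_measure_of) auto

lemma sets_path_filtration:
  "sets (path_filtration t0 T t) =
     sigma_sets (paths t0 T) {{x \<in> paths t0 T. x s \<in> B} | s B. s \<le> t \<and> B \<in> sets borel}"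
  unfolding path_filtration_def by (rule sets_measure_of) auto

lemma coordinate_measurable [measurable]: "(\<lambda>x. x s) \<in> borel_measurable (path_space t0 T)"
proof (rule measurableI)
  fix B :: "(real ^ 'a) set" assume "B \<in> sets borel"
  then have "{x \<in> paths t0 T. x s \<in> B} \<in> sets (path_space t0 T)"
    unfolding sets_path_space by (intro sigma_sets.Basic) auto
  then show "(\<lambda>x. x s) -` B \<inter> space (path_space t0 T) \<in> sets (path_space t0 T)"
    by (simp add: vimage_def Int_def conj_commute)
qed auto

lemma coordinate_measurable_filtration:
  assumes "s \<le> t"
  shows "(\<lambda>x. x s) \<in> borel_measurable (path_filtration t0 T t)"
proof (rule measurableI)
  fix B :: "(real ^ 'a) set" assume "B \<in> sets borel"
  then have "{x \<in> paths t0 T. x s \<in> B} \<in> sets (path_filtration t0 T t)"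
    unfolding sets_path_filtration using assms by (intro sigma_sets.Basic) auto
  then show "(\<lambda>x. x s) -` B \<inter> space (path_filtration t0 T t) \<in> sets (path_filtration t0 T t)"
    by (simp add: vimage_def Int_def conj_commute)
qed auto

lemma component_measurable [measurable]: "(\<lambda>x. x $ i) \<in> borel_measurable (borel :: (real ^ 'i::finite) measure)"
  by (intro borel_measurable_continuous_onI continuous_on_component continuous_on_id)

lemma path_filtration_subset: "sets (path_filtration t0 T t) \<subseteq> sets (path_space t0 T)"
  unfolding sets_path_space sets_path_filtration by (rule sigma_sets_mono') auto

lemma path_filtration_filtration: "filtration (paths t0 T) (path_filtration t0 T)"
proof
  show "sets (path_filtration t0 T i) \<subseteq> sets (path_filtration t0 T j)" if "i \<le> j" for i j
    unfolding sets_path_filtration by (rule sigma_sets_mono') (use that in force)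
qed simp

lemma measurable_path_spaceI:
  fixes f :: "'c \<Rightarrow> real \<Rightarrow> real ^ 'b::finite"
  assumes "\<And>x. x \<in> space M \<Longrightarrow> f x \<in> paths t0 T" "\<And>s. (\<lambda>x. f x s) \<in> borel_measurable M"
  shows "f \<in> M \<rightarrow>\<^sub>M path_space t0 T"
  unfolding path_space_def
proof (rule measurable_measure_of)
  fix A :: "(real \<Rightarrow> real ^ 'b) set" assume "A \<in> {{x \<in> paths t0 T. x s \<in> B} | s B. B \<in> sets borel}"
  then obtain s B where A: "A = {x \<in> paths t0 T. x s \<in> B}" "B \<in> sets borel" by auto
  have "f -` A \<inter> space M = (\<lambda>x. f x s) -` B \<inter> space M" using A assms(1) by auto
  then show "f -` A \<inter> space M \<in> sets M" using measurable_sets[OF assms(2) A(2)] by simp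
qed (use assms in auto)

text \<open>True for the generators and stable under complements and countable unions. For belief
  paths it turns an event of the filtration into a function of the past observations.\<close>

lemma path_filtration_determined:
  assumes "A \<in> sets (path_filtration t0 T t)" "x \<in> paths t0 T" "y \<in> paths t0 T" "\<And>s. s \<le> t \<Longrightarrow> x s = y s"
  shows "x \<in> A \<longleftrightarrow> y \<in> A"
  using assms(1) unfolding sets_path_filtration
proof (induction rule: sigma_sets.induct)
  case (Basic a)
  then show ?case using assms by auto
qed (use assms in auto)

text \<open>Any measurable function of the path stopped at \<open>r\<close> is measurable for the
  filtration at time \<open>r\<close>; this is how replies with delay become adapted.\<close>

definition stopped :: "real \<Rightarrow> (real \<Rightarrow> 'c) \<Rightarrow> real \<Rightarrow> 'c" where
  "stopped r x t = x (min t r)"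

lemma stopped_paths:
  assumes x: "x \<in> paths t0 T" and r: "t0 \<le> r" "r \<le> T"
  shows "stopped r x \<in> paths t0 T"
proof -
  have right: "(stopped r x \<longlongrightarrow> stopped r x t) (at_right t)" for t
  proof (cases "t < r")
    case True
    have "eventually (\<lambda>s. x s = stopped r x s) (at_right t)"
      using True by (auto simp: eventually_at_right[OF True] stopped_def intro!: exI[of _ r])
    moreover have "(x \<longlongrightarrow> stopped r x t) (at_right t)"
      using x True by (auto simp: paths_def cadlag_def stopped_def)
    ultimately show ?thesis by (simp cong: tendsto_cong)
  next
    case False
    have "eventually (\<lambda>s. stopped r x t = stopped r x s) (at_right t)"
      using False by (auto simp: eventually_at_right[of t "t+1"] stopped_def min_def intro!: exI[of _ "t+1"])
    then show ?thesis by (rule Lim_transform_eventually[OF tendsto_const])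
  qed
  have left: "\<exists>y. (stopped r x \<longlongrightarrow> y) (at_left t)" for t
  proof (cases "t \<le> r")
    case True
    obtain y where "(x \<longlongrightarrow> y) (at_left t)" using x by (auto simp: paths_def cadlag_def)
    moreover have "eventually (\<lambda>s. x s = stopped r x s) (at_left t)"
      using True by (auto simp: eventually_at_left[of "t-1"] stopped_def intro!: exI[of _ "t-1"])
    ultimately show ?thesis by (intro exI[of _ y]) (rule Lim_transform_eventually)
  next
    case False
    then have "eventually (\<lambda>s. x r = stopped r x s) (at_left t)"
      by (auto simp: eventually_at_left[of r] stopped_def min_def intro!: exI[of _ r])
    then show ?thesis by (intro exI[of _ "x r"]) (rule Lim_transform_eventually[OF tendsto_const])
  qed
  have "stopped r x constant_on {..<t0}"
    using x r by (auto simp: paths_def constant_on_def stopped_def)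
  moreover have "stopped r x constant_on {T..}"
    using r unfolding constant_on_def by (intro exI[of _ "x r"]) (auto simp: stopped_def min_def dest: order_antisym[OF _ order_trans])
  moreover have "stopped r x t \<in> prob_simplex" for t using x by (auto simp: paths_def stopped_def)
  ultimately show ?thesis using left right by (auto simp: paths_def cadlag_def)
qed

lemma stopped_measurable:
  assumes "t0 \<le> r" "r \<le> T"
  shows "stopped r \<in> path_filtration t0 T r \<rightarrow>\<^sub>M path_space t0 T"
proof (rule measurable_path_spaceI)
  show "(\<lambda>x. stopped r x s) \<in> borel_measurable (path_filtration t0 T r)" for s
    unfolding stopped_def by (rule coordinate_measurable_filtration) simp
qed (use stopped_paths assms in auto)

text \<open>Right-continuity: the value at \<open>s\<close> is the limit of values at grid points to
  the right of \<open>s\<close>, and evaluation at a grid point chosen by a countable measurable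
  index is measurable.\<close>

lemma path_evaluation_measurable:
  "(\<lambda>(x, s). x s) \<in> borel_measurable (path_space t0 T \<Otimes>\<^sub>M (borel :: real measure))"
proof (rule borel_measurable_LIMSEQ_metric)
  let ?M = "path_space t0 T \<Otimes>\<^sub>M (borel :: real measure)"
  \<comment> \<open>The \<open>+ 1\<close> makes the grid point lie strictly to the right of
    \<open>s\<close>, also when \<open>s\<close> is itself on the grid, as the filter
    \<open>at_right s\<close> demands.\<close>
  define q where "q n s = (of_int (\<lfloor>real (Suc n) * s\<rfloor> + 1) / real (Suc n) :: real)" for n s
  show "(\<lambda>p. fst p (q n (snd p))) \<in> borel_measurable ?M" for n
    unfolding q_def
  proof (rule measurable_compose_countable[where g="\<lambda>p. \<lfloor>real (Suc n) * snd p\<rfloor>" and f="\<lambda>k p. fst p (of_int (k + 1) / real (Suc n))"])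
    show "(\<lambda>p. fst p (of_int (k + 1) / real (Suc n))) \<in> borel_measurable ?M" for k :: int
      by (rule measurable_compose[OF measurable_fst coordinate_measurable])
    show "(\<lambda>p. \<lfloor>real (Suc n) * snd p\<rfloor>) \<in> ?M \<rightarrow>\<^sub>M count_space UNIV" by measurable
  qed
  fix p assume "p \<in> space ?M"
  then have x: "fst p \<in> paths t0 T" by (auto simp: space_pair_measure)
  define s where "s = snd p"
  have q1: "q n s > s" for n
  proof -
    have "real (Suc n) * s < of_int (\<lfloor>real (Suc n) * s\<rfloor> + 1)" by linarith
    then show ?thesis by (simp add: q_def field_simps)
  qed
  have q2: "q n s \<le> s + inverse (real (Suc n))" for n
  proof -
    have "of_int (\<lfloor>real (Suc n) * s\<rfloor> + 1) \<le> real (Suc n) * s + 1" by linarith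
    then have "q n s \<le> (real (Suc n) * s + 1) / real (Suc n)" unfolding q_def by (rule divide_right_mono) simp
    then show ?thesis by (simp add: field_simps)
  qed
  have "(\<lambda>n. s + inverse (real (Suc n))) \<longlonglongrightarrow> s + 0"
    by (intro tendsto_intros LIMSEQ_inverse_real_of_nat)
  then have "(\<lambda>n. q n s) \<longlonglongrightarrow> s"
    by (intro tendsto_sandwich[of "\<lambda>_. s" "\<lambda>n. q n s" sequentially "\<lambda>n. s + inverse (real (Suc n))" s])
       (use q1 q2 in \<open>auto intro!: always_eventually less_imp_le simp del: of_nat_Suc\<close>)
  moreover have "q n s \<noteq> s" for n using q1[of n] by simp
  ultimately have "filterlim (\<lambda>n. q n s) (at_right s) sequentially"
    using q1 by (auto simp: filterlim_at)
  moreover have "(fst p \<longlongrightarrow> fst p s) (at_right s)" using x by (auto simp: paths_def cadlag_def)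
  ultimately have "(\<lambda>n. fst p (q n s)) \<longlonglongrightarrow> fst p s" by (rule filterlim_compose[rotated])
  then show "(\<lambda>n. fst p (q n (snd p))) \<longlonglongrightarrow> (case p of (x, s) \<Rightarrow> x s)"
    by (simp add: s_def case_prod_beta)
qed

context game
begin

lemma path_evaluation_time_measurable:
  "(\<lambda>p. fst p (snd p)) \<in> borel_measurable (path_space t0 T \<Otimes>\<^sub>M timeM)"
proof -
  have "(\<lambda>p. (fst p, snd p)) \<in> path_space t0 T \<Otimes>\<^sub>M timeM \<rightarrow>\<^sub>M path_space t0 T \<Otimes>\<^sub>M borel"
    by measurable
  from measurable_compose[OF this path_evaluation_measurable] show ?thesis by (simp add: case_prod_beta)
qed

lemma path_simplex: "x \<in> paths t0 T \<Longrightarrow> x s \<in> prob_simplex"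
  by (auto simp: paths_def)

lemma H_path_measurable:
  "(\<lambda>p. H (snd p) (fst p (snd p))) \<in> borel_measurable (path_space t0 T \<Otimes>\<^sub>M timeM)"
  using t0 path_simplex
  by (intro H_measurable path_evaluation_time_measurable measurable_compose[OF measurable_snd time_ident_measurable])
     (auto simp: space_pair_measure)

lemma path_measurable_time: "x \<in> paths t0 T \<Longrightarrow> x \<in> borel_measurable timeM"
  using measurable_compose[OF measurable_Pair1' path_evaluation_time_measurable, of x] by simp

lemma H_path_time_integrable:
  assumes "x \<in> paths t0 T" and [measurable]: "S \<in> sets borel"
  shows "integrable timeM (\<lambda>s. indicator S s * H s (x s))"
proof (rule integrable_bounded_on_Icc[where C=lbound])
  have [measurable]: "(\<lambda>s. H s (x s)) \<in> borel_measurable timeM"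
    using t0 path_simplex[OF assms(1)]
    by (intro H_measurable time_ident_measurable path_measurable_time[OF assms(1)]) auto
  show "(\<lambda>s. indicator S s * H s (x s)) \<in> borel_measurable timeM" by measurable
  show "\<bar>indicator S s * H s (x s)\<bar> \<le> lbound" if "s \<in> {t0..T}" for s
    using H_bound[OF path_simplex[OF assms(1)], of s] that t0 lbound(1) by (auto simp: indicator_def)
qed

text \<open>Serves to make the infimum over martingale measures bounded below. If the integrand is
  not integrable, the integral is 0 and the bound still holds.\<close>

lemma running_cost_lower:
  assumes "prob_space P" "sets P = sets (path_space t0 T)"
  shows "running_cost T U V l t0 P \<ge> - (lbound * (T - t0))"
proof -
  interpret prob_space P by fact
  have sp: "space P = paths t0 T" using sets_eq_imp_space_eq[OF assms(2)] by simp
  have "- (lbound * (T - t0)) \<le> (LINT s|timeM. H s (x s))" if "x \<in> paths t0 T" for x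
  proof -
    have "\<bar>LINT s|timeM. indicator UNIV s * H s (x s)\<bar> \<le> (LINT s|timeM. lbound)"
      by (intro integral_abs_bound_integral H_path_time_integrable that)
        (use H_bound[OF path_simplex[OF that]] t0 in auto)
    also have "\<dots> = lbound * (T - t0)" using t0 by (simp add: measure_restrict_space mult.commute)
    finally show ?thesis by simp
  qed
  then have b: "- (lbound * (T - t0)) \<le> (LINT s|timeM. H s (x s))" if "x \<in> space P" for x using that sp by simp
  show ?thesis unfolding running_cost_def
  proof (cases "integrable P (\<lambda>x. LINT s|timeM. H s (x s))")
    case True
    then have "(LINT x|P. - (lbound * (T - t0))) \<le> (LINT x|P. LINT s|timeM. H s (x s))"
      by (intro integral_mono b) auto
    then show "- (lbound * (T - t0)) \<le> (LINT x|P. LINT s|timeM. H s (x s))" by (simp add: prob_space)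
  next
    case False
    then show "- (lbound * (T - t0)) \<le> (LINT x|P. LINT s|timeM. H s (x s))"
      using lbound(1) t0 by (simp add: not_integrable_integral_eq)
  qed
qed

end

section \<open>Feedback controls as measurable functions of the path\<close>

locale feedback_game = game l U V T t0
  for l :: "'i::finite \<Rightarrow> real \<Rightarrow> 'a::euclidean_space \<Rightarrow> 'b::euclidean_space \<Rightarrow> real"
    and U V T t0 +
  fixes ustar :: "real \<Rightarrow> real ^ 'i \<Rightarrow> 'a"
  assumes sel: "minimizer_selection T U V l ustar"
begin

abbreviation fb :: "(real \<Rightarrow> real ^ 'i) \<Rightarrow> real \<Rightarrow> 'a" where "fb \<equiv> feedback_control t0 T ustar"

lemma ustar_measurable:
  assumes "f \<in> borel_measurable M" "q \<in> borel_measurable M"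
    and "\<And>x. x \<in> space M \<Longrightarrow> f x \<in> {0..T} \<and> q x \<in> prob_simplex"
  shows "(\<lambda>x. ustar (f x) (q x)) \<in> borel_measurable M"
proof -
  have "(\<lambda>x. (f x, q x)) \<in> M \<rightarrow>\<^sub>M restrict_space borel ({0..T} \<times> prob_simplex)"
    using assms by (intro measurable_restrict_space2 borel_measurable_Pair) auto
  moreover have "(\<lambda>(t, p). ustar t p) \<in> restrict_space borel ({0..T} \<times> prob_simplex) \<rightarrow>\<^sub>M borel"
    using sel unfolding minimizer_selection_def by (auto simp: measurable_restrict_space2_iff)
  ultimately show ?thesis by (auto dest: measurable_compose)
qed

lemma ustar_in_U:
  assumes "s \<in> {0..T}" "p \<in> prob_simplex"
  shows "ustar s p \<in> U"
proof -
  have "(\<lambda>(t, p). ustar t p) \<in> restrict_space borel ({0..T} \<times> prob_simplex) \<rightarrow>\<^sub>M restrict_space borel U"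
    using sel unfolding minimizer_selection_def by auto
  from measurable_space[OF this, of "(s, p)"] show ?thesis
    using assms by (auto simp: space_restrict_space)
qed

lemma mixed_ustar_le_H:
  "s \<in> {0..T} \<Longrightarrow> p \<in> prob_simplex \<Longrightarrow> v \<in> V \<Longrightarrow> mixed s p (ustar s p) v \<le> H s p"
  using mixed_le_SUP[of p s "ustar s p" v] ustar_in_U[of s p] sel
  by (simp add: minimizer_selection_def mixed_def)

lemma fb_joint_measurable:
  "(\<lambda>p. ustar (snd p) (fst p (snd p))) \<in> borel_measurable (path_space t0 T \<Otimes>\<^sub>M timeM)"
  using t0 path_simplex
  by (intro ustar_measurable path_evaluation_time_measurable measurable_compose[OF measurable_snd time_ident_measurable])
     (auto simp: space_pair_measure)

lemma fb_control: "x \<in> paths t0 T \<Longrightarrow> fb x \<in> ctlU"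
proof (rule control_setI)
  assume x: "x \<in> paths t0 T"
  show "fb x s \<in> U" if "s \<in> {t0..T}" for s
    using that t0 ustar_in_U[of s "x s"] path_simplex[OF x] by (simp add: feedback_control_def)
  have "(\<lambda>s. ustar s (x s)) \<in> borel_measurable timeM"
    using measurable_compose[OF measurable_Pair1' fb_joint_measurable, of x] x by simp
  then show "fb x \<in> borel_measurable timeM"
    by (rule measurable_cong[THEN iffD1, rotated]) (auto simp: feedback_control_def)
qed (auto simp: feedback_control_def)

text \<open>By the criterion through L1-distances, joint measurability of the feedback in path and
  time suffices: the distance to a fixed control is then a measurable parameter integral.\<close>

lemma fb_measurable: "fb \<in> path_space t0 T \<rightarrow>\<^sub>M spU"
proof (rule measurable_control_spaceI[OF U])
  fix d assume d: "d \<in> ctlU"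
  interpret finite_measure timeM by simp
  note [measurable] = fb_joint_measurable control_set_measurable[OF d]
  have "(\<lambda>x. LINT s|timeM. dist (ustar s (x s)) (d s)) \<in> borel_measurable (path_space t0 T)"
  proof (rule borel_measurable_lebesgue_integral)
    have "(\<lambda>p. dist (ustar (snd p) (fst p (snd p))) (d (snd p))) \<in> borel_measurable (path_space t0 T \<Otimes>\<^sub>M timeM)"
      by measurable
    then show "(\<lambda>(x, s). dist (ustar s (x s)) (d s)) \<in> borel_measurable (path_space t0 T \<Otimes>\<^sub>M timeM)"
      by (simp add: case_prod_beta)
  qed
  moreover have "(LINT s|timeM. dist (ustar s (x s)) (d s)) = L1_dist t0 T (fb x) d" for x
    unfolding L1_dist_def by (rule Bochner_Integration.integral_cong) (auto simp: feedback_control_def)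
  ultimately show "(\<lambda>x. L1_dist t0 T (fb x) d) \<in> borel_measurable (path_space t0 T)" by simp
qed (use fb_control in simp)

lemma fb_stopped: "s \<le> r \<Longrightarrow> fb (stopped r x) s = fb x s"
  by (simp add: feedback_control_def stopped_def restrict_def)

end

section \<open>Feedback controls against delayed strategies\<close>

lemma simplex_component: "p \<in> prob_simplex \<Longrightarrow> 0 \<le> p $ i \<and> p $ i \<le> (1::real)"
proof -
  assume p: "p \<in> prob_simplex"
  have "p $ i \<le> (\<Sum>i\<in>UNIV. p $ i)" by (rule member_le_sum) (use p in \<open>auto simp: prob_simplex_def\<close>)
  then show ?thesis using p by (auto simp: prob_simplex_def)
qed

text \<open>When Player 1 ignores the opponent, the pair \<open>(u, b u)\<close> solves the
  fixed-point equations, and the chosen outcome agrees with it almost everywhere.\<close>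

lemma (in game) outcome_control_pay:
  assumes "u \<in> ctlU" "time_partition t0 T k \<tau>" "delayed_map t0 \<tau> k ctlU ctlV b"
  shows "(case outcome t0 T U V (\<lambda>_. u) b of (u, v) \<Rightarrow> LINT s|timeM. l i s (u s) (v s)) = pay i UNIV u (b u)"
proof -
  obtain u' v' where o: "outcome t0 T U V (\<lambda>_. u) b = (u', v')" "u' \<in> ctlU" "v' \<in> ctlV"
    "ae_eq_upto t0 T u u'" "ae_eq_upto t0 T (b u') v'"
    by (rule outcome_spec[OF assms(2) delayed_map_const[OF assms(1)] assms(2,3) ctlV_nonempty]) blast
  have "ae_eq_upto t0 T (b u) (b u')"
    by (rule delayed_map_causal[OF assms(2,3) assms(1) o(2) order_refl o(4)])
  then have bv: "ae_eq_upto t0 T (b u) v'" using o(5) by (rule ae_eq_upto_trans)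
  have "pay i {..T} u (b u) = pay i {..T} u' v'"
    using o assms bv delayed_map_in[OF assms(3)] by (intro pay_cong[of T]) auto
  moreover have "pay i {..T} u v = pay i UNIV u v" for u v
    unfolding pay_def by (rule Bochner_Integration.integral_cong) auto
  ultimately have "pay i UNIV u (b u) = pay i UNIV u' v'" by simp
  then show ?thesis by (simp add: o(1) pay_def)
qed

section \<open>Payoff of the feedback under one martingale measure\<close>

context feedback_game
begin

context
  fixes P :: "(real \<Rightarrow> real ^ 'i) measure" and p0 :: "real ^ 'i"
  assumes P: "P \<in> martingale_measures t0 T p0"
begin

lemma P_prob: "prob_space P" and P_sets [measurable_cong]: "sets P = sets (path_space t0 T)"
  using P by (auto simp: martingale_measures_def)

lemma P_space: "space P = paths t0 T"
  using sets_eq_imp_space_eq[OF P_sets] by simp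

text \<open>Conditioning on the filtration at time \<open>s\<close>: the factor \<open>Z\<close> is
  known then, and the conditional expectation of the terminal value is the value at
  \<open>s\<close>. This trades the weight of the true type for the current belief.\<close>

lemma martingale_terminal:
  assumes Z: "Z \<in> borel_measurable (path_filtration t0 T s)" "\<And>x. x \<in> paths t0 T \<Longrightarrow> \<bar>Z x\<bar> \<le> c" and s: "s \<le> T"
  shows "(LINT x|P. Z x * x T $ i) = (LINT x|P. Z x * x s $ i)"
proof -
  interpret P: prob_space P by (rule P_prob)
  have m: "martingale P (path_filtration t0 T) (\<lambda>t x. x t $ i)"
    using P by (auto simp: martingale_measures_def)
  have sub: "subalgebra P (path_filtration t0 T s)" using m by (simp add: martingale_def)
  interpret finite_measure_subalgebra P "path_filtration t0 T s"
    by unfold_locales (rule sub)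
  have [measurable]: "Z \<in> borel_measurable P" by (rule measurable_from_subalg[OF sub Z(1)])
  have [measurable]: "(\<lambda>x. x s) \<in> borel_measurable P" for s by measurable
  have le1: "\<bar>x s $ i\<bar> \<le> 1" if "x \<in> paths t0 T" for x :: "real \<Rightarrow> real ^ 'i" and s
  proof -
    have x: "\<forall>i. 0 \<le> x s $ i" "(\<Sum>i\<in>UNIV. x s $ i) = 1" using path_simplex[OF that, of s] by (auto simp: prob_simplex_def)
    have "x s $ i \<le> (\<Sum>i\<in>UNIV. x s $ i)" by (rule member_le_sum) (use x in auto)
    then show ?thesis using x by simp
  qed
  have c0: "c \<ge> 0" using Z(2) P.not_empty P_space by fastforce
  have int: "integrable P (\<lambda>x. Z x * x s $ i)" for s
  proof (rule P.integrable_const_bound[where B=c])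
    show "AE x in P. norm (Z x * x s $ i) \<le> c"
    proof (rule AE_I2)
      fix x assume "x \<in> space P"
      then have x: "x \<in> paths t0 T" by (simp add: P_space)
      have "\<bar>Z x\<bar> * \<bar>x s $ i\<bar> \<le> c * 1" using Z(2)[OF x] le1[OF x] c0 by (intro mult_mono) auto
      then show "norm (Z x * x s $ i) \<le> c" by (simp add: abs_mult)
    qed
  qed measurable
  have "(LINT x|P. Z x * x T $ i) = (LINT x|P. Z x * real_cond_exp P (path_filtration t0 T s) (\<lambda>x. x T $ i) x)"
    by (rule real_cond_exp_intg(2)[symmetric, OF int Z(1)]) measurable
  also have "\<dots> = (LINT x|P. Z x * x s $ i)"
  proof (rule integral_cong_AE)
    have "AE x in P. real_cond_exp P (path_filtration t0 T s) (\<lambda>x. x T $ i) x = x s $ i"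
      using m s unfolding martingale_def by blast
    then show "AE x in P. Z x * real_cond_exp P (path_filtration t0 T s) (\<lambda>x. x T $ i) x = Z x * x s $ i"
      by eventually_elim simp
    have [measurable]: "real_cond_exp P (path_filtration t0 T s) (\<lambda>x. x T $ i) \<in> borel_measurable P"
      by (rule borel_measurable_cond_exp2)
    show "(\<lambda>x. Z x * real_cond_exp P (path_filtration t0 T s) (\<lambda>x. x T $ i) x) \<in> borel_measurable P" by measurable
  qed measurable
  finally show ?thesis .
qed

lemma integrable_path_time:
  fixes f :: "(real \<Rightarrow> real ^ 'i) \<times> real \<Rightarrow> real"
  assumes "f \<in> borel_measurable (path_space t0 T \<Otimes>\<^sub>M timeM)"
    and "\<And>x s. x \<in> paths t0 T \<Longrightarrow> s \<in> {t0..T} \<Longrightarrow> \<bar>f (x, s)\<bar> \<le> c"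
  shows "integrable (P \<Otimes>\<^sub>M timeM) f"
proof -
  interpret P: prob_space P by (rule P_prob)
  interpret finite_measure "P \<Otimes>\<^sub>M timeM"
    by (rule finite_measure_pair_measure) (auto intro: P.finite_measure_axioms)
  show ?thesis
  proof (rule integrable_const_bound[where B=c])
    show "f \<in> borel_measurable (P \<Otimes>\<^sub>M timeM)" using assms(1)
      by (simp cong: measurable_cong_sets sets_pair_measure_cong add: P_sets)
  qed (use assms(2) in \<open>auto simp: space_pair_measure P_space\<close>)
qed

lemma Fubini_path_time:
  fixes f :: "(real \<Rightarrow> real ^ 'i) \<times> real \<Rightarrow> real"
  assumes "f \<in> borel_measurable (path_space t0 T \<Otimes>\<^sub>M timeM)"
    and "\<And>x s. x \<in> paths t0 T \<Longrightarrow> s \<in> {t0..T} \<Longrightarrow> \<bar>f (x, s)\<bar> \<le> c"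
  shows "(LINT x|P. LINT s|timeM. f (x, s)) = (LINT s|timeM. LINT x|P. f (x, s))"
    and "integrable P (\<lambda>x. LINT s|timeM. f (x, s))"
proof -
  interpret P: prob_space P by (rule P_prob)
  interpret t: finite_measure timeM by simp
  interpret pair_sigma_finite P timeM ..
  have i: "integrable (P \<Otimes>\<^sub>M timeM) (case_prod (\<lambda>x s. f (x, s)))"
    using integrable_path_time[OF assms] by simp
  show "(LINT x|P. LINT s|timeM. f (x, s)) = (LINT s|timeM. LINT x|P. f (x, s))"
    using Fubini_integral[OF i] by simp
  show "integrable P (\<lambda>x. LINT s|timeM. f (x, s))"
    using integrable_fst[OF i] by simp
qed

lemma H_cost_integrable:
  assumes S: "S \<in> sets borel"
  shows "integrable P (\<lambda>x. LINT s|timeM. indicator S s * H s (x s))"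
proof -
  let ?M = "path_space t0 T \<Otimes>\<^sub>M timeM"
  have "(\<lambda>p. indicator S (snd p) :: real) \<in> borel_measurable ?M"
    by (rule measurable_compose[OF measurable_snd indicator_time_measurable[OF S]])
  then have m: "(\<lambda>p. indicator S (snd p) * H (snd p) (fst p (snd p))) \<in> borel_measurable ?M"
    using H_path_measurable by measurable
  have b: "\<bar>indicator S s * H s (x s)\<bar> \<le> lbound" if "x \<in> paths t0 T" "s \<in> {t0..T}" for x s
    using H_bound[OF path_simplex[OF that(1)], of s] that(2) t0 lbound(1) by (auto simp: indicator_def)
  show ?thesis
    by (rule Fubini_path_time(2)[OF m, unfolded fst_conv snd_conv]) (rule b)
qed

text \<open>The reply is selected from countably many fixed controls by an index known at time
  \<open>r\<close>, so its value at a fixed time \<open>s\<close> in \<open>S\<close> is an honest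
  random variable known at \<open>s\<close>. The weights may then be exchanged at each time, after
  which the choice of \<open>ustar\<close> bounds the mixed rate by the Hamiltonian.\<close>

lemma discretized_piece_le:
  assumes \<kappa>: "\<kappa> \<in> path_filtration t0 T r \<rightarrow>\<^sub>M count_space (UNIV :: nat set)"
    and d: "\<And>k. d k \<in> ctlV" and S: "S \<in> sets borel" "S \<subseteq> {r..}"
  shows "(\<Sum>i\<in>UNIV. LINT x|P. x T $ i * pay i S (fb x) (d (\<kappa> x))) \<le> (LINT x|P. LINT s|timeM. indicator S s * H s (x s))"
proof -
  interpret P: prob_space P by (rule P_prob)
  let ?M = "path_space t0 T \<Otimes>\<^sub>M timeM"
  have sub: "subalgebra (path_space t0 T) (path_filtration t0 T s)" for s :: real
    using path_filtration_subset by (auto simp: subalgebra_def)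
  have \<kappa>m [measurable]: "\<kappa> \<in> path_space t0 T \<rightarrow>\<^sub>M count_space UNIV"
    by (rule measurable_from_subalg[OF sub \<kappa>])
  define g where "g i p = indicator S (snd p) * l i (snd p) (ustar (snd p) (fst p (snd p))) (d (\<kappa> (fst p)) (snd p))" for i and p :: "(real \<Rightarrow> real ^ 'i) \<times> real"
  have dm: "(\<lambda>p. d (\<kappa> (fst p)) (snd p)) \<in> borel_measurable ?M"
  proof (rule measurable_compose_countable[where g="\<lambda>p. \<kappa> (fst p)" and f="\<lambda>k p. d k (snd p)"])
    show "(\<lambda>p. d k (snd p)) \<in> borel_measurable ?M" for k
      by (rule measurable_compose[OF measurable_snd control_set_measurable[OF d]])
  qed measurable
  have tm: "snd \<in> borel_measurable ?M" by (rule measurable_compose[OF measurable_snd time_ident_measurable])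
  have mem: "ustar s (x s) \<in> U \<and> d (\<kappa> x) s \<in> V \<and> s \<in> {0..T}" if "x \<in> paths t0 T" "s \<in> {t0..T}" for x s
    using that t0 ustar_in_U[of s "x s"] path_simplex[OF that(1)] control_set_mem[OF d that(2)] by auto
  have im: "(\<lambda>p. indicator S (snd p) :: real) \<in> borel_measurable ?M"
    by (rule measurable_compose[OF measurable_snd indicator_time_measurable[OF S(1)]])
  have gm: "g i \<in> borel_measurable ?M" for i
  proof -
    have "(\<lambda>p. l i (snd p) (ustar (snd p) (fst p (snd p))) (d (\<kappa> (fst p)) (snd p))) \<in> borel_measurable ?M"
      by (rule l_measurable[OF tm fb_joint_measurable dm]) (use mem in \<open>auto simp: space_pair_measure\<close>)
    then show ?thesis unfolding g_def[abs_def] using im by measurable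
  qed
  have gb: "\<bar>g i (x, s)\<bar> \<le> lbound" if "x \<in> paths t0 T" "s \<in> {t0..T}" for i x s
    using lbound(2)[of s "ustar s (x s)" "d (\<kappa> x) s" i] mem[OF that] lbound(1) by (auto simp: g_def indicator_def)
  have comp [measurable]: "(\<lambda>p. fst p s $ i) \<in> borel_measurable ?M" for s i
    by (intro measurable_compose[OF _ component_measurable] measurable_compose[OF measurable_fst coordinate_measurable])
  have g1b: "\<bar>x s' $ i * g i (x, s)\<bar> \<le> lbound" if "x \<in> paths t0 T" "s \<in> {t0..T}" for i x s s'
  proof -
    have "\<bar>x s' $ i\<bar> * \<bar>g i (x, s)\<bar> \<le> 1 * lbound"
      using gb[OF that, of i] simplex_component[OF path_simplex[OF that(1), of s'], of i] by (intro mult_mono) auto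
    then show ?thesis by (simp add: abs_mult)
  qed
  have ev: "(\<lambda>p. fst p (snd p) $ i) \<in> borel_measurable ?M" for i
    by (rule measurable_compose[OF path_evaluation_time_measurable component_measurable])
  have m1: "(\<lambda>p. fst p T $ i * g i p) \<in> borel_measurable ?M" for i using gm[of i] by measurable
  have m2: "(\<lambda>p. fst p (snd p) $ i * g i p) \<in> borel_measurable ?M" for i using gm[of i] ev[of i] by measurable
  have payg: "pay i S (fb x) (d (\<kappa> x)) = (LINT s|timeM. g i (x, s))" for i x
    unfolding pay_def g_def by (rule Bochner_Integration.integral_cong) (auto simp: feedback_control_def)
  have eq: "(LINT x|P. x T $ i * pay i S (fb x) (d (\<kappa> x))) = (LINT x|P. LINT s|timeM. x s $ i * g i (x, s))" for i
  proof -
    have "(LINT x|P. x T $ i * pay i S (fb x) (d (\<kappa> x))) = (LINT x|P. LINT s|timeM. x T $ i * g i (x, s))"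
      by (simp add: payg)
    also have "\<dots> = (LINT s|timeM. LINT x|P. x T $ i * g i (x, s))"
      by (rule Fubini_path_time(1)[OF m1, unfolded fst_conv snd_conv]) (rule g1b)
    \<comment> \<open>The replacement weight depends on \<open>s\<close>, hence the exchange of
      integrals before and after it. Membership in \<open>S\<close> gives \<open>r \<le> s\<close>,
      so the index \<open>\<kappa>\<close> is known at time \<open>s\<close>.\<close>
    also have "\<dots> = (LINT s|timeM. LINT x|P. x s $ i * g i (x, s))"
    proof (rule Bochner_Integration.integral_cong[OF refl])
      fix s assume "s \<in> space timeM"
      then have s: "s \<in> {t0..T}" by simp
      show "(LINT x|P. x T $ i * g i (x, s)) = (LINT x|P. x s $ i * g i (x, s))"
      proof (cases "s \<in> S")
        case False
        then show ?thesis by (simp add: g_def)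
      next
        case True
        then have rs: "r \<le> s" using S by auto
        have "(\<lambda>x. g i (x, s)) \<in> borel_measurable (path_filtration t0 T s)"
        proof -
          have subs: "subalgebra (path_filtration t0 T s) (path_filtration t0 T r)"
            using path_filtration_filtration[of t0 T] rs by (auto simp: subalgebra_def filtration_def)
          have "(\<lambda>x. d (\<kappa> x) s) \<in> borel_measurable (path_filtration t0 T s)"
            by (rule measurable_compose[OF measurable_from_subalg[OF subs \<kappa>]]) simp
          moreover have "(\<lambda>x. ustar s (x s)) \<in> borel_measurable (path_filtration t0 T s)"
            using s t0 path_simplex by (intro ustar_measurable coordinate_measurable_filtration) auto
          ultimately have "(\<lambda>x. l i s (ustar s (x s)) (d (\<kappa> x) s)) \<in> borel_measurable (path_filtration t0 T s)"
            using mem[OF _ s] by (intro l_measurable) auto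
          then show ?thesis unfolding g_def by simp
        qed
        from martingale_terminal[OF this gb[OF _ s], of i] s
        show ?thesis by (simp add: mult.commute)
      qed
    qed
    also have "\<dots> = (LINT x|P. LINT s|timeM. x s $ i * g i (x, s))"
      by (rule Fubini_path_time(1)[OF m2, unfolded fst_conv snd_conv, symmetric]) (rule g1b)
    finally show ?thesis .
  qed
  have int: "integrable P (\<lambda>x. LINT s|timeM. x s $ i * g i (x, s))" for i
    by (rule Fubini_path_time(2)[OF m2, unfolded fst_conv snd_conv]) (rule g1b)
  have "(\<Sum>i\<in>UNIV. LINT x|P. x T $ i * pay i S (fb x) (d (\<kappa> x))) = (LINT x|P. (\<Sum>i\<in>UNIV. LINT s|timeM. x s $ i * g i (x, s)))"
    unfolding eq by (rule Bochner_Integration.integral_sum[symmetric]) (rule int)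
  also have "\<dots> \<le> (LINT x|P. LINT s|timeM. indicator S s * H s (x s))"
  proof (rule integral_mono)
    show "integrable P (\<lambda>x. \<Sum>i\<in>UNIV. LINT s|timeM. x s $ i * g i (x, s))" using int by simp
    show "integrable P (\<lambda>x. LINT s|timeM. indicator S s * H s (x s))" by (rule H_cost_integrable[OF S(1)])
    fix x assume "x \<in> space P"
    then have x: "x \<in> paths t0 T" by (simp add: P_space)
    have gi: "integrable timeM (\<lambda>s. x s $ i * g i (x, s))" for i
    proof (rule integrable_bounded_on_Icc[OF _ g1b[OF x]])
      from measurable_compose[OF measurable_Pair1' m2, of x] x
      show "(\<lambda>s. x s $ i * g i (x, s)) \<in> borel_measurable timeM" by simp
    qed
    have "(\<Sum>i\<in>UNIV. LINT s|timeM. x s $ i * g i (x, s)) = (LINT s|timeM. (\<Sum>i\<in>UNIV. x s $ i * g i (x, s)))"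
      by (rule Bochner_Integration.integral_sum[symmetric]) (rule gi)
    also have "\<dots> \<le> (LINT s|timeM. indicator S s * H s (x s))"
    proof (rule integral_mono)
      show "integrable timeM (\<lambda>s. \<Sum>i\<in>UNIV. x s $ i * g i (x, s))" using gi by simp
      show "integrable timeM (\<lambda>s. indicator S s * H s (x s))" by (rule H_path_time_integrable[OF x S(1)])
      fix s assume "s \<in> space timeM"
      then have s: "s \<in> {t0..T}" by simp
      have "(\<Sum>i\<in>UNIV. x s $ i * g i (x, s)) = indicator S s * mixed s (x s) (ustar s (x s)) (d (\<kappa> x) s)"
        by (simp add: mixed_def g_def sum_distrib_left ac_simps)
      also have "\<dots> \<le> indicator S s * H s (x s)"
        using mixed_ustar_le_H[of s "x s" "d (\<kappa> x) s"] mem[OF x s] path_simplex[OF x] by (intro mult_left_mono) auto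
      finally show "(\<Sum>i\<in>UNIV. x s $ i * g i (x, s)) \<le> indicator S s * H s (x s)" .
    qed
    finally show "(\<Sum>i\<in>UNIV. LINT s|timeM. x s $ i * g i (x, s)) \<le> (LINT s|timeM. indicator S s * H s (x s))" .
  qed
  finally show ?thesis .
qed

lemma pay_fb_measurable:
  assumes "S \<in> sets borel" "v \<in> path_space t0 T \<rightarrow>\<^sub>M spV"
  shows "(\<lambda>x. pay i S (fb x) (v x)) \<in> borel_measurable (path_space t0 T)"
proof -
  have "(\<lambda>x. (fb x, v x)) \<in> path_space t0 T \<rightarrow>\<^sub>M spU \<Otimes>\<^sub>M spV"
    using fb_measurable assms(2) by measurable
  from measurable_compose[OF this pay_measurable[OF assms(1), of i]] show ?thesis by simp
qed

lemma terminal_pay_integrable: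
  assumes "S \<in> sets borel" "v \<in> path_space t0 T \<rightarrow>\<^sub>M spV"
  shows "integrable P (\<lambda>x. x T $ i * pay i S (fb x) (v x))"
proof -
  interpret P: prob_space P by (rule P_prob)
  have vm: "x \<in> paths t0 T \<Longrightarrow> v x \<in> ctlV" for x using measurable_space[OF assms(2)] by simp
  show ?thesis
  proof (rule P.integrable_const_bound[where B="1 * (lbound * (T - t0))"])
    note [measurable] = pay_fb_measurable[OF assms]
    have [measurable]: "(\<lambda>x. x T) \<in> borel_measurable P" by measurable
    have [measurable]: "(\<lambda>x. pay i S (fb x) (v x)) \<in> borel_measurable P"
      using pay_fb_measurable[OF assms, of i] by (simp cong: measurable_cong_sets add: P_sets)
    show "(\<lambda>x. x T $ i * pay i S (fb x) (v x)) \<in> borel_measurable P" by measurable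
    show "AE x in P. norm (x T $ i * pay i S (fb x) (v x)) \<le> 1 * (lbound * (T - t0))"
    proof (rule AE_I2)
      fix x assume "x \<in> space P"
      then have x: "x \<in> paths t0 T" by (simp add: P_space)
      show "norm (x T $ i * pay i S (fb x) (v x)) \<le> 1 * (lbound * (T - t0))"
        using pay_bound[OF fb_control[OF x] vm[OF x] assms(1), of i]
          simplex_component[OF path_simplex[OF x, of T], of i]
        unfolding real_norm_def abs_mult by (intro mult_mono) auto
    qed
  qed
qed

text \<open>The rounding of the reply is removed by uniform continuity of the payoff: with weights
  at most 1, an error \<open>e / n\<close> for each of the \<open>n\<close> types adds up to
  \<open>e\<close>.\<close>

lemma adapted_piece_le:
  assumes v: "v \<in> path_filtration t0 T r \<rightarrow>\<^sub>M spV" and S: "S \<in> sets borel" "S \<subseteq> {r..}"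
  shows "(\<Sum>i\<in>UNIV. LINT x|P. x T $ i * pay i S (fb x) (v x)) \<le> (LINT x|P. LINT s|timeM. indicator S s * H s (x s))"
proof (rule field_le_epsilon)
  fix e :: real assume e: "e > 0"
  interpret P: prob_space P by (rule P_prob)
  define n where "n = real CARD('i)"
  have n: "n > 0" by (simp add: n_def)
  have sub: "subalgebra (path_space t0 T) (path_filtration t0 T r)"
    using path_filtration_subset by (auto simp: subalgebra_def)
  have vp: "v \<in> path_space t0 T \<rightarrow>\<^sub>M spV" by (rule measurable_from_subalg[OF sub v])
  have vm: "x \<in> paths t0 T \<Longrightarrow> v x \<in> ctlV" for x using measurable_space[OF v] by simp
  obtain d :: "nat \<Rightarrow> real \<Rightarrow> 'b" and \<kappa> where d: "\<And>k. d k \<in> ctlV"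
    and \<kappa>: "\<And>n. \<kappa> n \<in> spV \<rightarrow>\<^sub>M count_space UNIV"
    and dist: "\<And>v n. v \<in> ctlV \<Longrightarrow> L1_dist t0 T v (d (\<kappa> n v)) < inverse (Suc n)"
    using control_space_discretization[OF V, of t0 T] by blast
  have "\<exists>\<delta>>0. \<forall>u\<in>ctlU. \<forall>v\<in>ctlV. \<forall>v'\<in>ctlV. L1_dist t0 T v v' < \<delta> \<longrightarrow> \<bar>pay i S u v - pay i S u v'\<bar> < e / n" for i
  proof -
    obtain \<delta> where \<delta>: "\<delta> > 0" "\<forall>u\<in>ctlU. \<forall>u'\<in>ctlU. \<forall>v\<in>ctlV. \<forall>v'\<in>ctlV.
      L1_dist t0 T u u' < \<delta> \<longrightarrow> L1_dist t0 T v v' < \<delta> \<longrightarrow> \<bar>pay i S u v - pay i S u' v'\<bar> < e / n"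
      using pay_uniformly_continuous[OF _ S(1), of "e / n" i] e n by auto
    have "L1_dist t0 T u u = 0" for u :: "real \<Rightarrow> 'a" by (simp add: L1_dist_def)
    then show ?thesis using \<delta> by (intro exI[of _ \<delta>]) auto
  qed
  then obtain \<delta> where \<delta>: "\<And>i. \<delta> i > 0" "\<And>i u v v'. u \<in> ctlU \<Longrightarrow> v \<in> ctlV \<Longrightarrow> v' \<in> ctlV \<Longrightarrow> L1_dist t0 T v v' < \<delta> i \<Longrightarrow> \<bar>pay i S u v - pay i S u v'\<bar> < e / n"
    by metis
  have "Min (range \<delta>) > 0" using \<delta>(1) by auto
  then obtain m :: nat where m: "inverse (Suc m) < Min (range \<delta>)" using reals_Archimedean by blast
  have m': "inverse (Suc m) < \<delta> i" for i using m by (rule less_le_trans) auto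
  have \<kappa>v: "(\<lambda>x. \<kappa> m (v x)) \<in> path_filtration t0 T r \<rightarrow>\<^sub>M count_space UNIV"
    by (rule measurable_compose[OF v \<kappa>])
  have dv: "(\<lambda>x. d (\<kappa> m (v x))) \<in> path_space t0 T \<rightarrow>\<^sub>M spV"
    by (rule measurable_compose[OF measurable_from_subalg[OF sub \<kappa>v]]) (use d in auto)
  have "(\<Sum>i\<in>UNIV. LINT x|P. x T $ i * pay i S (fb x) (v x)) \<le> (\<Sum>i\<in>(UNIV::'i set). (LINT x|P. x T $ i * pay i S (fb x) (d (\<kappa> m (v x)))) + e / n)"
  proof (rule sum_mono)
    fix i :: 'i
    have "(LINT x|P. x T $ i * pay i S (fb x) (v x)) \<le> (LINT x|P. x T $ i * pay i S (fb x) (d (\<kappa> m (v x))) + e / n)"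
    proof (rule integral_mono)
      fix x assume "x \<in> space P"
      then have x: "x \<in> paths t0 T" by (simp add: P_space)
      have "\<bar>pay i S (fb x) (v x) - pay i S (fb x) (d (\<kappa> m (v x)))\<bar> < e / n"
        by (intro \<delta>(2) fb_control x vm d less_trans[OF dist m'])
      then have "x T $ i * (pay i S (fb x) (v x) - pay i S (fb x) (d (\<kappa> m (v x)))) \<le> 1 * (e / n)"
        using simplex_component[OF path_simplex[OF x, of T], of i] e n
        by (intro order_trans[OF mult_left_mono[of _ "e / n"] mult_right_mono]) auto
      then show "x T $ i * pay i S (fb x) (v x) \<le> x T $ i * pay i S (fb x) (d (\<kappa> m (v x))) + e / n"
        by (simp add: algebra_simps)
    qed (use terminal_pay_integrable[OF S(1) vp] terminal_pay_integrable[OF S(1) dv] in auto)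
    also have "\<dots> = (LINT x|P. x T $ i * pay i S (fb x) (d (\<kappa> m (v x)))) + e / n"
      using terminal_pay_integrable[OF S(1) dv] by (simp add: P.prob_space)
    finally show "(LINT x|P. x T $ i * pay i S (fb x) (v x)) \<le> (LINT x|P. x T $ i * pay i S (fb x) (d (\<kappa> m (v x)))) + e / n" .
  qed
  also have "\<dots> = (\<Sum>i\<in>UNIV. LINT x|P. x T $ i * pay i S (fb x) (d (\<kappa> m (v x)))) + e"
    using n by (simp add: sum.distrib n_def)
  also have "\<dots> \<le> (LINT x|P. LINT s|timeM. indicator S s * H s (x s)) + e"
    using discretized_piece_le[OF \<kappa>v d S] by simp
  finally show "(\<Sum>i\<in>UNIV. LINT x|P. x T $ i * pay i S (fb x) (v x)) \<le> (LINT x|P. LINT s|timeM. indicator S s * H s (x s)) + e" .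
qed

text \<open>On each interval of the delay partition the reply agrees with the one computed from the
  path stopped at the left end, which is adapted. The bounds for the intervals are added up.\<close>

lemma feedback_against_delayed_le:
  assumes p: "time_partition t0 T k \<tau>" and b: "delayed_map t0 \<tau> k ctlU ctlV b" and bm: "b \<in> spU \<rightarrow>\<^sub>M spV"
  shows "(\<Sum>i\<in>UNIV. LINT x|P. x T $ i * pay i UNIV (fb x) (b (fb x))) \<le> running_cost T U V l t0 P"
proof -
  interpret P: prob_space P by (rule P_prob)
  have bf: "(\<lambda>x. b (fb x)) \<in> path_space t0 T \<rightarrow>\<^sub>M spV" by (rule measurable_compose[OF fb_measurable bm])
  have bc: "b (fb x) \<in> ctlV" if "x \<in> paths t0 T" for x by (rule delayed_map_in[OF b fb_control[OF that]])
  have piece: "(\<Sum>i\<in>UNIV. LINT x|P. x T $ i * pay i {\<tau> j..<\<tau> (Suc j)} (fb x) (b (fb x)))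
      \<le> (LINT x|P. LINT s|timeM. indicator {\<tau> j..<\<tau> (Suc j)} s * H s (x s))" if j: "j < k" for j
  proof -
    have tj: "t0 \<le> \<tau> j" "\<tau> j \<le> T" "\<tau> (Suc j) \<le> T"
      using time_partition_mono[OF p, of 0 j] time_partition_mono[OF p, of j k] time_partition_mono[OF p, of "Suc j" k] j p
      by (auto simp: time_partition_def)
    \<comment> \<open>Feedback uses only the current position, so stopping the path leaves the
      control unchanged up to \<open>\<tau> j\<close>; the delay of \<open>b\<close> then determines
      the reply up to \<open>\<tau> (Suc j)\<close>.\<close>
    have v: "(\<lambda>x. b (fb (stopped (\<tau> j) x))) \<in> path_filtration t0 T (\<tau> j) \<rightarrow>\<^sub>M spV"
      by (rule measurable_compose[OF stopped_measurable[OF tj(1,2)] bf])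
    have "pay i {\<tau> j..<\<tau> (Suc j)} (fb x) (b (fb x)) = pay i {\<tau> j..<\<tau> (Suc j)} (fb x) (b (fb (stopped (\<tau> j) x)))"
      if "x \<in> paths t0 T" for x i
    proof -
      note sx = stopped_paths[OF that tj(1,2)]
      have "ae_eq_upto t0 (\<tau> j) (fb x) (fb (stopped (\<tau> j) x))"
        by (rule ae_eq_uptoI) (simp add: fb_stopped)
      from delayed_map_step[OF b fb_control[OF that] fb_control[OF sx] j this]
      show ?thesis
        by (intro pay_cong[of "\<tau> (Suc j)"] fb_control that bc sx) (use tj in auto)
    qed
    then have "(LINT x|P. x T $ i * pay i {\<tau> j..<\<tau> (Suc j)} (fb x) (b (fb x))) =
       (LINT x|P. x T $ i * pay i {\<tau> j..<\<tau> (Suc j)} (fb x) (b (fb (stopped (\<tau> j) x))))" for i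
      by (intro Bochner_Integration.integral_cong) (auto simp: P_space)
    moreover have "{\<tau> j..<\<tau> (Suc j)} \<subseteq> {\<tau> j..}" by auto
    ultimately show ?thesis using adapted_piece_le[OF v, of "{\<tau> j..<\<tau> (Suc j)}"] by simp
  qed
  have "(\<Sum>i\<in>UNIV. LINT x|P. x T $ i * pay i {t0..<\<tau> n} (fb x) (b (fb x)))
      \<le> (LINT x|P. LINT s|timeM. indicator {t0..<\<tau> n} s * H s (x s))" if "n \<le> k" for n
    using that
  proof (induction n)
    case 0
    then show ?case using p by (simp add: time_partition_def pay_def)
  next
    case (Suc n)
    have tn: "t0 \<le> \<tau> n" "\<tau> n \<le> \<tau> (Suc n)"
      using time_partition_mono[OF p, of 0 n] time_partition_mono[OF p, of n "Suc n"] Suc p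
      by (auto simp: time_partition_def)
    have "(LINT x|P. x T $ i * pay i {t0..<\<tau> (Suc n)} (fb x) (b (fb x))) =
      (LINT x|P. x T $ i * pay i {t0..<\<tau> n} (fb x) (b (fb x))) + (LINT x|P. x T $ i * pay i {\<tau> n..<\<tau> (Suc n)} (fb x) (b (fb x)))" for i
    proof -
      have "(LINT x|P. x T $ i * pay i {t0..<\<tau> (Suc n)} (fb x) (b (fb x))) =
        (LINT x|P. x T $ i * pay i {t0..<\<tau> n} (fb x) (b (fb x)) + x T $ i * pay i {\<tau> n..<\<tau> (Suc n)} (fb x) (b (fb x)))"
        using pay_split[OF fb_control bc tn, of _ _ i]
        by (intro Bochner_Integration.integral_cong) (auto simp: P_space distrib_left)
      then show ?thesis using terminal_pay_integrable[OF _ bf] by simp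
    qed
    moreover have "(LINT x|P. LINT s|timeM. indicator {t0..<\<tau> (Suc n)} s * H s (x s)) =
      (LINT x|P. LINT s|timeM. indicator {t0..<\<tau> n} s * H s (x s)) + (LINT x|P. LINT s|timeM. indicator {\<tau> n..<\<tau> (Suc n)} s * H s (x s))"
    proof -
      have "(LINT s|timeM. indicator {t0..<\<tau> (Suc n)} s * H s (x s)) =
        (LINT s|timeM. indicator {t0..<\<tau> n} s * H s (x s)) + (LINT s|timeM. indicator {\<tau> n..<\<tau> (Suc n)} s * H s (x s))"
        if x: "x \<in> paths t0 T" for x
      proof -
        have "indicator {t0..<\<tau> (Suc n)} s = (indicator {t0..<\<tau> n} s + indicator {\<tau> n..<\<tau> (Suc n)} s :: real)" for s
          using tn by (auto simp: indicator_def)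
        then show ?thesis by (simp add: distrib_right H_path_time_integrable[OF x])
      qed
      then have "(LINT x|P. LINT s|timeM. indicator {t0..<\<tau> (Suc n)} s * H s (x s)) =
        (LINT x|P. (LINT s|timeM. indicator {t0..<\<tau> n} s * H s (x s)) + (LINT s|timeM. indicator {\<tau> n..<\<tau> (Suc n)} s * H s (x s)))"
        by (intro Bochner_Integration.integral_cong) (auto simp: P_space)
      then show ?thesis using H_cost_integrable by simp
    qed
    ultimately show ?case using Suc piece[of n] by (simp add: sum.distrib)
  qed
  from this[of k] have "(\<Sum>i\<in>UNIV. LINT x|P. x T $ i * pay i {t0..<T} (fb x) (b (fb x)))
      \<le> (LINT x|P. LINT s|timeM. indicator {t0..<T} s * H s (x s))" using p by (simp add: time_partition_def)
  moreover have "(LINT x|P. x T $ i * pay i {t0..<T} (fb x) (b (fb x))) = (LINT x|P. x T $ i * pay i UNIV (fb x) (b (fb x)))" for i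
    by (intro Bochner_Integration.integral_cong) (auto simp: P_space pay_drop_endpoint fb_control bc)
  moreover have "(LINT x|P. LINT s|timeM. indicator {t0..<T} s * H s (x s)) = running_cost T U V l t0 P"
    unfolding running_cost_def
  proof (rule Bochner_Integration.integral_cong[OF refl])
    fix x assume "x \<in> space P"
    then have x: "x \<in> paths t0 T" by (simp add: P_space)
    show "(LINT s|timeM. indicator {t0..<T} s * H s (x s)) = (LINT s|timeM. H s (x s))"
    proof (rule integral_cong_AE)
      have "AE s in lebesgue. s \<noteq> T" by (rule AE_I[of _ _ "{T}"]) auto
      then have "AE s in lebesgue. s \<in> {t0..T} \<longrightarrow> indicator {t0..<T} s * H s (x s) = H s (x s)"
        by (elim eventually_mono) (auto simp: indicator_def)
      then show "AE s in timeM. indicator {t0..<T} s * H s (x s) = H s (x s)"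
        by (subst AE_restrict_space_iff) auto
    qed (use borel_measurable_integrable[OF H_path_time_integrable[OF x, of "{t0..<T}"]]
        borel_measurable_integrable[OF H_path_time_integrable[OF x, of UNIV]] in auto)
  qed
  ultimately show ?thesis by simp
qed

end

end

lemma integral_abs_le:
  fixes f :: "'c \<Rightarrow> real"
  assumes "integrable M f" "integrable M g" "\<And>x. x \<in> space M \<Longrightarrow> \<bar>f x\<bar> \<le> g x"
  shows "\<bar>\<integral>x. f x \<partial>M\<bar> \<le> (\<integral>x. g x \<partial>M)"
proof -
  have "\<bar>\<integral>x. f x \<partial>M\<bar> \<le> (\<integral>x. \<bar>f x\<bar> \<partial>M)" by simp
  also have "\<dots> \<le> (\<integral>x. g x \<partial>M)" using assms by (intro integral_mono) auto
  finally show ?thesis .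
qed

section \<open>Conditional laws and the random parameter of Player 2\<close>

context feedback_game
begin

lemma martingale_measure_measurable:
  fixes P :: "(real \<Rightarrow> real ^ 'i) measure"
  assumes "P \<in> martingale_measures t0 T p0" "f \<in> borel_measurable (path_space t0 T)"
  shows "f \<in> borel_measurable P"
  using assms(2) by (simp cong: measurable_cong_sets add: P_sets[OF assms(1)])

lemma component_path_measurable:
  "(\<lambda>x. x s $ i) \<in> borel_measurable (path_space t0 T :: (real \<Rightarrow> real ^ 'i) measure)"
  by (rule measurable_compose[OF coordinate_measurable component_measurable])

lemma terminal_mean:
  fixes P :: "(real \<Rightarrow> real ^ 'i) measure"
  assumes P: "P \<in> martingale_measures t0 T p0"
  shows "(LINT x|P. x T $ i) = p0 $ i"
proof -
  interpret P: prob_space P by (rule P_prob[OF P])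
  have [measurable]: "(\<lambda>x. x s $ i) \<in> borel_measurable P" for s
    by (rule martingale_measure_measurable[OF P component_path_measurable])
  \<comment> \<open>A time strictly before \<open>t0\<close> is needed: the value is
    \<open>p0\<close> there, while the path may already jump at \<open>t0\<close>.\<close>
  have "(LINT x|P. 1 * x T $ i) = (LINT x|P. 1 * x (t0 - 1) $ i)"
    by (rule martingale_terminal[OF P, where c=1]) (use t0 in auto)
  also have "\<dots> = (LINT x|P. p0 $ i)"
  proof (rule integral_cong_AE)
    have "AE x in P. \<forall>t<t0. x t = p0" using P by (auto simp: martingale_measures_def)
    then show "AE x in P. 1 * x (t0 - 1) $ i = p0 $ i" by eventually_elim simp
  qed simp_all
  finally show ?thesis by (simp add: P.prob_space)
qed

text \<open>The conditional law has density \<open>indicator E / p0 $ i\<close> with respect to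
  \<open>P\<close>, where \<open>E\<close> is the event of ending in the vertex of \<open>i\<close>;
  almost surely this indicator equals \<open>x T $ i\<close>, since the path ends in a
  vertex.\<close>

lemma conditional_law_integral:
  fixes P :: "(real \<Rightarrow> real ^ 'i) measure"
  assumes P: "P \<in> martingale_measures t0 T p0" and Q: "conditional_laws t0 T p0 P Q" and p0: "p0 \<in> prob_simplex"
    and f: "f \<in> borel_measurable (path_space t0 T)" "\<And>x. x \<in> paths t0 T \<Longrightarrow> \<bar>f x\<bar> \<le> c"
  shows "p0 $ i * (LINT x|Q i. f x) = (LINT x|P. x T $ i * f x)"
proof -
  interpret P: prob_space P by (rule P_prob[OF P])
  have [measurable]: "(\<lambda>x. x T $ i) \<in> borel_measurable P" "f \<in> borel_measurable P"
    by (rule martingale_measure_measurable[OF P component_path_measurable] martingale_measure_measurable[OF P f(1)])+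
  have "0 \<le> p0 $ i" using p0 by (simp add: prob_simplex_def)
  then consider "p0 $ i > 0" | "p0 $ i = 0" by linarith
  then show ?thesis
  proof cases
    case 1
    let ?E = "{x \<in> paths t0 T. x T = axis i 1}"
    have EM [measurable]: "?E \<in> sets P"
    proof -
      have "{x \<in> space (path_space t0 T). x T = axis i 1} \<in> sets (path_space t0 T)" by measurable
      then show ?thesis by (simp add: P_sets[OF P])
    qed
    have Qs: "sets (Q i) = sets (path_space t0 T)"
      and Qe: "\<And>A. A \<in> sets (path_space t0 T) \<Longrightarrow> emeasure (Q i) A = emeasure P (A \<inter> ?E) / ennreal (p0 $ i)"
      using Q 1 by (auto simp: conditional_laws_def)
    have "Q i = density P (\<lambda>x. ennreal (indicator ?E x / p0 $ i))"
    proof (rule measure_eqI)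
      fix A assume "A \<in> sets (Q i)"
      then have A: "A \<in> sets (path_space t0 T)" using Qs by simp
      have "emeasure (density P (\<lambda>x. ennreal (indicator ?E x / p0 $ i))) A = (\<integral>\<^sup>+x. ennreal (1 / p0 $ i) * indicator (A \<inter> ?E) x \<partial>P)"
      proof (subst emeasure_density)
        show "A \<in> sets P" using A by (simp add: P_sets[OF P])
        show "(\<integral>\<^sup>+x. ennreal (indicator ?E x / p0 $ i) * indicator A x \<partial>P) = (\<integral>\<^sup>+x. ennreal (1 / p0 $ i) * indicator (A \<inter> ?E) x \<partial>P)"
          by (intro nn_integral_cong) (simp add: indicator_def)
      qed measurable
      also have "\<dots> = ennreal (1 / p0 $ i) * emeasure P (A \<inter> ?E)"
        using A EM by (intro nn_integral_cmult_indicator) (auto simp: P_sets[OF P])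
      also have "\<dots> = emeasure (Q i) A"
      proof -
        have "ennreal (1 / p0 $ i) = inverse (ennreal (p0 $ i))"
          using 1 by (simp add: inverse_ennreal inverse_eq_divide)
        then show ?thesis by (simp add: Qe[OF A] divide_ennreal_def mult.commute)
      qed
      finally show "emeasure (Q i) A = emeasure (density P (\<lambda>x. ennreal (indicator ?E x / p0 $ i))) A" by simp
    qed (simp add: Qs P_sets[OF P])
    then have "(LINT x|Q i. f x) = (LINT x|P. (indicator ?E x / p0 $ i) *\<^sub>R f x)"
      using 1 by (simp add: integral_density)
    then have "p0 $ i * (LINT x|Q i. f x) = (LINT x|P. indicator ?E x * f x)"
      using 1 by simp
    also have "\<dots> = (LINT x|P. x T $ i * f x)"
    proof (rule integral_cong_AE)
      have "AE x in P. \<forall>t\<ge>T. x t \<in> range (\<lambda>i. axis i 1)" using P by (auto simp: martingale_measures_def)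
      then show "AE x in P. indicator ?E x * f x = x T $ i * f x"
        using AE_space
      proof eventually_elim
        case (elim x)
        then obtain j where j: "x T = axis j 1" by auto
        have "x \<in> paths t0 T" using elim by (simp add: P_space[OF P])
        moreover have "x T $ i = (if i = j then 1 else 0)" by (simp add: j axis_def)
        moreover have "x T = axis i 1 \<longleftrightarrow> i = j" by (auto simp: j axis_eq_axis)
        ultimately show ?case by (auto simp: indicator_def)
      qed
    qed measurable
    finally show ?thesis .
  next
    case 2
    \<comment> \<open>The left side of the claim vanishes whatever \<open>Q i\<close> is. On the
      right, the nonnegative weight \<open>x T $ i\<close> has mean
      \<open>p0 $ i = 0\<close>.\<close>
    have "\<bar>LINT x|P. x T $ i * f x\<bar> \<le> (LINT x|P. c * x T $ i)"
    proof (rule integral_abs_le)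
      have "martingale P (path_filtration t0 T) (\<lambda>t x. x t $ i)"
        using P by (simp add: martingale_measures_def)
      then have int: "integrable P (\<lambda>x. x T $ i)"
        unfolding martingale_def by blast
      then show "integrable P (\<lambda>x. c * x T $ i)" by simp
      show le: "\<bar>x T $ i * f x\<bar> \<le> c * x T $ i" if "x \<in> space P" for x
      proof -
        have x: "x \<in> paths t0 T" using that by (simp add: P_space[OF P])
        show ?thesis using f(2)[OF x] simplex_component[OF path_simplex[OF x, of T], of i]
          by (simp add: abs_mult mult.commute mult_right_mono)
      qed
      show "integrable P (\<lambda>x. x T $ i * f x)"
      proof (rule Bochner_Integration.integrable_bound[of P "\<lambda>x. c * x T $ i"])
        show "AE x in P. norm (x T $ i * f x) \<le> norm (c * x T $ i)"
          using le by (intro AE_I2) (metis abs_ge_self order_trans real_norm_def)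
      qed (use int in simp_all)
    qed
    also have "\<dots> = 0" using terminal_mean[OF P, of i] 2 by simp
    finally show ?thesis using 2 by simp
  qed
qed

lemma feedback_payoff_integrand:
  assumes \<beta>: "\<beta> \<in> rand_strategies E t0 T U V"
    and x: "x \<in> paths t0 T" and \<omega>: "\<omega> \<in> space (fst \<beta>)"
  shows "(case outcome t0 T U V (\<lambda>_. fb x) (snd \<beta> \<omega>) of (u, v) \<Rightarrow> LINT s|timeM. l i s (u s) (v s))
     = pay i UNIV (fb x) (snd \<beta> \<omega> (fb x))"
proof -
  obtain k \<tau> where p: "time_partition t0 T k \<tau>"
    and b: "\<And>\<omega>. \<omega> \<in> space (fst \<beta>) \<Longrightarrow> delayed_map t0 \<tau> k ctlU ctlV (snd \<beta> \<omega>)"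
    by (rule rand_strategies_delayed[OF \<beta>]) blast
  show ?thesis by (rule outcome_control_pay[OF fb_control[OF x] p b[OF \<omega>]])
qed

lemma feedback_payoff_measurable:
  assumes \<beta>: "\<beta> \<in> rand_strategies E t0 T U V"
  shows "(\<lambda>\<omega>. pay i UNIV (fb (fst \<omega>)) (snd \<beta> (snd \<omega>) (fb (fst \<omega>)))) \<in> borel_measurable (path_space t0 T \<Otimes>\<^sub>M fst \<beta>)"
proof -
  have b: "(\<lambda>(\<omega>, u). snd \<beta> \<omega> u) \<in> (fst \<beta> \<Otimes>\<^sub>M spU) \<rightarrow>\<^sub>M spV"
    using \<beta> by (auto simp: rand_strategies_def)
  have f: "(\<lambda>\<omega>. fb (fst \<omega>)) \<in> path_space t0 T \<Otimes>\<^sub>M fst \<beta> \<rightarrow>\<^sub>M spU"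
    by (rule measurable_compose[OF measurable_fst fb_measurable])
  have "(\<lambda>\<omega>. (snd \<omega>, fb (fst \<omega>))) \<in> path_space t0 T \<Otimes>\<^sub>M fst \<beta> \<rightarrow>\<^sub>M fst \<beta> \<Otimes>\<^sub>M spU"
    using f by measurable
  from measurable_compose[OF this b] have v: "(\<lambda>\<omega>. snd \<beta> (snd \<omega>) (fb (fst \<omega>))) \<in> path_space t0 T \<Otimes>\<^sub>M fst \<beta> \<rightarrow>\<^sub>M spV"
    by simp
  have "(\<lambda>\<omega>. (fb (fst \<omega>), snd \<beta> (snd \<omega>) (fb (fst \<omega>)))) \<in> path_space t0 T \<Otimes>\<^sub>M fst \<beta> \<rightarrow>\<^sub>M spU \<Otimes>\<^sub>M spV"
    using f v by measurable
  from measurable_compose[OF this pay_measurable[of UNIV i]] show ?thesis by simp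
qed

lemma feedback_payoff_eq:
  assumes \<beta>: "\<beta> \<in> rand_strategies E t0 T U V" and Q: "sets Q = sets (path_space t0 T)"
  shows "expected_payoff t0 T U V (l i) (strategy_of_control (Q, fb)) \<beta>
    = (LINT \<omega>|(Q \<Otimes>\<^sub>M fst \<beta>). pay i UNIV (fb (fst \<omega>)) (snd \<beta> (snd \<omega>) (fb (fst \<omega>))))"
  unfolding expected_payoff_def strategy_of_control_def fst_conv snd_conv
proof (rule Bochner_Integration.integral_cong[OF refl])
  fix \<omega> assume "\<omega> \<in> space (Q \<Otimes>\<^sub>M fst \<beta>)"
  then have "fst \<omega> \<in> paths t0 T" "snd \<omega> \<in> space (fst \<beta>)"
    using sets_eq_imp_space_eq[OF Q] by (simp_all add: space_pair_measure mem_Times_iff)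
  then show "(case outcome t0 T U V (\<lambda>v. fb (fst \<omega>)) (snd \<beta> (snd \<omega>)) of (u, v) \<Rightarrow> LINT s|timeM. l i s (u s) (v s))
      = pay i UNIV (fb (fst \<omega>)) (snd \<beta> (snd \<omega>) (fb (fst \<omega>)))"
    by (rule feedback_payoff_integrand[OF \<beta>])
qed

text \<open>Player 2's random parameter is independent of the path and has the same law for every
  type, so its integral can be taken last and the bound for one realisation applies under
  it.\<close>

lemma feedback_payoff_le:
  fixes P :: "(real \<Rightarrow> real ^ 'i) measure"
  assumes P: "P \<in> martingale_measures t0 T p0" and Q: "conditional_laws t0 T p0 P Q" and p0: "p0 \<in> prob_simplex"
    and Qp: "\<And>i. prob_space (Q i)"
    and \<beta>: "\<beta> \<in> rand_strategies E t0 T U V" "prob_space (fst \<beta>)"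
  shows "(\<Sum>i\<in>UNIV. p0 $ i * expected_payoff t0 T U V (l i) (strategy_of_control (Q i, fb)) \<beta>)
    \<le> running_cost T U V l t0 P"
proof -
  interpret M: prob_space "fst \<beta>" by fact
  obtain k \<tau> where p: "time_partition t0 T k \<tau>"
    and b: "\<And>\<omega>. \<omega> \<in> space (fst \<beta>) \<Longrightarrow> delayed_map t0 \<tau> k ctlU ctlV (snd \<beta> \<omega>)"
    by (rule rand_strategies_delayed[OF \<beta>(1)]) blast
  have bm: "snd \<beta> \<omega> \<in> spU \<rightarrow>\<^sub>M spV" if "\<omega> \<in> space (fst \<beta>)" for \<omega>
  proof -
    have "(\<lambda>(\<omega>, u). snd \<beta> \<omega> u) \<in> (fst \<beta> \<Otimes>\<^sub>M spU) \<rightarrow>\<^sub>M spV"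
      using \<beta>(1) by (auto simp: rand_strategies_def)
    from measurable_compose[OF measurable_Pair1'[OF that] this] show ?thesis by simp
  qed
  have Qs: "sets (Q i) = sets (path_space t0 T)" for i
  proof -
    have "0 \<le> p0 $ i" using p0 by (simp add: prob_simplex_def)
    then show ?thesis using Q
      by (cases "p0 $ i = 0") (auto simp: conditional_laws_def martingale_measures_def)
  qed
  define F where "F i x \<omega> = pay i UNIV (fb x) (snd \<beta> \<omega> (fb x))" for i x \<omega>
  have Fb: "\<bar>F i x \<omega>\<bar> \<le> lbound * (T - t0)" if "x \<in> paths t0 T" "\<omega> \<in> space (fst \<beta>)" for i x \<omega>
    unfolding F_def using fb_control[OF that(1)] delayed_map_in[OF b[OF that(2)]] by (intro pay_bound) auto
  have Fm: "(\<lambda>(x, \<omega>). F i x \<omega>) \<in> borel_measurable (path_space t0 T \<Otimes>\<^sub>M fst \<beta>)" for i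
    using feedback_payoff_measurable[OF \<beta>(1), of i] by (simp add: F_def case_prod_beta)
  have eq: "p0 $ i * expected_payoff t0 T U V (l i) (strategy_of_control (Q i, fb)) \<beta>
      = (LINT \<omega>|fst \<beta>. LINT x|P. x T $ i * F i x \<omega>)"
    and int: "integrable (fst \<beta>) (\<lambda>\<omega>. LINT x|P. x T $ i * F i x \<omega>)" for i
  proof -
    interpret Q: prob_space "Q i" by (rule Qp)
    interpret QM: pair_prob_space "Q i" "fst \<beta>" ..
    have "expected_payoff t0 T U V (l i) (strategy_of_control (Q i, fb)) \<beta> = (LINT \<omega>|(Q i \<Otimes>\<^sub>M fst \<beta>). case_prod (F i) \<omega>)"
      by (simp add: feedback_payoff_eq[OF \<beta>(1) Qs] F_def case_prod_beta)
    moreover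
    have i: "integrable (Q i \<Otimes>\<^sub>M fst \<beta>) (case_prod (F i))"
    proof (rule QM.integrable_const_bound)
      show "AE \<omega> in Q i \<Otimes>\<^sub>M fst \<beta>. norm (case_prod (F i) \<omega>) \<le> lbound * (T - t0)"
        using Fb sets_eq_imp_space_eq[OF Qs, of i]
        by (intro AE_I2) (simp add: space_pair_measure mem_Times_iff case_prod_beta)
      show "case_prod (F i) \<in> borel_measurable (Q i \<Otimes>\<^sub>M fst \<beta>)"
        using Fm[of i] by (simp cong: measurable_cong_sets sets_pair_measure_cong add: Qs)
    qed
    moreover
    have e: "p0 $ i * (LINT x|Q i. F i x \<omega>) = (LINT x|P. x T $ i * F i x \<omega>)" if "\<omega> \<in> space (fst \<beta>)" for \<omega>
    proof (rule conditional_law_integral[OF P Q p0])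
      from measurable_compose[OF measurable_Pair2'[OF that] Fm[of i]]
      show "(\<lambda>x. F i x \<omega>) \<in> borel_measurable (path_space t0 T)" by simp
    qed (rule Fb[OF _ that])
    ultimately have "p0 $ i * expected_payoff t0 T U V (l i) (strategy_of_control (Q i, fb)) \<beta>
      = (LINT \<omega>|fst \<beta>. p0 $ i * (LINT x|Q i. F i x \<omega>))"
      using QM.integral_snd[OF i] by simp
    also have "\<dots> = (LINT \<omega>|fst \<beta>. LINT x|P. x T $ i * F i x \<omega>)"
      by (rule Bochner_Integration.integral_cong[OF refl e])
    finally show "p0 $ i * expected_payoff t0 T U V (l i) (strategy_of_control (Q i, fb)) \<beta>
      = (LINT \<omega>|fst \<beta>. LINT x|P. x T $ i * F i x \<omega>)" .
    have "integrable (fst \<beta>) (\<lambda>\<omega>. p0 $ i * (LINT x|Q i. F i x \<omega>))"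
      using QM.integrable_snd[OF i] by simp
    then show "integrable (fst \<beta>) (\<lambda>\<omega>. LINT x|P. x T $ i * F i x \<omega>)"
      by (rule Bochner_Integration.integrable_cong[THEN iffD1, rotated 2]) (use e in auto)
  qed
  have "(\<Sum>i\<in>UNIV. p0 $ i * expected_payoff t0 T U V (l i) (strategy_of_control (Q i, fb)) \<beta>)
    = (LINT \<omega>|fst \<beta>. (\<Sum>i\<in>UNIV. LINT x|P. x T $ i * F i x \<omega>))"
    unfolding eq by (rule Bochner_Integration.integral_sum[symmetric]) (rule int)
  also have "\<dots> \<le> (LINT \<omega>|fst \<beta>. running_cost T U V l t0 P)"
    using feedback_against_delayed_le[OF P p b bm] int
    by (intro integral_mono) (auto simp: F_def)
  finally show ?thesis by (simp add: M.prob_space)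
qed

text \<open>The value ranges over strategies on spaces in \<open>E\<close>, whereas the feedback
  controls live on path space. Pulling the path back along the isomorphism keeps the joint law of
  the path and the opponent's parameter, hence every payoff.\<close>

lemma feedback_strategy_transfer:
  assumes Q: "sets Q = sets (path_space t0 T)" "member_upto_iso Q E" and E: "prob_space_family E"
  obtains \<alpha> where "\<alpha> \<in> rand_strategies E t0 T V U"
    "\<And>i \<beta>. \<beta> \<in> rand_strategies E t0 T U V \<Longrightarrow>
      expected_payoff t0 T U V (l i) \<alpha> \<beta> = expected_payoff t0 T U V (l i) (strategy_of_control (Q, fb)) \<beta>"
proof -
  obtain K f where K: "K \<in> E" and f: "f \<in> K \<rightarrow>\<^sub>M Q" "distr K Q f = Q"
    using Q(2) by (auto simp: member_upto_iso_def isomorphic_measure_spaces_def)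
  define \<alpha> where "\<alpha> = (K, \<lambda>\<omega> (v :: real \<Rightarrow> 'b). fb (f \<omega>))"
  interpret K: prob_space K using K E by (auto simp: prob_space_family_def)
  have fm: "f \<in> K \<rightarrow>\<^sub>M path_space t0 T" using f(1) Q(1) by (simp cong: measurable_cong_sets)
  have \<alpha>: "\<alpha> \<in> rand_strategies E t0 T V U"
  proof -
    have "(\<lambda>\<omega>. fb (f (fst \<omega>))) \<in> K \<Otimes>\<^sub>M spV \<rightarrow>\<^sub>M spU"
      by (rule measurable_compose[OF measurable_compose[OF measurable_fst fm] fb_measurable])
    moreover have "nonanticipative_with_delay t0 T V (space K) (\<lambda>\<omega> v. fb (f \<omega>))"
      unfolding nonanticipative_with_delay_def
      by (rule exI[of _ 1], rule exI[of _ "\<lambda>n. if n = 0 then t0 else T"]) (use t0 in auto)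
    ultimately show ?thesis using K by (simp add: \<alpha>_def rand_strategies_def case_prod_beta)
  qed
  show ?thesis
  proof (rule that[OF \<alpha>])
    fix i \<beta> assume \<beta>: "\<beta> \<in> rand_strategies E t0 T U V"
    then interpret M: prob_space "fst \<beta>" using E by (auto simp: prob_space_family_def rand_strategies_def)
    let ?G = "\<lambda>\<omega>. pay i UNIV (fb (fst \<omega>)) (snd \<beta> (snd \<omega>) (fb (fst \<omega>)))"
    have Gm: "?G \<in> borel_measurable (Q \<Otimes>\<^sub>M fst \<beta>)"
      using feedback_payoff_measurable[OF \<beta>, of i] by (simp cong: measurable_cong_sets sets_pair_measure_cong add: Q(1))
    have d: "distr (K \<Otimes>\<^sub>M fst \<beta>) (Q \<Otimes>\<^sub>M fst \<beta>) (\<lambda>(x, y). (f x, y)) = Q \<Otimes>\<^sub>M fst \<beta>"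
    proof -
      have "distr K Q f \<Otimes>\<^sub>M distr (fst \<beta>) (fst \<beta>) (\<lambda>x. x) = distr (K \<Otimes>\<^sub>M fst \<beta>) (Q \<Otimes>\<^sub>M fst \<beta>) (\<lambda>(x, y). (f x, y))"
        by (rule pair_measure_distr[OF f(1)]) (auto simp: distr_id2 intro: M.sigma_finite_measure_axioms)
      then show ?thesis by (simp add: f(2) distr_id2)
    qed
    have "expected_payoff t0 T U V (l i) \<alpha> \<beta> = (LINT \<omega>|(K \<Otimes>\<^sub>M fst \<beta>). ?G (f (fst \<omega>), snd \<omega>))"
      unfolding expected_payoff_def \<alpha>_def fst_conv snd_conv
    proof (rule Bochner_Integration.integral_cong[OF refl])
      fix \<omega> assume "\<omega> \<in> space (K \<Otimes>\<^sub>M fst \<beta>)"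
      then have "f (fst \<omega>) \<in> paths t0 T" "snd \<omega> \<in> space (fst \<beta>)"
        using measurable_space[OF fm] by (simp_all add: space_pair_measure mem_Times_iff)
      from feedback_payoff_integrand[OF \<beta> this]
      show "(case outcome t0 T U V (\<lambda>v. fb (f (fst \<omega>))) (snd \<beta> (snd \<omega>)) of (u, v) \<Rightarrow> LINT s|timeM. l i s (u s) (v s))
        = pay i UNIV (fb (f (fst \<omega>))) (snd \<beta> (snd \<omega>) (fb (f (fst \<omega>))))" .
    qed
    also have "\<dots> = (LINT \<omega>|distr (K \<Otimes>\<^sub>M fst \<beta>) (Q \<Otimes>\<^sub>M fst \<beta>) (\<lambda>(x, y). (f x, y)). ?G \<omega>)"
    proof -
      have "(\<lambda>(x, y). (f x, y)) \<in> K \<Otimes>\<^sub>M fst \<beta> \<rightarrow>\<^sub>M Q \<Otimes>\<^sub>M fst \<beta>" using f(1) by measurable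
      from integral_distr[OF this Gm] show ?thesis by (simp add: case_prod_beta)
    qed
    also have "\<dots> = expected_payoff t0 T U V (l i) (strategy_of_control (Q, fb)) \<beta>"
      unfolding d feedback_payoff_eq[OF \<beta> Q(1)] ..
    finally show "expected_payoff t0 T U V (l i) \<alpha> \<beta> = expected_payoff t0 T U V (l i) (strategy_of_control (Q, fb)) \<beta>" .
  qed
qed

end

context game
begin

text \<open>Holds without knowing that the outcome depends measurably on the random parameters: the
  integrand is bounded, and if it is not integrable the integral is 0.\<close>

lemma expected_payoff_bound:
  assumes \<alpha>: "\<alpha> \<in> rand_strategies E t0 T V U" and \<beta>: "\<beta> \<in> rand_strategies E t0 T U V"
    and E: "prob_space_family E"
  shows "\<bar>expected_payoff t0 T U V (l i) \<alpha> \<beta>\<bar> \<le> lbound * (T - t0)"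
proof -
  interpret A: prob_space "fst \<alpha>" using E \<alpha> by (auto simp: prob_space_family_def rand_strategies_def)
  interpret B: prob_space "fst \<beta>" using E \<beta> by (auto simp: prob_space_family_def rand_strategies_def)
  interpret AB: pair_prob_space "fst \<alpha>" "fst \<beta>" ..
  let ?G = "\<lambda>\<omega>. case outcome t0 T U V (snd \<alpha> (fst \<omega>)) (snd \<beta> (snd \<omega>)) of (u, v) \<Rightarrow> LINT s|timeM. l i s (u s) (v s)"
  obtain k \<tau> where p: "time_partition t0 T k \<tau>"
    and a: "\<And>\<omega>. \<omega> \<in> space (fst \<alpha>) \<Longrightarrow> delayed_map t0 \<tau> k ctlV ctlU (snd \<alpha> \<omega>)"
    by (rule rand_strategies_delayed[OF \<alpha>]) blast
  obtain k' \<tau>' where p': "time_partition t0 T k' \<tau>'"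
    and b: "\<And>\<omega>. \<omega> \<in> space (fst \<beta>) \<Longrightarrow> delayed_map t0 \<tau>' k' ctlU ctlV (snd \<beta> \<omega>)"
    by (rule rand_strategies_delayed[OF \<beta>]) blast
  have G: "\<bar>?G \<omega>\<bar> \<le> lbound * (T - t0)" if "\<omega> \<in> space (fst \<alpha> \<Otimes>\<^sub>M fst \<beta>)" for \<omega>
  proof -
    have \<omega>: "fst \<omega> \<in> space (fst \<alpha>)" "snd \<omega> \<in> space (fst \<beta>)" using that by (auto simp: space_pair_measure)
    obtain u v where o: "outcome t0 T U V (snd \<alpha> (fst \<omega>)) (snd \<beta> (snd \<omega>)) = (u, v)" "u \<in> ctlU" "v \<in> ctlV"
      by (rule outcome_spec[OF p a[OF \<omega>(1)] p' b[OF \<omega>(2)] ctlV_nonempty]) blast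
    show ?thesis using pay_bound[OF o(2,3), of UNIV i] by (simp add: o(1) pay_def)
  qed
  show ?thesis
  proof (cases "integrable (fst \<alpha> \<Otimes>\<^sub>M fst \<beta>) ?G")
    case True
    have "\<bar>LINT \<omega>|(fst \<alpha> \<Otimes>\<^sub>M fst \<beta>). ?G \<omega>\<bar> \<le> (LINT \<omega>|(fst \<alpha> \<Otimes>\<^sub>M fst \<beta>). lbound * (T - t0))"
    proof (rule integral_abs_le)
      fix \<omega> assume "\<omega> \<in> space (fst \<alpha> \<Otimes>\<^sub>M fst \<beta>)"
      then show "\<bar>?G \<omega>\<bar> \<le> lbound * (T - t0)" by (rule G)
    qed (use True in simp_all)
    then show ?thesis by (simp add: expected_payoff_def AB.prob_space)
  next
    case False
    then show ?thesis using lbound(1) t0 by (simp add: expected_payoff_def not_integrable_integral_eq)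
  qed
qed

lemma const_strategy:
  assumes "M \<in> E" "v \<in> ctlV"
  shows "(M, \<lambda>\<omega> u. v) \<in> rand_strategies E t0 T U V"
proof -
  have "nonanticipative_with_delay t0 T U (space M) (\<lambda>\<omega> u. v)"
    unfolding nonanticipative_with_delay_def
    by (rule exI[of _ 1], rule exI[of _ "\<lambda>n. if n = 0 then t0 else T"]) (use t0 in auto)
  then show ?thesis using assms by (simp add: rand_strategies_def case_prod_beta)
qed

end

section \<open>Martingale measures from finite belief trees\<close>

lemma cadlag_const: "cadlag (\<lambda>_. c)"
  by (auto simp: cadlag_def intro: tendsto_const)

lemma cadlag_switch:
  assumes "cadlag f"
  shows "cadlag (\<lambda>t. if t < c then f t else (a :: 'c::topological_space))"
  unfolding cadlag_def
proof
  fix t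
  let ?g = "\<lambda>t. if t < c then f t else a"
  show "(?g \<longlongrightarrow> ?g t) (at_right t) \<and> (\<exists>y. (?g \<longlongrightarrow> y) (at_left t))"
  proof
    show "(?g \<longlongrightarrow> ?g t) (at_right t)"
    proof (cases "t < c")
      case True
      have "eventually (\<lambda>s. f s = ?g s) (at_right t)"
        using True by (auto simp: eventually_at_right[OF True] intro!: exI[of _ c])
      moreover have "(f \<longlongrightarrow> ?g t) (at_right t)" using assms True by (simp add: cadlag_def)
      ultimately show ?thesis by (rule Lim_transform_eventually[rotated])
    next
      case False
      have "eventually (\<lambda>s. ?g t = ?g s) (at_right t)"
        using False by (auto simp: eventually_at_right[of t "t+1"] intro!: exI[of _ "t+1"])
      then show ?thesis by (rule Lim_transform_eventually[OF tendsto_const])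
    qed
    show "\<exists>y. (?g \<longlongrightarrow> y) (at_left t)"
    proof (cases "t \<le> c")
      case True
      obtain y where "(f \<longlongrightarrow> y) (at_left t)" using assms by (auto simp: cadlag_def)
      moreover have "eventually (\<lambda>s. f s = ?g s) (at_left t)"
        using True by (auto simp: eventually_at_left[of "t-1"] intro!: exI[of _ "t-1"])
      ultimately show ?thesis by (intro exI[of _ y]) (rule Lim_transform_eventually)
    next
      case False
      then have "eventually (\<lambda>s. a = ?g s) (at_left t)"
        by (auto simp: eventually_at_left[of c] intro!: exI[of _ c])
      then show ?thesis by (intro exI[of _ a]) (rule Lim_transform_eventually[OF tendsto_const])
    qed
  qed
qed

text \<open>Here \<open>q i h\<close> stands for the joint probability of the type \<open>i\<close>
  and the observation history \<open>h\<close>, most recent observation first. Only the consistency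
  \<open>q_sum\<close> is kept, so that the martingale argument is independent of where the masses
  come from.\<close>

locale belief_tree = game l U V T t0
  for l :: "'i::finite \<Rightarrow> real \<Rightarrow> 'a::euclidean_space \<Rightarrow> 'b::euclidean_space \<Rightarrow> real"
    and U V T t0 +
  fixes N :: nat and tt :: "nat \<Rightarrow> real" and Y :: "'y set"
    and q :: "'i \<Rightarrow> 'y list \<Rightarrow> real" and p0 :: "real ^ 'i"
  assumes part: "time_partition t0 T N tt" and Y: "finite Y" and p0: "p0 \<in> prob_simplex"
    and q_nonneg: "\<And>i h. 0 \<le> q i h" and q_Nil: "\<And>i. q i [] = p0 $ i"
    and q_sum: "\<And>i h. length h < N \<Longrightarrow> set h \<subseteq> Y \<Longrightarrow> (\<Sum>y\<in>Y. q i (y # h)) = q i h"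
begin

definition hist :: "nat \<Rightarrow> 'y list set" where "hist n = {h. set h \<subseteq> Y \<and> length h = n}"

definition tot :: "'y list \<Rightarrow> real" where "tot h = (\<Sum>i\<in>UNIV. q i h)"

text \<open>Bayes' formula. The default on histories without mass keeps the value in the simplex,
  and \<open>tot h * post h $ i = q i h\<close> still holds there because all masses vanish.\<close>

definition post :: "'y list \<Rightarrow> real ^ 'i" where
  "post h = (if tot h = 0 then p0 else (\<chi> i. q i h / tot h))"

lemma finite_hist [simp]: "finite (hist n)"
  unfolding hist_def by (rule finite_lists_length_eq[OF Y])

lemma tot_nonneg: "0 \<le> tot h" by (simp add: tot_def sum_nonneg q_nonneg)

lemma tot_post: "tot h * post h $ i = q i h"
proof (cases "tot h = 0")
  case True
  then have "\<forall>i. q i h = 0" by (simp add: tot_def q_nonneg sum_nonneg_eq_0_iff)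
  then show ?thesis using True by simp
qed (simp add: post_def)

lemma post_simplex: "post h \<in> prob_simplex"
proof (cases "tot h = 0")
  case False
  have "(\<Sum>i\<in>UNIV. q i h / tot h) = 1"
    unfolding sum_divide_distrib[symmetric] using False by (simp add: tot_def[symmetric])
  then show ?thesis using False by (simp add: post_def prob_simplex_def q_nonneg tot_nonneg)
qed (simp add: post_def p0)

lemma post_Nil: "post [] = p0"
proof -
  have "tot [] = 1" using p0 by (simp add: tot_def q_Nil prob_simplex_def)
  then show ?thesis by (simp add: post_def q_Nil vec_eq_iff)
qed

lemma hist_0: "hist 0 = {[]}" by (auto simp: hist_def)

lemma sum_hist_Suc:
  fixes f :: "'y list \<Rightarrow> real"
  shows "(\<Sum>h\<in>hist (Suc n). f h) = (\<Sum>h\<in>hist n. \<Sum>y\<in>Y. f (y # h))"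
proof -
  have "hist (Suc n) = (\<lambda>(h, y). y # h) ` (hist n \<times> Y)"
    unfolding hist_def by (force simp: length_Suc_conv image_iff)
  moreover have inj: "inj_on (\<lambda>(h, y). y # h) (hist n \<times> Y)" by (auto simp: inj_on_def)
  ultimately show ?thesis
    using sum.reindex[OF inj, of f] by (simp add: sum.cartesian_product case_prod_beta o_def)
qed

text \<open>\<open>drop k\<close> forgets the \<open>k\<close> most recent observations; consistency
  of the masses sums them out one at a time.\<close>

lemma marginal:
  assumes "n + k \<le> N"
  shows "(\<Sum>h\<in>hist (n + k). f (drop k h) * q i h) = (\<Sum>g\<in>hist n. f g * q i g)"
  using assms
proof (induction k)
  case (Suc k)
  have "(\<Sum>h\<in>hist (n + Suc k). f (drop (Suc k) h) * q i h) = (\<Sum>h\<in>hist (n + k). f (drop k h) * (\<Sum>y\<in>Y. q i (y # h)))"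
    by (simp add: sum_hist_Suc sum_distrib_left)
  also have "\<dots> = (\<Sum>h\<in>hist (n + k). f (drop k h) * q i h)"
    using Suc.prems by (intro sum.cong) (auto simp: hist_def q_sum)
  finally show ?case using Suc by simp
qed simp

lemma mass: "n \<le> N \<Longrightarrow> (\<Sum>h\<in>hist n. q i h) = p0 $ i"
  using marginal[of 0 n "\<lambda>_. 1" i] by (simp add: hist_0 q_Nil)

lemma mass_tot: "n \<le> N \<Longrightarrow> (\<Sum>h\<in>hist n. tot h) = 1"
  unfolding tot_def by (subst sum.swap) (use p0 in \<open>simp add: mass prob_simplex_def\<close>)

lemma tot_sum: "length h < N \<Longrightarrow> set h \<subseteq> Y \<Longrightarrow> (\<Sum>y\<in>Y. tot (y # h)) = tot h"
  unfolding tot_def by (subst sum.swap) (simp add: q_sum)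

text \<open>The observation \<open>y\<close> belongs to the period that ends at
  \<open>tt (Suc (length h))\<close> and becomes effective only then; during that period the belief
  is still \<open>post h\<close>.\<close>

primrec belief :: "'y list \<Rightarrow> real \<Rightarrow> real ^ 'i" where
  "belief [] t = p0"
| "belief (y # h) t = (if t < tt (Suc (length h)) then belief h t else post (y # h))"

definition belief_path :: "'i \<times> 'y list \<Rightarrow> real \<Rightarrow> real ^ 'i" where
  "belief_path z t = (if t < T then belief (snd z) t else axis (fst z) 1)"

lemma tt_mono: "m \<le> n \<Longrightarrow> n \<le> N \<Longrightarrow> tt m \<le> tt n"
  using time_partition_mono[OF part] .

lemma tt_0: "tt 0 = t0" and tt_N: "tt N = T"
  using part by (auto simp: time_partition_def)

text \<open>Later observations act only at later grid times, so before \<open>tt (Suc m)\<close>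
  just the \<open>m\<close> oldest ones matter: the belief does not anticipate.\<close>

lemma belief_drop:
  assumes "length h = m + k" "m + k \<le> N" "t < tt (Suc m)"
  shows "belief h t = belief (drop k h) t"
  using assms
proof (induction k arbitrary: h)
  case (Suc k)
  then obtain y h' where h: "h = y # h'" by (cases h) auto
  have "tt (Suc m) \<le> tt (Suc (length h'))" using Suc.prems h by (intro tt_mono) auto
  then show ?case using Suc h by simp
qed simp

lemma belief_post:
  assumes "length g = 0 \<or> tt (length g) \<le> t"
  shows "belief g t = post g"
  using assms by (cases g) (auto simp: post_Nil)

lemma belief_simplex: "belief h t \<in> prob_simplex"
  by (induction h) (auto simp: p0 post_simplex)

lemma belief_cadlag: "cadlag (belief h)"
proof (induction h)
  case Nil
  have "belief [] = (\<lambda>_. p0)" by (rule ext) simp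
  then show ?case by (simp add: cadlag_const)
next
  case (Cons y h)
  have "belief (y # h) = (\<lambda>t. if t < tt (Suc (length h)) then belief h t else post (y # h))" by (rule ext) simp
  then show ?case using cadlag_switch[OF Cons] by simp
qed

lemma belief_before: "length h \<le> N \<Longrightarrow> t < t0 \<Longrightarrow> belief h t = p0"
proof (induction h)
  case (Cons y h)
  have "tt 0 \<le> tt (Suc (length h))" using Cons.prems by (intro tt_mono) auto
  then show ?case using Cons by (simp add: tt_0)
qed simp

lemma belief_path_paths:
  assumes "length (snd z) \<le> N"
  shows "belief_path z \<in> paths t0 T"
proof -
  have "belief_path z = (\<lambda>t. if t < T then belief (snd z) t else axis (fst z) 1)"
    by (rule ext) (simp add: belief_path_def)
  then have "cadlag (belief_path z)" using cadlag_switch[OF belief_cadlag] by simp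
  moreover have "belief_path z t \<in> prob_simplex" for t
  proof -
    have "axis (fst z) 1 \<in> (prob_simplex :: (real ^ 'i) set)"
      by (auto simp: prob_simplex_def axis_def)
    then show ?thesis by (simp add: belief_path_def belief_simplex)
  qed
  moreover have "belief_path z constant_on {..<t0}"
    unfolding constant_on_def using belief_before[OF assms] t0 by (intro exI[of _ p0]) (auto simp: belief_path_def)
  moreover have "belief_path z constant_on {T..}"
    unfolding constant_on_def by (intro exI[of _ "axis (fst z) 1"]) (auto simp: belief_path_def)
  ultimately show ?thesis by (simp add: paths_def)
qed

section \<open>The law of the belief path is a martingale measure\<close>

definition tree_pmf :: "('i \<times> 'y list) pmf" where
  "tree_pmf = embed_pmf (\<lambda>z. if snd z \<in> hist N then q (fst z) (snd z) else 0)"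

lemma pmf_tree: "pmf tree_pmf z = (if snd z \<in> hist N then q (fst z) (snd z) else 0)"
  unfolding tree_pmf_def
proof (rule pmf_embed_pmf)
  let ?f = "\<lambda>z. if snd z \<in> hist N then q (fst z) (snd z) else 0"
  have "(\<integral>\<^sup>+z. ennreal (?f z) \<partial>count_space UNIV) = (\<Sum>z\<in>UNIV \<times> hist N. ennreal (?f z))"
    by (rule nn_integral_count_space'[where A="UNIV \<times> hist N"]) (auto split: if_splits)
  also have "\<dots> = ennreal (\<Sum>z\<in>UNIV \<times> hist N. ?f z)"
    by (rule sum_ennreal) (simp add: q_nonneg)
  also have "(\<Sum>z\<in>UNIV \<times> hist N. ?f z) = (\<Sum>i\<in>UNIV. \<Sum>h\<in>hist N. q i h)"
    unfolding sum.cartesian_product by (rule sum.cong) auto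
  also have "\<dots> = 1" using p0 by (simp add: mass prob_simplex_def)
  finally show "(\<integral>\<^sup>+z. ennreal (?f z) \<partial>count_space UNIV) = 1" by simp
qed (simp add: q_nonneg)

text \<open>Histories longer than \<open>N\<close> carry no mass; they are sent to an arbitrary admissible path.\<close>

definition tree_path :: "'i \<times> 'y list \<Rightarrow> real \<Rightarrow> real ^ 'i" where
  "tree_path z = belief_path (if length (snd z) \<le> N then z else (fst z, []))"

lemma tree_path_paths: "tree_path z \<in> paths t0 T"
  unfolding tree_path_def by (rule belief_path_paths) simp

lemma tree_path_hist: "h \<in> hist N \<Longrightarrow> tree_path (i, h) = belief_path (i, h)"
  by (simp add: tree_path_def hist_def)

definition tree_law :: "(real \<Rightarrow> real ^ 'i) measure" where
  "tree_law = distr (measure_pmf tree_pmf) (path_space t0 T) tree_path"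

lemma tree_path_measurable: "tree_path \<in> measure_pmf tree_pmf \<rightarrow>\<^sub>M path_space t0 T"
  by (rule measurableI) (simp_all add: tree_path_paths)

lemma tree_law_sets: "sets tree_law = sets (path_space t0 T)"
  by (simp add: tree_law_def)

lemma tree_law_prob: "prob_space tree_law"
  unfolding tree_law_def by (rule measure_pmf.prob_space_distr[OF tree_path_measurable])

lemma tree_law_space: "space tree_law = paths t0 T"
  by (simp add: tree_law_def)

text \<open>Reduces all path integrals to finite sums over types and histories. Different histories
  may give the same path; the sum simply counts each with its mass.\<close>

lemma tree_law_integral:
  fixes f :: "(real \<Rightarrow> real ^ 'i) \<Rightarrow> real"
  assumes "f \<in> borel_measurable (path_space t0 T)"
  shows "(LINT x|tree_law. f x) = (\<Sum>i\<in>UNIV. \<Sum>h\<in>hist N. q i h * f (belief_path (i, h)))"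
proof -
  have "(LINT x|tree_law. f x) = (LINT z|measure_pmf tree_pmf. f (tree_path z))"
    unfolding tree_law_def by (rule integral_distr[OF tree_path_measurable assms])
  also have "\<dots> = (\<Sum>z\<in>UNIV \<times> hist N. f (tree_path z) * pmf tree_pmf z)"
    by (rule integral_measure_pmf_real) (auto simp: set_pmf_iff pmf_tree split: if_splits)
  also have "\<dots> = (\<Sum>z\<in>UNIV \<times> hist N. q (fst z) (snd z) * f (belief_path z))"
    by (rule sum.cong) (auto simp: pmf_tree tree_path_hist)
  also have "\<dots> = (\<Sum>i\<in>UNIV. \<Sum>h\<in>hist N. q i h * f (belief_path (i, h)))"
    by (simp add: sum.cartesian_product case_prod_beta)
  finally show ?thesis .
qed

lemma terminal_belief: "belief_path (j, h) T $ i = (if i = j then 1 else 0)"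
  by (simp add: belief_path_def axis_def)

text \<open>At a time \<open>s\<close> of period \<open>j\<close> membership in \<open>A\<close>
  depends only on the first \<open>j\<close> observations and not on the type. Summing out the later
  ones gives the mass of type \<open>i\<close>, and this mass is the belief times the total
  mass.\<close>

lemma tree_martingale_terminal:
  assumes A: "A \<in> sets (path_filtration t0 T s)" and s: "s < T"
  shows "(LINT x|tree_law. indicator A x * x T $ i) = (LINT x|tree_law. indicator A x * x s $ i)"
proof -
  have AM: "A \<in> sets (path_space t0 T)" using A path_filtration_subset by auto
  have m: "(\<lambda>x. indicator A x * x r $ i) \<in> borel_measurable (path_space t0 T)" for r
    using AM by (intro borel_measurable_times measurable_compose[OF coordinate_measurable component_measurable]) auto
  define j where "j = (LEAST j. s < tt (Suc j))"
  have N0: "N > 0" using tt_0 tt_N t0 by (cases N) auto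
  have ex: "s < tt (Suc (N - 1))" using s N0 tt_N by simp
  have j: "s < tt (Suc j)" unfolding j_def by (rule LeastI[of _ "N - 1"]) (rule ex)
  have jN: "j < N"
  proof -
    have "j \<le> N - 1" unfolding j_def by (rule Least_le) (rule ex)
    then show ?thesis using N0 by simp
  qed
  \<comment> \<open>The case \<open>j = 0\<close> also contains the times before \<open>t0\<close>,
    at which the belief is the prior, that is \<open>post []\<close>.\<close>
  have jt: "j = 0 \<or> tt j \<le> s"
  proof (cases j)
    case (Suc m)
    have "\<not> s < tt (Suc m)" using not_less_Least[of m "\<lambda>j. s < tt (Suc j)"] Suc by (simp add: j_def)
    then show ?thesis using Suc by simp
  qed simp
  \<comment> \<open>A version of the indicator that sees only the first \<open>j\<close>
    observations: the rest of the history and the type are filled in arbitrarily. Padding to length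
    \<open>N\<close> makes \<open>belief_drop\<close> applicable, and the padding is dropped
    again.\<close>
  define a where "a g = (indicator A (belief_path (undefined, replicate (N - j) undefined @ g)) :: real)" for g
  have len: "length h = j + (N - j)" if "h \<in> hist N" for h using that jN by (simp add: hist_def)
  have dropN: "drop (N - j) (replicate (N - j) undefined @ g) = g" for g by simp
  have ind: "indicator A (belief_path (i', h)) = a (drop (N - j) h)" if h: "h \<in> hist N" for i' h
  proof -
    let ?h' = "replicate (N - j) undefined @ drop (N - j) h"
    have lh: "length h = N" using h by (simp add: hist_def)
    have "belief_path (i', h) r = belief_path (undefined, ?h') r" if "r \<le> s" for r
    proof -
      have "r < tt (Suc j)" "r < T" using that j s by auto
      then show ?thesis
        using belief_drop[of h j "N - j" r] belief_drop[of ?h' j "N - j" r] lh jN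
        by (simp add: belief_path_def)
    qed
    then have "belief_path (i', h) \<in> A \<longleftrightarrow> belief_path (undefined, ?h') \<in> A"
      using lh jN by (intro path_filtration_determined[OF A] belief_path_paths) auto
    then show ?thesis by (simp add: a_def indicator_def)
  qed
  have "(LINT x|tree_law. indicator A x * x T $ i) = (\<Sum>i'\<in>UNIV. \<Sum>h\<in>hist N. q i' h * (a (drop (N - j) h) * (if i = i' then 1 else 0)))"
    unfolding tree_law_integral[OF m] by (intro sum.cong refl) (simp add: ind terminal_belief)
  also have "\<dots> = (\<Sum>i'\<in>UNIV. if i = i' then \<Sum>h\<in>hist N. a (drop (N - j) h) * q i' h else 0)"
    by (intro sum.cong refl) (auto simp: mult.commute)
  also have "\<dots> = (\<Sum>h\<in>hist N. a (drop (N - j) h) * q i h)" by simp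
  also have "\<dots> = (\<Sum>g\<in>hist j. a g * q i g)"
    using marginal[of j "N - j" a i] jN by simp
  \<comment> \<open>The mass of type \<open>i\<close> is written as its belief times the total mass,
    and the latter is spread over all types, so that \<open>marginal\<close> can be read backwards
    for each type.\<close>
  also have "\<dots> = (\<Sum>g\<in>hist j. \<Sum>i'\<in>UNIV. (a g * post g $ i) * q i' g)"
  proof (intro sum.cong refl)
    fix g
    have "a g * q i g = (a g * post g $ i) * tot g" unfolding tot_post[of g i, symmetric] by simp
    then show "a g * q i g = (\<Sum>i'\<in>UNIV. (a g * post g $ i) * q i' g)" by (simp only: tot_def sum_distrib_left)
  qed
  also have "\<dots> = (\<Sum>i'\<in>UNIV. \<Sum>g\<in>hist j. (a g * post g $ i) * q i' g)" by (rule sum.swap)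
  also have "\<dots> = (\<Sum>i'\<in>UNIV. \<Sum>h\<in>hist N. (a (drop (N - j) h) * post (drop (N - j) h) $ i) * q i' h)"
    using marginal[of j "N - j" "\<lambda>g. a g * post g $ i"] jN by simp
  also have "\<dots> = (\<Sum>i'\<in>UNIV. \<Sum>h\<in>hist N. q i' h * (indicator A (belief_path (i', h)) * belief_path (i', h) s $ i))"
  proof (intro sum.cong refl)
    fix i' h assume h: "h \<in> hist N"
    have lh: "length h = N" using h by (simp add: hist_def)
    have "belief h s = belief (drop (N - j) h) s"
      using belief_drop[of h j "N - j" s] j lh jN by simp
    also have "\<dots> = post (drop (N - j) h)" using jt lh jN by (intro belief_post) auto
    finally show "a (drop (N - j) h) * post (drop (N - j) h) $ i * q i' h =
      q i' h * (indicator A (belief_path (i', h)) * belief_path (i', h) s $ i)"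
      using s by (simp add: ind[OF h] belief_path_def)
  qed
  also have "\<dots> = (LINT x|tree_law. indicator A x * x s $ i)"
    unfolding tree_law_integral[OF m] ..
  finally show ?thesis .
qed

text \<open>Before \<open>T\<close> both times are compared with the terminal value, as an event
  known at \<open>s\<close> is also known at \<open>t\<close>; from \<open>T\<close> on paths are
  constant.\<close>

lemma tree_law_martingale: "martingale tree_law (path_filtration t0 T) (\<lambda>t x. x t $ i)"
  unfolding martingale_def
proof (intro conjI allI impI)
  interpret P: prob_space tree_law by (rule tree_law_prob)
  show "filtration (space tree_law) (path_filtration t0 T)"
    by (simp add: tree_law_space path_filtration_filtration)
  show sub: "subalgebra tree_law (path_filtration t0 T t)" for t
    using path_filtration_subset by (auto simp: subalgebra_def tree_law_space tree_law_sets)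
  have mF: "(\<lambda>x. x t $ i) \<in> borel_measurable (path_filtration t0 T t)" for t
    by (rule measurable_compose[OF coordinate_measurable_filtration component_measurable]) simp
  then show "(\<lambda>x. x t $ i) \<in> borel_measurable (path_filtration t0 T t)" for t .
  show int: "integrable tree_law (\<lambda>x. x t $ i)" for t
  proof (rule P.integrable_const_bound[where B=1])
    show "(\<lambda>x. x t $ i) \<in> borel_measurable tree_law" by (rule measurable_from_subalg[OF sub mF])
    show "AE x in tree_law. norm (x t $ i) \<le> 1"
    proof (rule AE_I2)
      fix x :: "real \<Rightarrow> real ^ 'i" assume "x \<in> space tree_law"
      then show "norm (x t $ i) \<le> 1"
        using simplex_component[OF path_simplex, of x t i] by (simp add: tree_law_space)
    qed
  qed
  fix s t :: real assume st: "s \<le> t"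
  interpret F: finite_measure_subalgebra tree_law "path_filtration t0 T s"
    by unfold_locales (rule sub)
  show "AE x in tree_law. real_cond_exp tree_law (path_filtration t0 T s) (\<lambda>x. x t $ i) x = x s $ i"
  proof (rule F.real_cond_exp_charact)
    fix A :: "(real \<Rightarrow> real ^ 'i) set" assume A: "A \<in> sets (path_filtration t0 T s)"
    have At: "A \<in> sets (path_filtration t0 T t)"
      using A st filtration.sets_F_mono[OF path_filtration_filtration] by blast
    have "(LINT x|tree_law. indicator A x * x t $ i) = (LINT x|tree_law. indicator A x * x s $ i)"
    proof (cases "t < T")
      case True
      then show ?thesis using tree_martingale_terminal[OF At True, of i] tree_martingale_terminal[OF A, of i] st by simp
    next
      case False
      have tT: "x t = x T" if "x \<in> paths t0 T" for x :: "real \<Rightarrow> real ^ 'i"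
        using that False by (auto simp: paths_def constant_on_def)
      show ?thesis
      proof (cases "s < T")
        case True
        have "(LINT x|tree_law. indicator A x * x t $ i) = (LINT x|tree_law. indicator A x * x T $ i)"
          by (intro Bochner_Integration.integral_cong refl) (simp add: tree_law_space tT)
        then show ?thesis using tree_martingale_terminal[OF A True] by simp
      next
        case sF: False
        have sT: "x s = x T" if "x \<in> paths t0 T" for x :: "real \<Rightarrow> real ^ 'i"
          using that sF by (auto simp: paths_def constant_on_def)
        show ?thesis
        proof (rule Bochner_Integration.integral_cong[OF refl])
          fix x :: "real \<Rightarrow> real ^ 'i" assume "x \<in> space tree_law"
          then have "x \<in> paths t0 T" by (simp add: tree_law_space)
          then show "indicator A x * x t $ i = indicator A x * x s $ i" by (simp only: tT sT)
        qed
      qed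
    qed
    then show "(LINT x:A|tree_law. x t $ i) = (LINT x:A|tree_law. x s $ i)"
      by (simp add: set_lebesgue_integral_def)
  qed (use int mF in auto)
qed

lemma tree_law_martingale_measure: "tree_law \<in> martingale_measures t0 T p0"
proof -
  \<comment> \<open>Paths are constant before \<open>t0\<close> and from \<open>T\<close> on, so two
    times decide the conditions at all times and give a measurable event.\<close>
  let ?A = "{x \<in> paths t0 T. x (t0 - 1) = p0 \<and> x T \<in> range (\<lambda>i. axis i 1)}"
  have fin: "finite (range (\<lambda>i. axis i 1 :: real ^ 'i))" by simp
  have AM: "?A \<in> sets (path_space t0 T)"
  proof -
    have "?A = ((\<lambda>x. x (t0 - 1)) -` {p0} \<inter> space (path_space t0 T)) \<inter>
        ((\<lambda>x. x T) -` range (\<lambda>i. axis i 1) \<inter> space (path_space t0 T))" by auto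
    also have "\<dots> \<in> sets (path_space t0 T)"
      using finite_imp_closed[OF fin]
      by (intro sets.Int measurable_sets[OF coordinate_measurable]) auto
    finally show ?thesis .
  qed
  have "AE x in tree_law. x \<in> ?A"
    unfolding tree_law_def
  proof (subst AE_distr_iff[OF tree_path_measurable])
    show "{x \<in> space (path_space t0 T). x \<in> ?A} \<in> sets (path_space t0 T)" using AM by (simp add: Int_absorb1 Collect_conj_eq)
    show "AE z in measure_pmf tree_pmf. tree_path z \<in> ?A"
    proof (rule AE_pmfI)
      fix z
      have "tree_path z (t0 - 1) = p0" using t0 by (auto simp: tree_path_def belief_path_def belief_before)
      moreover have "tree_path z T \<in> range (\<lambda>i. axis i 1)" by (auto simp: tree_path_def belief_path_def)
      ultimately show "tree_path z \<in> ?A" using tree_path_paths by auto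
    qed
  qed
  then have "AE x in tree_law. (\<forall>t<t0. x t = p0) \<and> (\<forall>t\<ge>T. x t \<in> range (\<lambda>i. axis i 1))"
  proof eventually_elim
    case (elim x)
    then have x: "x \<in> paths t0 T" "x (t0 - 1) = p0" "x T \<in> range (\<lambda>i. axis i 1)" by auto
    have "x t = p0" if "t < t0" for t
    proof -
      have "x t = x (t0 - 1)" using x(1) that by (auto simp: paths_def constant_on_def)
      then show ?thesis using x(2) by simp
    qed
    moreover have "x t \<in> range (\<lambda>i. axis i 1)" if "t \<ge> T" for t
    proof -
      have "x t = x T" using x(1) that by (auto simp: paths_def constant_on_def)
      then show ?thesis using x(3) by simp
    qed
    ultimately show ?case by blast
  qed
  then show ?thesis
    by (simp add: martingale_measures_def tree_law_prob tree_law_sets tree_law_martingale)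
qed

section \<open>Running cost and quadratic variation of the beliefs\<close>

definition cost_upto :: "nat \<Rightarrow> real" where
  "cost_upto n = (\<Sum>h\<in>hist n. tot h * (LINT s|timeM. indicator {t0..<tt n} s * H s (belief h s)))"

lemma belief_measurable [measurable]: "belief h \<in> borel_measurable timeM"
proof (induction h)
  case Nil
  have "belief [] = (\<lambda>_. p0)" by (rule ext) simp
  then show ?case by simp
next
  case (Cons y h)
  note [measurable] = Cons
  have "belief (y # h) = (\<lambda>t. if t < tt (Suc (length h)) then belief h t else post (y # h))" by (rule ext) simp
  then show ?case by simp
qed

lemma H_belief_measurable [measurable]: "(\<lambda>s. H s (belief h s)) \<in> borel_measurable timeM"
  using t0 by (intro H_measurable) (auto simp: belief_simplex)

lemma H_belief_integrable:
  assumes [measurable]: "S \<in> sets borel"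
  shows "integrable timeM (\<lambda>s. indicator S s * H s (belief h s))"
proof (rule integrable_bounded_on_Icc[where C=lbound])
  show "(\<lambda>s. indicator S s * H s (belief h s)) \<in> borel_measurable timeM" by measurable
  show "\<bar>indicator S s * H s (belief h s)\<bar> \<le> lbound" if "s \<in> {t0..T}" for s
    using H_bound[OF belief_simplex, of s h s] that t0 lbound(1) by (auto simp: indicator_def)
qed

lemma H_const_integrable:
  assumes [measurable]: "S \<in> sets borel" and p: "p \<in> prob_simplex"
  shows "integrable timeM (\<lambda>s. indicator S s * H s p)"
proof (rule integrable_bounded_on_Icc[where C=lbound])
  have [measurable]: "(\<lambda>s. H s p) \<in> borel_measurable timeM"
    using t0 p by (intro H_measurable) auto
  show "(\<lambda>s. indicator S s * H s p) \<in> borel_measurable timeM" by measurable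
  show "\<bar>indicator S s * H s p\<bar> \<le> lbound" if "s \<in> {t0..T}" for s
    using H_bound[OF p, of s] that t0 lbound(1) by (auto simp: indicator_def)
qed

lemma cost_upto_0: "cost_upto 0 = 0"
  by (simp add: cost_upto_def tt_0)

text \<open>During period \<open>n\<close> the belief does not yet depend on that period's
  observation, which is therefore summed out by consistency; the new cost is evaluated at the old
  posteriors.\<close>

lemma cost_upto_Suc:
  assumes "n < N"
  shows "cost_upto (Suc n) = cost_upto n + (\<Sum>h\<in>hist n. tot h * (LINT s|timeM. indicator {tt n..<tt (Suc n)} s * H s (post h)))"
proof -
  have mono: "t0 \<le> tt n" "tt n \<le> tt (Suc n)" using tt_mono[of 0 n] tt_mono[of n "Suc n"] assms tt_0 by auto
  have "cost_upto (Suc n) = (\<Sum>h\<in>hist n. \<Sum>y\<in>Y. tot (y # h) * (LINT s|timeM. indicator {t0..<tt (Suc n)} s * H s (belief (y # h) s)))"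
    by (simp add: cost_upto_def sum_hist_Suc del: belief.simps)
  also have "\<dots> = (\<Sum>h\<in>hist n. \<Sum>y\<in>Y. tot (y # h) * (LINT s|timeM. indicator {t0..<tt (Suc n)} s * H s (belief h s)))"
  proof (intro sum.cong refl)
    fix h y assume "h \<in> hist n"
    then have "indicator {t0..<tt (Suc n)} s * H s (belief (y # h) s) = indicator {t0..<tt (Suc n)} s * H s (belief h s)" for s
      by (auto simp: indicator_def hist_def)
    then show "tot (y # h) * (LINT s|timeM. indicator {t0..<tt (Suc n)} s * H s (belief (y # h) s)) =
      tot (y # h) * (LINT s|timeM. indicator {t0..<tt (Suc n)} s * H s (belief h s))" by presburger
  qed
  also have "\<dots> = (\<Sum>h\<in>hist n. tot h * (LINT s|timeM. indicator {t0..<tt (Suc n)} s * H s (belief h s)))"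
    using assms by (intro sum.cong refl) (simp add: sum_distrib_right[symmetric] tot_sum hist_def)
  also have "\<dots> = (\<Sum>h\<in>hist n. tot h * (LINT s|timeM. indicator {t0..<tt n} s * H s (belief h s)) + tot h * (LINT s|timeM. indicator {tt n..<tt (Suc n)} s * H s (post h)))"
  proof (intro sum.cong refl)
    fix h assume h: "h \<in> hist n"
    have "indicator {t0..<tt (Suc n)} s * H s (belief h s) = indicator {t0..<tt n} s * H s (belief h s) + indicator {tt n..<tt (Suc n)} s * H s (post h)" for s
      using mono h belief_post[of h s] by (auto simp: indicator_def hist_def)
    then have "(LINT s|timeM. indicator {t0..<tt (Suc n)} s * H s (belief h s)) = (LINT s|timeM. indicator {t0..<tt n} s * H s (belief h s)) + (LINT s|timeM. indicator {tt n..<tt (Suc n)} s * H s (post h))"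
      by (simp add: H_belief_integrable H_const_integrable post_simplex)
    then show "tot h * (LINT s|timeM. indicator {t0..<tt (Suc n)} s * H s (belief h s)) =
      tot h * (LINT s|timeM. indicator {t0..<tt n} s * H s (belief h s)) + tot h * (LINT s|timeM. indicator {tt n..<tt (Suc n)} s * H s (post h))"
      by (simp add: distrib_left)
  qed
  also have "\<dots> = cost_upto n + (\<Sum>h\<in>hist n. tot h * (LINT s|timeM. indicator {tt n..<tt (Suc n)} s * H s (post h)))"
    by (simp add: sum.distrib cost_upto_def)
  finally show ?thesis .
qed

text \<open>The revealing jump takes place at the single time \<open>T\<close> and costs nothing, so
  the type disappears from the cost and only total masses remain.\<close>

lemma running_cost_tree: "running_cost T U V l t0 tree_law = cost_upto N"
proof -
  interpret t: finite_measure timeM by simp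
  have "(\<lambda>x. LINT s|timeM. H s (x s)) \<in> borel_measurable (path_space t0 T)"
    by (rule t.borel_measurable_lebesgue_integral) (use H_path_measurable in \<open>simp add: case_prod_beta\<close>)
  then have "running_cost T U V l t0 tree_law = (\<Sum>i\<in>UNIV. \<Sum>h\<in>hist N. q i h * (LINT s|timeM. H s (belief_path (i, h) s)))"
    unfolding running_cost_def by (rule tree_law_integral)
  also have "\<dots> = (\<Sum>i\<in>UNIV. \<Sum>h\<in>hist N. q i h * (LINT s|timeM. indicator {t0..<T} s * H s (belief h s)))"
  proof (intro sum.cong refl arg_cong2[of _ _ _ _ "(*)"])
    fix i h assume h: "h \<in> hist N"
    then have x: "belief_path (i, h) \<in> paths t0 T" by (intro belief_path_paths) (simp add: hist_def)
    show "(LINT s|timeM. H s (belief_path (i, h) s)) = (LINT s|timeM. indicator {t0..<T} s * H s (belief h s))"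
    proof (rule integral_cong_AE)
      have "AE s in lebesgue. s \<noteq> T" by (rule AE_I[of _ _ "{T}"]) auto
      then have "AE s in lebesgue. s \<in> {t0..T} \<longrightarrow> H s (belief_path (i, h) s) = indicator {t0..<T} s * H s (belief h s)"
        by (elim eventually_mono) (auto simp: indicator_def belief_path_def)
      then show "AE s in timeM. H s (belief_path (i, h) s) = indicator {t0..<T} s * H s (belief h s)"
        by (subst AE_restrict_space_iff) auto
    qed (use borel_measurable_integrable[OF H_path_time_integrable[OF x, of UNIV]] in auto)
  qed
  also have "\<dots> = cost_upto N"
    unfolding cost_upto_def tt_N tot_def by (subst sum.swap) (simp add: sum_distrib_right)
  finally show ?thesis .
qed

definition energy :: "'i \<Rightarrow> nat \<Rightarrow> real" where
  "energy i n = (\<Sum>h\<in>hist n. tot h * (post h $ i)\<^sup>2)"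

lemma energy_bounds: "0 \<le> energy i n" "n \<le> N \<Longrightarrow> energy i n \<le> 1"
proof -
  show "0 \<le> energy i n" by (simp add: energy_def sum_nonneg tot_nonneg)
  have "energy i n \<le> (\<Sum>h\<in>hist n. tot h * 1)"
    unfolding energy_def
    using simplex_component[OF post_simplex] by (intro sum_mono mult_left_mono tot_nonneg power_le_one) auto
  then show "n \<le> N \<Longrightarrow> energy i n \<le> 1" by (simp add: mass_tot)
qed

text \<open>Orthogonality of martingale increments at each node: in the expanded square the cross
  term sums to twice \<open>tot h * (post h $ i)\<^sup>2\<close> by consistency. Since the energy
  stays in the unit interval, all squared increments together have expectation at most 1.\<close>

lemma energy_Suc:
  assumes "n < N"
  shows "(\<Sum>h\<in>hist n. \<Sum>y\<in>Y. tot (y # h) * (post (y # h) $ i - post h $ i)\<^sup>2) = energy i (Suc n) - energy i n"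
proof -
  have "(\<Sum>y\<in>Y. tot (y # h) * (post (y # h) $ i - post h $ i)\<^sup>2) = (\<Sum>y\<in>Y. tot (y # h) * (post (y # h) $ i)\<^sup>2) - tot h * (post h $ i)\<^sup>2"
    if h: "h \<in> hist n" for h
  proof -
    have "(\<Sum>y\<in>Y. tot (y # h) * (post (y # h) $ i - post h $ i)\<^sup>2)
      = (\<Sum>y\<in>Y. tot (y # h) * (post (y # h) $ i)\<^sup>2 - 2 * post h $ i * q i (y # h) + (post h $ i)\<^sup>2 * tot (y # h))"
      by (intro sum.cong refl) (simp add: tot_post[symmetric] power2_eq_square algebra_simps)
    also have "\<dots> = (\<Sum>y\<in>Y. tot (y # h) * (post (y # h) $ i)\<^sup>2) - 2 * post h $ i * q i h + (post h $ i)\<^sup>2 * tot h"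
      using h assms by (simp add: sum.distrib sum_subtractf sum_distrib_left[symmetric] q_sum tot_sum hist_def)
    also have "\<dots> = (\<Sum>y\<in>Y. tot (y # h) * (post (y # h) $ i)\<^sup>2) - tot h * (post h $ i)\<^sup>2"
      by (simp add: tot_post[symmetric] power2_eq_square algebra_simps)
    finally show ?thesis .
  qed
  then show ?thesis by (simp add: energy_def sum_hist_Suc sum_subtractf)
qed

end

section \<open>Replies on a time grid\<close>

locale grid = game l U V T t0
  for l :: "'i::finite \<Rightarrow> real \<Rightarrow> 'a::euclidean_space \<Rightarrow> 'b::euclidean_space \<Rightarrow> real"
    and U V T t0 +
  fixes N :: nat and tt :: "nat \<Rightarrow> real" and \<eta> :: real
  assumes part: "time_partition t0 T N tt" and \<eta>: "\<eta> > 0"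
begin

lemma tt_mono: "m \<le> n \<Longrightarrow> n \<le> N \<Longrightarrow> tt m \<le> tt n"
  using time_partition_mono[OF part] .

lemma tt_0: "tt 0 = t0" and tt_N: "tt N = T"
  using part by (auto simp: time_partition_def)

lemma tt_bounds: "n \<le> N \<Longrightarrow> t0 \<le> tt n \<and> tt n \<le> T"
  using tt_mono[of 0 n] tt_mono[of n N] tt_0 tt_N by simp

abbreviation const_ctl :: "'b \<Rightarrow> real \<Rightarrow> 'b" where "const_ctl w \<equiv> restrict (\<lambda>_. w) {t0..T}"

text \<open>The payoffs that all types would receive in period \<open>n\<close> from the same
  control \<open>u\<close> against the constant action \<open>w\<close>. They are rounded down, so
  \<open>\<eta>\<close> times an entry understates the payoff by at most
  \<open>\<eta>\<close>.\<close>

definition obs :: "nat \<Rightarrow> 'b \<Rightarrow> (real \<Rightarrow> 'a) \<Rightarrow> ('i \<Rightarrow> int)" where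
  "obs n w u = (\<lambda>i. \<lfloor>pay i {tt n..<tt (Suc n)} u (const_ctl w) / \<eta>\<rfloor>)"

definition w0 :: 'b where "w0 = (SOME w. w \<in> V)"

lemma w0: "w0 \<in> V" unfolding w0_def using V(2) by (simp add: some_in_eq)

text \<open>Histories of observations are lists whose head is the most recent observation;
  \<open>act h\<close> is the action chosen after the history \<open>h\<close>.\<close>

primrec plan :: "(('i \<Rightarrow> int) list \<Rightarrow> 'b) \<Rightarrow> ('i \<Rightarrow> int) list \<Rightarrow> real \<Rightarrow> 'b" where
  "plan act [] s = w0"
| "plan act (y # h) s = (if s < tt (length h) then plan act h s else act h)"

text \<open>Computed from Player 1's control alone, with the constant action of each period in place
  of the reply; the reply is thus an explicit function of \<open>u\<close>, not the solution of an
  equation.\<close>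

primrec run :: "(('i \<Rightarrow> int) list \<Rightarrow> 'b) \<Rightarrow> (real \<Rightarrow> 'a) \<Rightarrow> nat \<Rightarrow> ('i \<Rightarrow> int) list" where
  "run act u 0 = []"
| "run act u (Suc n) = obs n (act (run act u n)) u # run act u n"

lemma length_run [simp]: "length (run act u n) = n"
  by (induction n) auto

text \<open>The next action is to depend on the actions at shorter histories, through the plan and
  through the set of controls compatible with the history. Recursion on the history carries both
  along and so resolves the circularity.\<close>

lemma policy_exists:
  "\<exists>act. \<forall>h. act h = F h (plan act h) {u. run act u (length h) = h}"
proof -
  \<comment> \<open>The state at \<open>h\<close> is the pair of the plan followed so far and the
    set of controls that produce \<open>h\<close>.\<close>
  define st where "st = rec_list (\<lambda>_. w0, UNIV) (\<lambda>y h (c, C).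
     (\<lambda>s. if s < tt (length h) then c s else F h c C, {u \<in> C. obs (length h) (F h c C) u = y}))"
  have st: "st [] = (\<lambda>_. w0, UNIV)"
    "st (y # h) = (\<lambda>s. if s < tt (length h) then fst (st h) s else F h (fst (st h)) (snd (st h)),
        {u \<in> snd (st h). obs (length h) (F h (fst (st h)) (snd (st h))) u = y})" for y h
    unfolding st_def by (simp_all add: case_prod_beta)
  define act where "act h = F h (fst (st h)) (snd (st h))" for h
  have "plan act h = fst (st h) \<and> {u. run act u (length h) = h} = snd (st h)" for h
  proof (induction h)
    case Nil
    have "plan act [] = (\<lambda>_. w0)" by (rule ext) simp
    then show ?case by (simp add: st)
  next
    case (Cons y h)
    have 1: "plan act (y # h) = (\<lambda>s. if s < tt (length h) then plan act h s else act h)" by (rule ext) simp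
    have 2: "{u. run act u (length (y # h)) = y # h} = {u \<in> {u. run act u (length h) = h}. obs (length h) (act h) u = y}"
      by auto
    show ?case unfolding 1 2 st act_def[of h, symmetric] fst_conv snd_conv
      using Cons by (metis (no_types))
  qed
  then show ?thesis by (intro exI[of _ act] allI) (simp add: act_def)
qed

section \<open>The reply strategy generated by a policy\<close>

context
  fixes act :: "('i \<Rightarrow> int) list \<Rightarrow> 'b"
  assumes act: "\<And>h. act h \<in> V"
begin

definition plan_ctl :: "('i \<Rightarrow> int) list \<Rightarrow> real \<Rightarrow> 'b" where
  "plan_ctl h = restrict (plan act h) {t0..T}"

lemma plan_ctl_control: "plan_ctl h \<in> ctlV"
proof (rule control_setI)
  have "plan act h s \<in> V" for s by (induction h) (auto simp: w0 act)
  then show "s \<in> {t0..T} \<Longrightarrow> plan_ctl h s \<in> V" for s by (simp add: plan_ctl_def)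
  have "plan act h \<in> borel_measurable timeM"
  proof (induction h)
    case Nil
    have "plan act [] = (\<lambda>_. w0)" by (rule ext) simp
    then show ?case by simp
  next
    case (Cons y h)
    note [measurable] = Cons
    have "plan act (y # h) = (\<lambda>s. if s < tt (length h) then plan act h s else act h)" by (rule ext) simp
    then show ?case by simp
  qed
  then show "plan_ctl h \<in> borel_measurable timeM"
    by (rule measurable_cong[THEN iffD1, rotated]) (auto simp: plan_ctl_def)
qed (auto simp: plan_ctl_def)

lemma plan_append:
  assumes "length (pre @ g) \<le> N" "s < tt (length g)"
  shows "plan act (pre @ g) s = plan act g s"
  using assms
proof (induction pre)
  case (Cons y pre)
  have "tt (length g) \<le> tt (length (pre @ g))" using Cons.prems by (intro tt_mono) auto
  then show ?case using Cons by simp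
qed simp

lemma run_suffix: "m \<le> n \<Longrightarrow> \<exists>pre. run act u n = pre @ run act u m"
proof (induction n rule: dec_induct)
  case (step n)
  then obtain pre where "run act u n = pre @ run act u m" by auto
  then show ?case by (intro exI[of _ "obs n (act (run act u n)) u # pre"]) simp
qed simp

lemma plan_run:
  assumes "n < N" "s < tt (Suc n)"
  shows "plan act (run act u N) s = (if s < tt n then plan act (run act u n) s else act (run act u n))"
proof -
  obtain pre where pre: "run act u N = pre @ run act u (Suc n)" using run_suffix[of "Suc n" N u] assms by auto
  have "length (pre @ run act u (Suc n)) \<le> N" unfolding pre[symmetric] by simp
  from plan_append[OF this] assms show ?thesis unfolding pre by simp
qed

lemma obs_cong:
  assumes "n < N" "u \<in> ctlU" "u' \<in> ctlU" "ae_eq_upto t0 (tt (Suc n)) u u'" "w \<in> V"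
  shows "obs n w u = obs n w u'"
proof -
  have "pay i {tt n..<tt (Suc n)} u (const_ctl w) = pay i {tt n..<tt (Suc n)} u' (const_ctl w)" for i
    using assms tt_bounds[of "Suc n"] const_control[OF assms(5), of t0 T]
    by (intro pay_cong[of "tt (Suc n)"]) auto
  then show ?thesis by (simp add: obs_def)
qed

lemma run_cong:
  assumes "n \<le> N" "u \<in> ctlU" "u' \<in> ctlU" "ae_eq_upto t0 (tt n) u u'"
  shows "run act u n = run act u' n"
  using assms
proof (induction n)
  case (Suc n)
  have "ae_eq_upto t0 (tt n) u u'" using ae_eq_upto_mono[OF Suc.prems(4)] tt_mono[of n "Suc n"] Suc.prems by simp
  then have "run act u n = run act u' n" using Suc by simp
  then show ?case using obs_cong[of n u u'] Suc.prems act by simp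
qed simp

definition reply :: "(real \<Rightarrow> 'a) \<Rightarrow> real \<Rightarrow> 'b" where
  "reply u = plan_ctl (run act u N)"

lemma reply_control: "reply u \<in> ctlV"
  by (simp add: reply_def plan_ctl_control)

text \<open>The action of period \<open>j\<close> depends on observations of earlier periods only,
  and these are determined by the control up to \<open>tt j\<close>.\<close>

lemma reply_delayed: "delayed_map t0 tt N ctlU ctlV reply"
  unfolding delayed_map_def
proof (intro conjI ballI allI impI)
  fix u u' j assume u: "u \<in> ctlU" "u' \<in> ctlU" and j: "j < N" "ae_eq_upto t0 (tt j) u u'"
  have "run act u j = run act u' j" using run_cong[of j u u'] u j by simp
  then have "reply u s = reply u' s" if "s < tt (Suc j)" for s
    using plan_run[OF j(1) that] by (simp add: reply_def plan_ctl_def restrict_def)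
  then show "ae_eq_upto t0 (tt (Suc j)) (reply u) (reply u')" by (intro ae_eq_uptoI)
qed (simp add: reply_control)

lemma reply_piece:
  assumes "n < N" "s \<in> {tt n..<tt (Suc n)}" "s \<in> {t0..T}"
  shows "reply u s = act (run act u n)"
  using plan_run[OF assms(1), of s u] assms by (simp add: reply_def plan_ctl_def)

lemma pay_reply_piece:
  assumes "n < N"
  shows "pay i {tt n..<tt (Suc n)} u (reply u) = pay i {tt n..<tt (Suc n)} u (const_ctl (act (run act u n)))"
  unfolding pay_def
  by (rule Bochner_Integration.integral_cong) (auto simp: indicator_def reply_piece[OF assms])

lemma obs_measurable:
  assumes "w \<in> V" "n < N"
  shows "obs n w \<in> spU \<rightarrow>\<^sub>M count_space UNIV"
proof -
  have [measurable]: "(\<lambda>u. pay i {tt n..<tt (Suc n)} u (const_ctl w)) \<in> borel_measurable spU" for i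
    by (rule pay_measurable_left) (auto intro: const_control assms)
  have "{u \<in> space spU. obs n w u = y} \<in> sets spU" for y
  proof -
    have "{u \<in> space spU. \<forall>i. \<lfloor>pay i {tt n..<tt (Suc n)} u (const_ctl w) / \<eta>\<rfloor> = y i} \<in> sets spU" by measurable
    then show ?thesis by (simp add: obs_def fun_eq_iff)
  qed
  then have "obs n w -` {y} \<inter> space spU \<in> sets spU" for y
    by (simp add: vimage_def Int_def conj_commute)
  then show ?thesis by (subst measurable_count_space_eq2_countable) auto
qed

lemma run_measurable: "n \<le> N \<Longrightarrow> (\<lambda>u. run act u n) \<in> spU \<rightarrow>\<^sub>M count_space UNIV"
proof (induction n)
  case (Suc n)
  then have IH: "(\<lambda>u. run act u n) \<in> spU \<rightarrow>\<^sub>M count_space UNIV" by simp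
  have "(\<lambda>u. (\<lambda>h u. obs n (act h) u # h) (run act u n) u) \<in> spU \<rightarrow>\<^sub>M count_space UNIV"
  proof (rule measurable_compose_countable[OF _ IH])
    fix h
    show "(\<lambda>u. obs n (act h) u # h) \<in> spU \<rightarrow>\<^sub>M count_space UNIV"
      by (rule measurable_compose[OF obs_measurable[OF act]]) (use Suc in auto)
  qed
  then show ?case by simp
qed simp

lemma reply_measurable: "reply \<in> spU \<rightarrow>\<^sub>M spV"
  unfolding reply_def
  by (rule measurable_compose[OF run_measurable]) (auto simp: plan_ctl_control)

lemma reply_strategy:
  assumes "M \<in> E"
  shows "(M, \<lambda>\<omega>. reply) \<in> rand_strategies E t0 T U V"
proof -
  have "(\<lambda>p. reply (snd p)) \<in> M \<Otimes>\<^sub>M spU \<rightarrow>\<^sub>M spV"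
    by (rule measurable_compose[OF measurable_snd reply_measurable])
  moreover have "nonanticipative_with_delay t0 T U (space M) (\<lambda>\<omega>. reply)"
    unfolding nonanticipative_with_delay_def
    by (rule exI[of _ N], rule exI[of _ tt])
       (use part reply_delayed in \<open>simp add: time_partition_def delayed_map_def\<close>)
  ultimately show ?thesis using assms by (simp add: rand_strategies_def case_prod_beta)
qed

text \<open>\<open>outcome\<close> need not depend measurably on the random parameter; \<open>played\<close> is an a.e. equal version of
  Player 1's control that does, because only finitely many replies occur.\<close>

context
  fixes a :: "(real \<Rightarrow> 'b) \<Rightarrow> (real \<Rightarrow> 'a)" and k :: nat and \<tau> :: "nat \<Rightarrow> real"
  assumes \<tau>: "time_partition t0 T k \<tau>" and a: "delayed_map t0 \<tau> k ctlV ctlU a"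
begin

definition final_hist :: "('i \<Rightarrow> int) list" where
  "final_hist = run act (fst (outcome t0 T U V a reply)) N"

definition played :: "real \<Rightarrow> 'a" where "played = a (plan_ctl final_hist)"

lemma outcome_played:
  obtains u v where "outcome t0 T U V a reply = (u, v)" "u \<in> ctlU" "v \<in> ctlV"
    "ae_eq_upto t0 T u played" "ae_eq_upto t0 T v (plan_ctl final_hist)"
    "\<And>u'. u' \<in> ctlU \<Longrightarrow> ae_eq_upto t0 T (a (reply u')) u' \<Longrightarrow> ae_eq_upto t0 T u u'"
proof -
  obtain u v where o: "outcome t0 T U V a reply = (u, v)" "u \<in> ctlU" "v \<in> ctlV"
    "ae_eq_upto t0 T (a v) u" "ae_eq_upto t0 T (reply u) v"
    "\<And>u' v'. u' \<in> ctlU \<Longrightarrow> v' \<in> ctlV \<Longrightarrow>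
       ae_eq_upto t0 T (a v') u' \<Longrightarrow> ae_eq_upto t0 T (reply u') v' \<Longrightarrow>
       ae_eq_upto t0 T u u' \<and> ae_eq_upto t0 T v v'"
    by (rule outcome_spec[OF \<tau> a part reply_delayed ctlV_nonempty]) blast
  have h: "final_hist = run act u N" by (simp add: final_hist_def o(1))
  have v: "ae_eq_upto t0 T v (plan_ctl final_hist)"
    using ae_eq_upto_sym[OF o(5)] by (simp add: reply_def h)
  have "ae_eq_upto t0 T (a v) played"
    unfolding played_def by (rule delayed_map_causal[OF \<tau> a o(3) plan_ctl_control order_refl v])
  then have u: "ae_eq_upto t0 T u played" using ae_eq_upto_trans[OF ae_eq_upto_sym[OF o(4)]] by blast
  have "ae_eq_upto t0 T u u'" if "u' \<in> ctlU" "ae_eq_upto t0 T (a (reply u')) u'" for u'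
    using o(6)[OF that(1) reply_control that(2) ae_eq_upto_refl] by simp
  then show ?thesis using that[OF o(1-3) u v] by blast
qed

lemma length_final_hist: "length final_hist = N"
  by (simp add: final_hist_def)

lemma played_control: "played \<in> ctlU"
  unfolding played_def by (rule delayed_map_in[OF a plan_ctl_control])

lemma run_played: "run act played N = final_hist"
proof -
  obtain u v where o: "outcome t0 T U V a reply = (u, v)" "u \<in> ctlU" "ae_eq_upto t0 T u played"
    by (rule outcome_played) blast
  show ?thesis unfolding final_hist_def o(1) fst_conv
    using run_cong[of N u played] o played_control tt_N by simp
qed

lemma reply_played: "reply played = plan_ctl final_hist"
  by (simp add: reply_def run_played)

text \<open>If the answer to the plan of \<open>h\<close> reproduces \<open>h\<close>, this answer
  together with the plan solves the fixed-point equations, and uniqueness identifies it with the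
  outcome. The right-hand side lets \<open>a\<close> answer a fixed control and is therefore
  measurable in the random parameter.\<close>

lemma final_hist_iff:
  assumes "length h = N"
  shows "final_hist = h \<longleftrightarrow> run act (a (plan_ctl h)) N = h"
proof
  assume "final_hist = h"
  then show "run act (a (plan_ctl h)) N = h" using run_played by (simp add: played_def)
next
  assume h: "run act (a (plan_ctl h)) N = h"
  let ?u = "a (plan_ctl h)"
  have uc: "?u \<in> ctlU" by (rule delayed_map_in[OF a plan_ctl_control])
  obtain u v where o: "outcome t0 T U V a reply = (u, v)" "u \<in> ctlU"
    "\<And>u'. u' \<in> ctlU \<Longrightarrow> ae_eq_upto t0 T (a (reply u')) u' \<Longrightarrow> ae_eq_upto t0 T u u'"
    by (rule outcome_played) blast
  have "ae_eq_upto t0 T (a (reply ?u)) ?u" by (simp add: reply_def h)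
  from o(3)[OF uc this] have "run act u N = run act ?u N"
    using run_cong[of N u ?u] o(2) uc tt_N by simp
  then show "final_hist = h" by (simp add: final_hist_def o(1) h)
qed

text \<open>The analogue for partial histories. It identifies the masses from which a policy
  computes its beliefs, defined by letting the strategy answer the plan of \<open>h\<close>, with
  the probabilities of histories in actual play.\<close>

lemma run_played_iff:
  assumes "length h \<le> N"
  shows "run act played (length h) = h \<longleftrightarrow> run act (a (plan_ctl h)) (length h) = h"
  using assms
proof (induction h)
  case (Cons y g)
  let ?n = "length g"
  have n: "?n < N" using Cons.prems by simp
  have c: "a (plan_ctl h) \<in> ctlU" for h by (rule delayed_map_in[OF a plan_ctl_control])
  \<comment> \<open>Once the history is \<open>g\<close>, actual play follows the plan of
    \<open>y # g\<close> before \<open>tt (Suc ?n)\<close>: the observation \<open>y\<close> is not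
    acted upon in the period in which it is made.\<close>
  have F: "run act played (Suc ?n) = run act (a (plan_ctl (y # g))) (Suc ?n)" if "run act played ?n = g"
  proof -
    have "plan_ctl final_hist s = plan_ctl (y # g) s" if "s < tt (Suc ?n)" for s
      using plan_run[OF n that, of played] \<open>run act played ?n = g\<close> by (simp add: plan_ctl_def run_played)
    then have "ae_eq_upto t0 (tt (Suc ?n)) (plan_ctl final_hist) (plan_ctl (y # g))" by (intro ae_eq_uptoI)
    then have "ae_eq_upto t0 (tt (Suc ?n)) played (a (plan_ctl (y # g)))"
      unfolding played_def using tt_bounds[of "Suc ?n"] n
      by (intro delayed_map_causal[OF \<tau> a plan_ctl_control plan_ctl_control]) auto
    then show ?thesis using n by (intro run_cong played_control c) auto
  qed
  have F': "run act (a (plan_ctl (y # g))) ?n = run act (a (plan_ctl g)) ?n"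
  proof -
    have "ae_eq_upto t0 (tt ?n) (plan_ctl (y # g)) (plan_ctl g)"
      by (rule ae_eq_uptoI) (simp add: plan_ctl_def)
    then have "ae_eq_upto t0 (tt ?n) (a (plan_ctl (y # g))) (a (plan_ctl g))"
      using tt_bounds[of ?n] n by (intro delayed_map_causal[OF \<tau> a plan_ctl_control plan_ctl_control]) auto
    then show ?thesis using n by (intro run_cong c) auto
  qed
  have l: "length (y # g) = Suc ?n" by simp
  show ?case
  proof
    assume *: "run act played (length (y # g)) = y # g"
    then have "run act played ?n = g" by simp
    from F[OF this] * show "run act (a (plan_ctl (y # g))) (length (y # g)) = y # g" unfolding l by metis
  next
    assume *: "run act (a (plan_ctl (y # g))) (length (y # g)) = y # g"
    then have "run act (a (plan_ctl g)) ?n = g" using F' by simp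
    then have "run act played ?n = g" using Cons by simp
    from F[OF this] * show "run act played (length (y # g)) = y # g" unfolding l by metis
  qed
qed simp

lemma outcome_pay:
  "(case outcome t0 T U V a reply of (u, v) \<Rightarrow> LINT s|timeM. l i s (u s) (v s)) = pay i UNIV played (reply played)"
proof -
  obtain u v where o: "outcome t0 T U V a reply = (u, v)" "u \<in> ctlU" "v \<in> ctlV"
    "ae_eq_upto t0 T u played" "ae_eq_upto t0 T v (plan_ctl final_hist)"
    by (rule outcome_played) blast
  have "pay i {..T} u v = pay i {..T} played (plan_ctl final_hist)"
    using o plan_ctl_control played_control by (intro pay_cong[of T]) auto
  moreover have "pay i {..T} u v = pay i UNIV u v" for u v
    unfolding pay_def by (rule Bochner_Integration.integral_cong) auto
  ultimately have "pay i UNIV played (reply played) = pay i UNIV u v" by (simp add: reply_played)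
  then show ?thesis by (simp add: o(1) pay_def)
qed

end

end

end

section \<open>Playing on the posterior beliefs\<close>

text \<open>The formula of \<open>post\<close>, stated for arbitrary masses: the policy must be
  constructed before the tree that it generates.\<close>

definition belief_of :: "real ^ 'i::finite \<Rightarrow> ('i \<Rightarrow> real) \<Rightarrow> real ^ 'i" where
  "belief_of p0 m = (if (\<Sum>i\<in>UNIV. m i) = 0 then p0 else (\<chi> i. m i / (\<Sum>i\<in>UNIV. m i)))"

lemma belief_of_simplex:
  assumes "p0 \<in> prob_simplex" "\<And>i. 0 \<le> m i"
  shows "belief_of p0 m \<in> prob_simplex"
proof (cases "(\<Sum>i\<in>UNIV. m i) = 0")
  case False
  have "(\<Sum>i\<in>UNIV. m i / (\<Sum>i\<in>UNIV. m i)) = 1"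
    unfolding sum_divide_distrib[symmetric] using False by simp
  then show ?thesis using False assms by (simp add: belief_of_def prob_simplex_def sum_nonneg)
qed (simp add: belief_of_def assms)

definition type_mass :: "real ^ 'i::finite \<Rightarrow> ('i \<Rightarrow> ('w, 'b, 'a) rand_strategy) \<Rightarrow> (real \<Rightarrow> 'b) \<Rightarrow> (real \<Rightarrow> 'a) set \<Rightarrow> 'i \<Rightarrow> real" where
  "type_mass p0 \<alpha> c C i = p0 $ i * measure (fst (\<alpha> i)) {\<omega> \<in> space (fst (\<alpha> i)). snd (\<alpha> i) \<omega> c \<in> C}"

text \<open>Assumption \<open>best\<close> says that the policy is \<epsilon>-optimal during the
  whole next period at the belief which it itself has generated so far.\<close>

locale response = grid l U V T t0 N tt \<eta>
  for l :: "'i::finite \<Rightarrow> real \<Rightarrow> 'a::euclidean_space \<Rightarrow> 'b::euclidean_space \<Rightarrow> real"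
    and U V T t0 N tt \<eta> +
  fixes E :: "'w measure set" and \<alpha> :: "'i \<Rightarrow> ('w, 'b, 'a) rand_strategy" and p0 :: "real ^ 'i"
    and act :: "('i \<Rightarrow> int) list \<Rightarrow> 'b" and \<epsilon> \<Delta> \<mu> :: real
  assumes E: "prob_space_family E" and p0: "p0 \<in> prob_simplex"
    and \<alpha>: "\<And>i. \<alpha> i \<in> rand_strategies E t0 T V U"
    and act: "\<And>h. act h \<in> V"
    and best: "\<And>h s u. length h < N \<Longrightarrow> s \<in> {tt (length h)..<tt (Suc (length h))} \<Longrightarrow> u \<in> U \<Longrightarrow>
      mixed s (belief_of p0 (type_mass p0 \<alpha> (plan_ctl act h) {u. run act u (length h) = h})) u (act h)
      \<ge> H s (belief_of p0 (type_mass p0 \<alpha> (plan_ctl act h) {u. run act u (length h) = h})) - \<epsilon>"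
    and step: "\<And>n. n < N \<Longrightarrow> tt (Suc n) - tt n = \<Delta>"
    and pos: "\<epsilon> > 0" "\<Delta> > 0" "\<mu> > 0"
begin

section \<open>Actual play and its posteriors\<close>

abbreviation M :: "'i \<Rightarrow> 'w measure" where "M i \<equiv> fst (\<alpha> i)"
abbreviation pl :: "'i \<Rightarrow> 'w \<Rightarrow> real \<Rightarrow> 'a" where "pl i \<omega> \<equiv> played act (snd (\<alpha> i) \<omega>)"

lemma M_prob: "prob_space (M i)"
  using E \<alpha>[of i] by (auto simp: prob_space_family_def rand_strategies_def)

lemma \<alpha>_delayed:
  obtains k \<tau> where "time_partition t0 T k \<tau>" "\<And>\<omega>. \<omega> \<in> space (M i) \<Longrightarrow> delayed_map t0 \<tau> k ctlV ctlU (snd (\<alpha> i) \<omega>)"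
  by (rule rand_strategies_delayed[OF \<alpha>[of i]]) blast

lemma \<alpha>_measurable: "v \<in> ctlV \<Longrightarrow> (\<lambda>\<omega>. snd (\<alpha> i) \<omega> v) \<in> M i \<rightarrow>\<^sub>M spU"
proof -
  assume v: "v \<in> ctlV"
  have "(\<lambda>(\<omega>, v). snd (\<alpha> i) \<omega> v) \<in> M i \<Otimes>\<^sub>M spV \<rightarrow>\<^sub>M spU"
    using \<alpha>[of i] by (auto simp: rand_strategies_def)
  from measurable_compose[OF measurable_Pair2'[of v spV] this] show ?thesis using v by simp
qed

lemma pl_control: "\<omega> \<in> space (M i) \<Longrightarrow> pl i \<omega> \<in> ctlU"
proof -
  assume \<omega>: "\<omega> \<in> space (M i)"
  obtain k \<tau> where p: "time_partition t0 T k \<tau>" and a: "\<And>\<omega>. \<omega> \<in> space (M i) \<Longrightarrow> delayed_map t0 \<tau> k ctlV ctlU (snd (\<alpha> i) \<omega>)"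
    by (rule \<alpha>_delayed) blast
  show ?thesis by (rule played_control[OF act p a[OF \<omega>]])
qed

lemma run_pl_iff:
  "\<omega> \<in> space (M i) \<Longrightarrow> length h \<le> N \<Longrightarrow>
    run act (pl i \<omega>) (length h) = h \<longleftrightarrow> run act (snd (\<alpha> i) \<omega> (plan_ctl act h)) (length h) = h"
proof -
  assume \<omega>: "\<omega> \<in> space (M i)" and h: "length h \<le> N"
  obtain k \<tau> where p: "time_partition t0 T k \<tau>" and a: "\<And>\<omega>. \<omega> \<in> space (M i) \<Longrightarrow> delayed_map t0 \<tau> k ctlV ctlU (snd (\<alpha> i) \<omega>)"
    by (rule \<alpha>_delayed) blast
  show ?thesis by (rule run_played_iff[OF act p a[OF \<omega>] h])
qed

text \<open>The parameter space splits into countably many events according to the final history,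
  measurable by \<open>final_hist_iff\<close>; on each of them the control played is the answer to
  one fixed plan.\<close>

lemma pl_measurable: "pl i \<in> M i \<rightarrow>\<^sub>M spU"
proof -
  obtain k \<tau> where p: "time_partition t0 T k \<tau>" and a: "\<And>\<omega>. \<omega> \<in> space (M i) \<Longrightarrow> delayed_map t0 \<tau> k ctlV ctlU (snd (\<alpha> i) \<omega>)"
    by (rule \<alpha>_delayed) blast
  have "(\<lambda>\<omega>. final_hist act (snd (\<alpha> i) \<omega>)) -` {h} \<inter> space (M i) \<in> sets (M i)" for h
  proof (cases "length h = N")
    case True
    have "(\<lambda>\<omega>. run act (snd (\<alpha> i) \<omega> (plan_ctl act h)) N) \<in> M i \<rightarrow>\<^sub>M count_space UNIV"
      by (rule measurable_compose[OF \<alpha>_measurable[OF plan_ctl_control[of act, OF act]] run_measurable[of act, OF act order_refl]])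
    from measurable_sets[OF this, of "{h}"] 
    have "{\<omega> \<in> space (M i). run act (snd (\<alpha> i) \<omega> (plan_ctl act h)) N = h} \<in> sets (M i)"
      by (simp add: vimage_def Int_def conj_commute)
    also have "{\<omega> \<in> space (M i). run act (snd (\<alpha> i) \<omega> (plan_ctl act h)) N = h} = (\<lambda>\<omega>. final_hist act (snd (\<alpha> i) \<omega>)) -` {h} \<inter> space (M i)"
      using final_hist_iff[of act, OF act p a True] by auto
    finally show ?thesis .
  next
    case False
    then have "(\<lambda>\<omega>. final_hist act (snd (\<alpha> i) \<omega>)) -` {h} \<inter> space (M i) = {}"
      using length_final_hist[of act, OF act p a] by auto
    then show ?thesis by simp
  qed
  then have "(\<lambda>\<omega>. final_hist act (snd (\<alpha> i) \<omega>)) \<in> M i \<rightarrow>\<^sub>M count_space UNIV"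
    by (subst measurable_count_space_eq2_countable) auto
  then have "(\<lambda>\<omega>. (\<lambda>h \<omega>. snd (\<alpha> i) \<omega> (plan_ctl act h)) (final_hist act (snd (\<alpha> i) \<omega>)) \<omega>) \<in> M i \<rightarrow>\<^sub>M spU"
    by (rule measurable_compose_countable[rotated]) (rule \<alpha>_measurable[OF plan_ctl_control[of act, OF act]])
  then show ?thesis
    using played_def[of act, OF act p a] by (simp cong: measurable_cong)
qed

lemma run_pl_measurable: "n \<le> N \<Longrightarrow> (\<lambda>\<omega>. run act (pl i \<omega>) n) \<in> M i \<rightarrow>\<^sub>M count_space UNIV"
  by (rule measurable_compose[OF pl_measurable run_measurable[of act, OF act]])

definition q :: "'i \<Rightarrow> ('i \<Rightarrow> int) list \<Rightarrow> real" where
  "q i h = p0 $ i * measure (M i) {\<omega> \<in> space (M i). run act (pl i \<omega>) (length h) = h}"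

lemma q_type_mass: "length h \<le> N \<Longrightarrow> q i h = type_mass p0 \<alpha> (plan_ctl act h) {u. run act u (length h) = h} i"
  unfolding q_def type_mass_def using run_pl_iff[of _ i h] by (auto intro!: arg_cong[of _ _ "measure (M i)"])

text \<open>The payoff of a period is bounded crudely by that of the whole time interval; what
  counts is that the range is finite.\<close>

definition obs_range :: "('i \<Rightarrow> int) set" where
  "obs_range = PiE UNIV (\<lambda>_. {- \<lceil>lbound * (T - t0) / \<eta>\<rceil> - 1..\<lceil>lbound * (T - t0) / \<eta>\<rceil>})"

lemma run_obs_range: "u \<in> ctlU \<Longrightarrow> set (run act u n) \<subseteq> obs_range"
proof (induction n)
  case (Suc n)
  have "obs n w u \<in> obs_range" if w: "w \<in> V" for w
  proof -
    have "\<lfloor>pay i {tt n..<tt (Suc n)} u (const_ctl w) / \<eta>\<rfloor> \<in> {- \<lceil>lbound * (T - t0) / \<eta>\<rceil> - 1..\<lceil>lbound * (T - t0) / \<eta>\<rceil>}" for i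
    proof -
      have "\<bar>pay i {tt n..<tt (Suc n)} u (const_ctl w)\<bar> \<le> lbound * (T - t0)"
        by (intro pay_bound Suc.prems const_control w) auto
      then have "\<bar>pay i {tt n..<tt (Suc n)} u (const_ctl w) / \<eta>\<bar> \<le> lbound * (T - t0) / \<eta>"
        using \<eta> by (simp add: divide_right_mono)
      then show ?thesis unfolding atLeastAtMost_iff by linarith
    qed
    then show ?thesis by (simp add: obs_range_def obs_def PiE_iff extensional_def)
  qed
  then show ?case using Suc act by simp
qed simp

text \<open>Consistency of the masses holds because the possible next observations split the event
  of a history into disjoint pieces, for each type separately.\<close>

lemma posterior_tree: "belief_tree l U V T t0 N tt obs_range q p0"
proof unfold_locales
  show "time_partition t0 T N tt" by (rule part)
  show "finite obs_range" unfolding obs_range_def by (intro finite_PiE) auto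
  show "p0 \<in> prob_simplex" by (rule p0)
  show "0 \<le> q i h" for i h using p0 by (simp add: q_def prob_simplex_def)
  show "q i [] = p0 $ i" for i
  proof -
    interpret prob_space "M i" by (rule M_prob)
    show ?thesis by (simp add: q_def prob_space)
  qed
  show "(\<Sum>y\<in>obs_range. q i (y # h)) = q i h" if h: "length h < N" "set h \<subseteq> obs_range" for i h
  proof -
    interpret prob_space "M i" by (rule M_prob)
    let ?n = "length h"
    define A where "A y = {\<omega> \<in> space (M i). run act (pl i \<omega>) (Suc ?n) = y # h}" for y
    have "measure (M i) (\<Union>y\<in>obs_range. A y) = (\<Sum>y\<in>obs_range. measure (M i) (A y))"
    proof (rule finite_measure_finite_Union)
      show "finite obs_range" unfolding obs_range_def by (intro finite_PiE) auto
      have "A y \<in> sets (M i)" for y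
        using measurable_sets[OF run_pl_measurable[of "Suc ?n" i], of "{y # h}"] h
        by (simp add: A_def vimage_def Int_def conj_commute del: run.simps)
      then show "A ` obs_range \<subseteq> sets (M i)" by auto
      show "disjoint_family_on A obs_range" by (auto simp: disjoint_family_on_def A_def)
    qed
    also have "(\<Union>y\<in>obs_range. A y) = {\<omega> \<in> space (M i). run act (pl i \<omega>) ?n = h}"
      using run_obs_range[OF pl_control, of _ i "Suc ?n"] by (auto simp: A_def)
    finally show ?thesis by (simp add: q_def A_def sum_distrib_left[symmetric])
  qed
qed

sublocale tree: belief_tree l U V T t0 N tt obs_range q p0
  by (rule posterior_tree)

text \<open>A function of the history is a simple function, as only finitely many histories occur;
  the masses \<open>q\<close> already contain the prior weight of the type.\<close>

lemma expectation_run: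
  assumes n: "n \<le> N"
  shows "p0 $ i * (LINT \<omega>|M i. f (run act (pl i \<omega>) n)) = (\<Sum>h\<in>tree.hist n. q i h * f h)"
    and "integrable (M i) (\<lambda>\<omega>. f (run act (pl i \<omega>) n) :: real)"
proof -
  interpret prob_space "M i" by (rule M_prob)
  define A where "A h = {\<omega> \<in> space (M i). run act (pl i \<omega>) n = h}" for h
  have As [measurable]: "A h \<in> sets (M i)" for h
    using measurable_sets[OF run_pl_measurable[of n i], of "{h}"] n
    by (simp add: A_def vimage_def Int_def conj_commute)
  have in_hist: "run act (pl i \<omega>) n \<in> tree.hist n" if "\<omega> \<in> space (M i)" for \<omega>
    using run_obs_range[OF pl_control[OF that]] by (simp add: tree.hist_def)
  have eq: "f (run act (pl i \<omega>) n) = (\<Sum>h\<in>tree.hist n. f h * indicator (A h) \<omega>)" if \<omega>: "\<omega> \<in> space (M i)" for \<omega>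
  proof -
    have "(\<Sum>h\<in>tree.hist n. f h * indicator (A h) \<omega>) = (\<Sum>h\<in>tree.hist n. if h = run act (pl i \<omega>) n then f h else 0)"
      using \<omega> by (intro sum.cong) (auto simp: A_def indicator_def)
    then show ?thesis using in_hist[OF \<omega>] by simp
  qed
  have int: "integrable (M i) (\<lambda>\<omega>. \<Sum>h\<in>tree.hist n. f h * indicator (A h) \<omega>)"
    by (intro Bochner_Integration.integrable_sum integrable_mult_right integrable_real_indicator As) (simp add: less_top[symmetric])
  show "integrable (M i) (\<lambda>\<omega>. f (run act (pl i \<omega>) n) :: real)"
    using int by (rule Bochner_Integration.integrable_cong[THEN iffD1, rotated 2]) (simp_all add: eq)
  have "(LINT \<omega>|M i. f (run act (pl i \<omega>) n)) = (LINT \<omega>|M i. (\<Sum>h\<in>tree.hist n. f h * indicator (A h) \<omega>))"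
    by (rule Bochner_Integration.integral_cong) (simp_all add: eq)
  also have "\<dots> = (\<Sum>h\<in>tree.hist n. f h * measure (M i) (A h))"
    by (subst Bochner_Integration.integral_sum) (auto simp: less_top[symmetric] intro!: integrable_mult_right integrable_real_indicator sum.cong)
  finally show "p0 $ i * (LINT \<omega>|M i. f (run act (pl i \<omega>) n)) = (\<Sum>h\<in>tree.hist n. q i h * f h)"
    by (simp add: q_def A_def sum_distrib_left tree.hist_def ac_simps)
qed

section \<open>The estimate for one period\<close>

abbreviation S :: "nat \<Rightarrow> real set" where "S n \<equiv> {tt n..<tt (Suc n)}"
abbreviation Hcost :: "nat \<Rightarrow> ('i \<Rightarrow> int) list \<Rightarrow> real" where
  "Hcost n h \<equiv> (LINT s|timeM. indicator (S n) s * H s (tree.post h))"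

lemma post_belief_of: "length h \<le> N \<Longrightarrow> tree.post h = belief_of p0 (type_mass p0 \<alpha> (plan_ctl act h) {u. run act u (length h) = h})"
  by (simp add: tree.post_def tree.tot_def belief_of_def q_type_mass)

text \<open>Integration of \<open>best\<close> over the period. The control \<open>u\<close> is
  arbitrary, since the action was chosen on the sup-inf side.\<close>

lemma mixed_payoff_lower:
  assumes n: "length h < N" and u: "u \<in> ctlU"
  shows "(\<Sum>j\<in>UNIV. tree.post h $ j * pay j (S (length h)) u (const_ctl (act h))) \<ge> Hcost (length h) h - \<epsilon> * \<Delta>"
proof -
  interpret finite_measure timeM by simp
  let ?n = "length h"
  have c: "const_ctl (act h) \<in> ctlV" by (rule const_control[OF act])
  have tb: "t0 \<le> tt ?n" "tt (Suc ?n) \<le> T" using tt_bounds[of ?n] tt_bounds[of "Suc ?n"] n by auto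
  have SM: "S ?n \<in> sets timeM" by (subst sets_restrict_space_iff) (use tb in auto)
  have mS: "measure timeM (S ?n) = \<Delta>"
  proof -
    have "measure timeM (S ?n) = measure lebesgue (S ?n)" using tb by (intro measure_restrict_space) auto
    then show ?thesis using step[OF n] pos by simp
  qed
  have SI: "S ?n \<inter> {t0..T} = S ?n" using tb by auto
  have intg: "integrable timeM (\<lambda>s. tree.post h $ j * (indicator (S ?n) s * l j s (u s) (const_ctl (act h) s)))" for j
    by (intro integrable_mult_right pay_integrable u c) auto
  have "Hcost ?n h - \<epsilon> * \<Delta> = (LINT s|timeM. indicator (S ?n) s * H s (tree.post h) - \<epsilon> * indicator (S ?n) s)"
    using tree.H_const_integrable[of "S ?n" "tree.post h"] SM
    by (subst Bochner_Integration.integral_diff) (auto simp: tree.post_simplex less_top[symmetric] mS SI intro!: integrable_mult_right integrable_real_indicator)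
  also have "\<dots> \<le> (LINT s|timeM. (\<Sum>j\<in>UNIV. tree.post h $ j * (indicator (S ?n) s * l j s (u s) (const_ctl (act h) s))))"
  proof (rule integral_mono)
    show "integrable timeM (\<lambda>s. indicator (S ?n) s * H s (tree.post h) - \<epsilon> * indicator (S ?n) s)"
      using tree.H_const_integrable[of "S ?n" "tree.post h"] SM
      by (intro Bochner_Integration.integrable_diff integrable_mult_right integrable_real_indicator) (auto simp: tree.post_simplex less_top[symmetric])
    show "integrable timeM (\<lambda>s. \<Sum>j\<in>UNIV. tree.post h $ j * (indicator (S ?n) s * l j s (u s) (const_ctl (act h) s)))"
      by (intro Bochner_Integration.integrable_sum intg)
    fix s assume "s \<in> space timeM"
    then have s: "s \<in> {t0..T}" by simp
    have "(\<Sum>j\<in>UNIV. tree.post h $ j * (indicator (S ?n) s * l j s (u s) (const_ctl (act h) s))) = indicator (S ?n) s * mixed s (tree.post h) (u s) (act h)"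
      using s by (simp add: mixed_def sum_distrib_left ac_simps)
    moreover have "mixed s (tree.post h) (u s) (act h) \<ge> H s (tree.post h) - \<epsilon>" if "s \<in> S ?n"
      using best[OF n that control_set_mem[OF u s]] n by (simp add: post_belief_of)
    ultimately show "indicator (S ?n) s * H s (tree.post h) - \<epsilon> * indicator (S ?n) s
       \<le> (\<Sum>j\<in>UNIV. tree.post h $ j * (indicator (S ?n) s * l j s (u s) (const_ctl (act h) s)))"
      by (auto simp: indicator_def)
  qed
  also have "\<dots> = (\<Sum>j\<in>UNIV. tree.post h $ j * pay j (S ?n) u (const_ctl (act h)))"
    by (subst Bochner_Integration.integral_sum[OF intg]) (simp add: pay_def)
  finally show ?thesis .
qed

text \<open>Bounds a rounded payoff of one period: the payoff itself is at most
  \<open>lbound * \<Delta>\<close>, the rounding at most \<open>\<eta>\<close>.\<close>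

definition jump_bound :: real where "jump_bound = lbound * \<Delta> + \<eta>"

lemma jump_bound_nonneg: "jump_bound \<ge> 0"
  using lbound(1) pos \<eta> by (simp add: jump_bound_def)

text \<open>The left side weights the observed payoffs with the new posterior, whereas the policy is
  nearly optimal for the old one. Exchanging the two costs at most \<open>jump_bound\<close> times
  the change of belief, and this change is estimated by its square so that the energy can absorb
  it.\<close>

lemma node_lower:
  assumes n: "length h < N"
  shows "(\<Sum>i\<in>UNIV. q i (y # h) * (\<eta> * of_int (y i))) \<ge> tree.tot (y # h) *
    (Hcost (length h) h - \<epsilon> * \<Delta> - \<eta> - jump_bound * (\<Sum>j\<in>UNIV. \<mu> / 2 + (tree.post (y # h) $ j - tree.post h $ j)\<^sup>2 / (2 * \<mu>)))"
    (is "_ \<ge> tree.tot (y # h) * ?R")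
proof (cases "tree.tot (y # h) = 0")
  case True
  then have "\<forall>i. q i (y # h) = 0" by (simp add: tree.tot_def tree.q_nonneg sum_nonneg_eq_0_iff)
  then show ?thesis using True by simp
next
  case False
  let ?n = "length h"
  let ?d = "\<lambda>j. tree.post (y # h) $ j - tree.post h $ j"
  \<comment> \<open>Positive mass provides a control that really produces \<open>y\<close>. As
    \<open>y\<close> lists the payoffs of all types against one control, this control serves for
    every type, whichever type it comes from.\<close>
  have "\<exists>i. q i (y # h) \<noteq> 0" using False by (auto simp: tree.tot_def intro: ccontr)
  then obtain i0 where "q i0 (y # h) \<noteq> 0" by blast
  have "{\<omega> \<in> space (M i0). run act (pl i0 \<omega>) (length (y # h)) = y # h} \<noteq> {}"
  proof
    assume "{\<omega> \<in> space (M i0). run act (pl i0 \<omega>) (length (y # h)) = y # h} = {}"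
    then have "q i0 (y # h) = 0" unfolding q_def by (simp only: measure_empty mult_zero_right)
    then show False using \<open>q i0 (y # h) \<noteq> 0\<close> by contradiction
  qed
  then obtain \<omega> where \<omega>: "\<omega> \<in> space (M i0)" "run act (pl i0 \<omega>) (length (y # h)) = y # h" by blast
  define u where "u = pl i0 \<omega>"
  have u: "u \<in> ctlU" unfolding u_def by (rule pl_control[OF \<omega>(1)])
  have y: "y = obs ?n (act h) u" using \<omega>(2) by (auto simp: u_def)
  define x where "x j = pay j (S ?n) u (const_ctl (act h))" for j
  have yx: "\<eta> * of_int (y j) \<le> x j" "x j \<le> \<eta> * of_int (y j) + \<eta>" for j
  proof -
    have yj: "y j = \<lfloor>x j / \<eta>\<rfloor>" by (simp add: y obs_def x_def)
    have "of_int (y j) \<le> x j / \<eta>" "x j / \<eta> \<le> of_int (y j) + 1" unfolding yj by linarith+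
    then show "\<eta> * of_int (y j) \<le> x j" "x j \<le> \<eta> * of_int (y j) + \<eta>" using \<eta> by (simp_all add: field_simps)
  qed
  have xb: "\<bar>x j\<bar> \<le> lbound * \<Delta>" for j
    unfolding x_def step[OF n, symmetric]
    using tt_bounds[of ?n] tt_bounds[of "Suc ?n"] tt_mono[of ?n "Suc ?n"] n
    by (intro pay_interval_bound u const_control act) auto
  have yb: "\<bar>\<eta> * of_int (y j)\<bar> \<le> jump_bound" for j
    using yx[of j] xb[of j] \<eta> by (simp add: jump_bound_def abs_le_iff)
  \<comment> \<open>The arithmetic-geometric mean inequality with a free parameter
    \<open>\<mu>\<close>.\<close>
  have quad: "\<bar>?d j\<bar> \<le> \<mu> / 2 + (?d j)\<^sup>2 / (2 * \<mu>)" for j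
  proof -
    have "0 \<le> (\<mu> - \<bar>?d j\<bar>)\<^sup>2" by simp
    then have "2 * \<mu> * \<bar>?d j\<bar> \<le> \<mu> * \<mu> + (?d j)\<^sup>2" by (simp add: power2_eq_square algebra_simps)
    then have "\<bar>?d j\<bar> \<le> (\<mu> * \<mu> + (?d j)\<^sup>2) / (2 * \<mu>)" using pos by (simp add: field_simps)
    also have "\<dots> = \<mu> / 2 + (?d j)\<^sup>2 / (2 * \<mu>)" using pos by (simp add: add_divide_distrib)
    finally show ?thesis .
  qed
  have "(\<Sum>j\<in>UNIV. tree.post h $ j * x j) \<le> (\<Sum>j\<in>UNIV. tree.post h $ j * (\<eta> * of_int (y j))) + \<eta>"
  proof -
    have "(\<Sum>j\<in>UNIV. tree.post h $ j * (x j - \<eta> * of_int (y j))) \<le> \<eta>"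
      using yx(2) by (intro simplex_sum_le tree.post_simplex) (simp add: algebra_simps)
    then show ?thesis by (simp add: right_diff_distrib sum_subtractf)
  qed
  then have 1: "(\<Sum>j\<in>UNIV. tree.post h $ j * (\<eta> * of_int (y j))) \<ge> Hcost ?n h - \<epsilon> * \<Delta> - \<eta>"
    using mixed_payoff_lower[OF n u] by (simp add: x_def)
  have "(\<Sum>j\<in>UNIV. - (jump_bound * (\<mu> / 2 + (?d j)\<^sup>2 / (2 * \<mu>)))) \<le> (\<Sum>j\<in>UNIV. ?d j * (\<eta> * of_int (y j)))"
  proof (rule sum_mono)
    fix j
    have "\<bar>?d j * (\<eta> * of_int (y j))\<bar> \<le> (\<mu> / 2 + (?d j)\<^sup>2 / (2 * \<mu>)) * jump_bound"
      unfolding abs_mult[of "?d j"] using quad[of j] yb[of j] pos by (intro mult_mono) auto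
    then show "- (jump_bound * (\<mu> / 2 + (?d j)\<^sup>2 / (2 * \<mu>))) \<le> ?d j * (\<eta> * of_int (y j))"
      by (simp add: mult.commute abs_le_iff)
  qed
  then have 2: "(\<Sum>j\<in>UNIV. ?d j * (\<eta> * of_int (y j))) \<ge> - (jump_bound * (\<Sum>j\<in>UNIV. \<mu> / 2 + (?d j)\<^sup>2 / (2 * \<mu>)))"
    by (simp add: sum_negf sum_distrib_left)
  have "(\<Sum>i\<in>UNIV. q i (y # h) * (\<eta> * of_int (y i))) = tree.tot (y # h) * (\<Sum>j\<in>UNIV. tree.post (y # h) $ j * (\<eta> * of_int (y j)))"
    by (simp add: sum_distrib_left tree.tot_post[symmetric] mult.assoc)
  also have "(\<Sum>j\<in>UNIV. tree.post (y # h) $ j * (\<eta> * of_int (y j))) =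
      (\<Sum>j\<in>UNIV. tree.post h $ j * (\<eta> * of_int (y j))) + (\<Sum>j\<in>UNIV. ?d j * (\<eta> * of_int (y j)))"
    unfolding sum.distrib[symmetric] by (intro sum.cong refl) (simp add: algebra_simps)
  also have "tree.tot (y # h) * \<dots> \<ge> tree.tot (y # h) * ?R"
    using 1 2 by (intro mult_left_mono tree.tot_nonneg) linarith
  finally show ?thesis .
qed

section \<open>Summation over the periods\<close>

definition payoff_upto :: "nat \<Rightarrow> real" where
  "payoff_upto n = (\<Sum>i\<in>UNIV. p0 $ i * (LINT \<omega>|M i. pay i {t0..<tt n} (pl i \<omega>) (reply act (pl i \<omega>))))"

lemma pay_pl_measurable:
  assumes "A \<in> sets borel"
  shows "(\<lambda>\<omega>. pay i A (pl i \<omega>) (reply act (pl i \<omega>))) \<in> borel_measurable (M i)"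
proof -
  have "(\<lambda>\<omega>. (pl i \<omega>, reply act (pl i \<omega>))) \<in> M i \<rightarrow>\<^sub>M spU \<Otimes>\<^sub>M spV"
    using pl_measurable measurable_compose[OF pl_measurable reply_measurable[of act, OF act]] by measurable
  from measurable_compose[OF this pay_measurable[OF assms, of i]] show ?thesis by simp
qed

lemma pay_pl_integrable:
  assumes "A \<in> sets borel"
  shows "integrable (M i) (\<lambda>\<omega>. pay i A (pl i \<omega>) (reply act (pl i \<omega>)))"
proof -
  interpret prob_space "M i" by (rule M_prob)
  show ?thesis
    by (rule integrable_const_bound[where B="lbound * (T - t0)"])
       (use pay_pl_measurable[OF assms] pay_bound[OF pl_control reply_control[of act, OF act] assms] in \<open>auto intro!: AE_I2\<close>)
qed

definition loss :: "nat \<Rightarrow> real" where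
  "loss n = \<epsilon> * \<Delta> + \<eta> + jump_bound * (\<Sum>j\<in>UNIV. \<mu> / 2 + (tree.energy j (Suc n) - tree.energy j n) / (2 * \<mu>))"

text \<open>Sums the node estimates over all histories of length \<open>n\<close>. The constant
  terms carry total mass 1, and the quadratic terms become the increase of the energy.\<close>

lemma payoff_step:
  assumes n: "n < N"
  shows "payoff_upto (Suc n) - payoff_upto n \<ge> tree.cost_upto (Suc n) - tree.cost_upto n - loss n"
proof -
  have tb: "t0 \<le> tt n" "tt n \<le> tt (Suc n)" using tt_bounds[of n] tt_mono[of n "Suc n"] n by auto
  have "payoff_upto (Suc n) - payoff_upto n = (\<Sum>i\<in>UNIV. p0 $ i * (LINT \<omega>|M i. pay i (S n) (pl i \<omega>) (reply act (pl i \<omega>))))"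
  proof -
    have "(LINT \<omega>|M i. pay i {t0..<tt (Suc n)} (pl i \<omega>) (reply act (pl i \<omega>))) =
      (LINT \<omega>|M i. pay i {t0..<tt n} (pl i \<omega>) (reply act (pl i \<omega>)) + pay i (S n) (pl i \<omega>) (reply act (pl i \<omega>)))" for i
      by (rule Bochner_Integration.integral_cong[OF refl]) (rule pay_split[OF pl_control reply_control[of act, OF act] tb])
    then have "(LINT \<omega>|M i. pay i {t0..<tt (Suc n)} (pl i \<omega>) (reply act (pl i \<omega>))) =
      (LINT \<omega>|M i. pay i {t0..<tt n} (pl i \<omega>) (reply act (pl i \<omega>))) + (LINT \<omega>|M i. pay i (S n) (pl i \<omega>) (reply act (pl i \<omega>)))" for i
      using pay_pl_integrable by simp
    then show ?thesis by (simp add: payoff_upto_def distrib_left sum.distrib)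
  qed
  \<comment> \<open>Rounding is downwards, so this replacement loses nothing that has to be
    estimated; the rounding error is paid at the nodes. Each type uses its own coordinate of the
    observation.\<close>
  also have "\<dots> \<ge> (\<Sum>i\<in>UNIV. p0 $ i * (LINT \<omega>|M i. \<eta> * of_int (hd (run act (pl i \<omega>) (Suc n)) i)))"
  proof (intro sum_mono mult_left_mono integral_mono)
    fix i \<omega> assume "\<omega> \<in> space (M i)"
    let ?x = "pay i (S n) (pl i \<omega>) (const_ctl (act (run act (pl i \<omega>) n)))"
    have "of_int \<lfloor>?x / \<eta>\<rfloor> * \<eta> \<le> ?x"
      by (rule pos_le_divide_eq[OF \<eta>, THEN iffD1]) (rule of_int_floor_le)
    then have "\<eta> * of_int \<lfloor>?x / \<eta>\<rfloor> \<le> ?x" by (simp only: mult.commute)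
    then show "\<eta> * of_int (hd (run act (pl i \<omega>) (Suc n)) i) \<le> pay i (S n) (pl i \<omega>) (reply act (pl i \<omega>))"
      by (simp add: obs_def pay_reply_piece[of act, OF act n])
  next
    fix i show "integrable (M i) (\<lambda>\<omega>. \<eta> * of_int (hd (run act (pl i \<omega>) (Suc n)) i))"
      by (rule expectation_run(2)) (use n in simp)
    show "integrable (M i) (\<lambda>\<omega>. pay i (S n) (pl i \<omega>) (reply act (pl i \<omega>)))" by (rule pay_pl_integrable) simp
    show "0 \<le> p0 $ i" using p0 by (simp add: prob_simplex_def)
  qed
  also have "(\<Sum>i\<in>UNIV. p0 $ i * (LINT \<omega>|M i. \<eta> * of_int (hd (run act (pl i \<omega>) (Suc n)) i)))
    = (\<Sum>i\<in>UNIV. \<Sum>h\<in>tree.hist (Suc n). q i h * (\<eta> * of_int (hd h i)))"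
    using n by (intro sum.cong refl expectation_run(1)) simp
  also have "\<dots> = (\<Sum>h\<in>tree.hist n. \<Sum>y\<in>obs_range. \<Sum>i\<in>UNIV. q i (y # h) * (\<eta> * of_int (y i)))"
    by (subst sum.swap) (simp add: tree.sum_hist_Suc)
  also have "\<dots> \<ge> (\<Sum>h\<in>tree.hist n. \<Sum>y\<in>obs_range. tree.tot (y # h) *
    (Hcost n h - \<epsilon> * \<Delta> - \<eta> - jump_bound * (\<Sum>j\<in>UNIV. \<mu> / 2 + (tree.post (y # h) $ j - tree.post h $ j)\<^sup>2 / (2 * \<mu>))))"
    using node_lower n by (intro sum_mono) (auto simp: tree.hist_def)
  also have "(\<Sum>h\<in>tree.hist n. \<Sum>y\<in>obs_range. tree.tot (y # h) *
    (Hcost n h - \<epsilon> * \<Delta> - \<eta> - jump_bound * (\<Sum>j\<in>UNIV. \<mu> / 2 + (tree.post (y # h) $ j - tree.post h $ j)\<^sup>2 / (2 * \<mu>))))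
    = (\<Sum>h\<in>tree.hist n. tree.tot h * Hcost n h) - loss n"
  proof -
    let ?D = "\<lambda>h y j. (tree.post (y # h) $ j - tree.post h $ j)\<^sup>2"
    have tots: "(\<Sum>y\<in>obs_range. tree.tot (y # h)) = tree.tot h" if "h \<in> tree.hist n" for h
      using that n by (intro tree.tot_sum) (auto simp: tree.hist_def)
    have 1: "(\<Sum>h\<in>tree.hist n. \<Sum>y\<in>obs_range. tree.tot (y # h) * (Hcost n h - c)) = (\<Sum>h\<in>tree.hist n. tree.tot h * Hcost n h) - c" for c
    proof -
      have "(\<Sum>h\<in>tree.hist n. \<Sum>y\<in>obs_range. tree.tot (y # h) * (Hcost n h - c)) = (\<Sum>h\<in>tree.hist n. tree.tot h * (Hcost n h - c))"
        by (intro sum.cong refl) (simp add: sum_distrib_right[symmetric] tots)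
      also have "\<dots> = (\<Sum>h\<in>tree.hist n. tree.tot h * Hcost n h) - (\<Sum>h\<in>tree.hist n. tree.tot h) * c"
        by (simp add: right_diff_distrib sum_subtractf sum_distrib_right)
      finally show ?thesis using n by (simp add: tree.mass_tot)
    qed
    have 2: "(\<Sum>h\<in>tree.hist n. \<Sum>y\<in>obs_range. tree.tot (y # h) * (\<Sum>j\<in>UNIV. ?D h y j / (2 * \<mu>)))
      = (\<Sum>j\<in>UNIV. (tree.energy j (Suc n) - tree.energy j n) / (2 * \<mu>))"
    proof -
      have "(\<Sum>h\<in>tree.hist n. \<Sum>y\<in>obs_range. tree.tot (y # h) * (\<Sum>j\<in>UNIV. ?D h y j / (2 * \<mu>)))
        = (\<Sum>h\<in>tree.hist n. \<Sum>y\<in>obs_range. \<Sum>j\<in>UNIV. tree.tot (y # h) * ?D h y j / (2 * \<mu>))"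
        by (simp add: sum_distrib_left)
      also have "\<dots> = (\<Sum>h\<in>tree.hist n. \<Sum>j\<in>UNIV. \<Sum>y\<in>obs_range. tree.tot (y # h) * ?D h y j / (2 * \<mu>))"
        by (intro sum.cong refl sum.swap)
      also have "\<dots> = (\<Sum>j\<in>UNIV. \<Sum>h\<in>tree.hist n. \<Sum>y\<in>obs_range. tree.tot (y # h) * ?D h y j / (2 * \<mu>))"
        by (rule sum.swap)
      also have "\<dots> = (\<Sum>j\<in>UNIV. (tree.energy j (Suc n) - tree.energy j n) / (2 * \<mu>))"
        using tree.energy_Suc[OF n] by (simp add: sum_divide_distrib[symmetric])
      finally show ?thesis .
    qed
    define c where "c = \<epsilon> * \<Delta> + \<eta> + jump_bound * (\<Sum>j\<in>(UNIV::'i set). \<mu> / 2)"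
    have "(\<Sum>h\<in>tree.hist n. \<Sum>y\<in>obs_range. tree.tot (y # h) *
      (Hcost n h - \<epsilon> * \<Delta> - \<eta> - jump_bound * (\<Sum>j\<in>UNIV. \<mu> / 2 + ?D h y j / (2 * \<mu>))))
      = (\<Sum>h\<in>tree.hist n. \<Sum>y\<in>obs_range. tree.tot (y # h) * (Hcost n h - c) - jump_bound * (tree.tot (y # h) * (\<Sum>j\<in>UNIV. ?D h y j / (2 * \<mu>))))"
      unfolding c_def sum.distrib by (intro sum.cong refl) (simp add: algebra_simps)
    also have "\<dots> = (\<Sum>h\<in>tree.hist n. tree.tot h * Hcost n h) - c - jump_bound * (\<Sum>j\<in>UNIV. (tree.energy j (Suc n) - tree.energy j n) / (2 * \<mu>))"
      unfolding sum_subtractf 1 sum_distrib_left[symmetric] 2 ..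
    also have "\<dots> = (\<Sum>h\<in>tree.hist n. tree.tot h * Hcost n h) - loss n"
      unfolding loss_def c_def sum.distrib by (simp add: algebra_simps)
    finally show ?thesis .
  qed
  also have "(\<Sum>h\<in>tree.hist n. tree.tot h * Hcost n h) = tree.cost_upto (Suc n) - tree.cost_upto n"
    using tree.cost_upto_Suc[OF n] by simp
  finally show ?thesis .
qed

text \<open>The energy increments in \<open>loss\<close> telescope, and the energies lie between 0
  and 1; the linear terms are multiplied by the number of periods.\<close>

lemma payoff_lower:
  "payoff_upto N \<ge> running_cost T U V l t0 tree.tree_law
     - (N * (\<epsilon> * \<Delta> + \<eta>) + jump_bound * CARD('i) * (N * \<mu> / 2 + 1 / (2 * \<mu>)))"
proof -
  have "payoff_upto n \<ge> tree.cost_upto n - (n * (\<epsilon> * \<Delta> + \<eta>) + jump_bound * (\<Sum>j\<in>UNIV. n * \<mu> / 2 + (tree.energy j n - tree.energy j 0) / (2 * \<mu>)))"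
    if "n \<le> N" for n
    using that
  proof (induction n)
    case 0
    then show ?case by (simp add: payoff_upto_def tt_0 pay_def tree.cost_upto_0)
  next
    case (Suc n)
    have "loss n = (\<epsilon> * \<Delta> + \<eta>) + (jump_bound * (\<Sum>j\<in>UNIV. real (Suc n) * \<mu> / 2 + (tree.energy j (Suc n) - tree.energy j 0) / (2 * \<mu>))
       - jump_bound * (\<Sum>j\<in>UNIV. n * \<mu> / 2 + (tree.energy j n - tree.energy j 0) / (2 * \<mu>)))"
      unfolding loss_def right_diff_distrib[symmetric] sum_subtractf[symmetric]
      by (simp add: diff_divide_distrib algebra_simps add_divide_distrib)
    then show ?case using Suc payoff_step[of n] by (simp add: algebra_simps)
  qed
  from this[of N] have "payoff_upto N \<ge> tree.cost_upto N - (N * (\<epsilon> * \<Delta> + \<eta>) + jump_bound * (\<Sum>j\<in>UNIV. N * \<mu> / 2 + (tree.energy j N - tree.energy j 0) / (2 * \<mu>)))"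
    by simp
  moreover have "(\<Sum>j\<in>UNIV. N * \<mu> / 2 + (tree.energy j N - tree.energy j 0) / (2 * \<mu>)) \<le> (\<Sum>j\<in>(UNIV::'i set). N * \<mu> / 2 + 1 / (2 * \<mu>))"
  proof (intro sum_mono add_left_mono divide_right_mono)
    fix j show "tree.energy j N - tree.energy j 0 \<le> 1"
      using tree.energy_bounds(2)[of N j] tree.energy_bounds(1)[of j 0] by simp
  qed (use pos in simp)
  then have "jump_bound * (\<Sum>j\<in>UNIV. N * \<mu> / 2 + (tree.energy j N - tree.energy j 0) / (2 * \<mu>)) \<le> jump_bound * CARD('i) * (N * \<mu> / 2 + 1 / (2 * \<mu>))"
    using mult_left_mono[OF _ jump_bound_nonneg] by (fastforce simp: mult.assoc)
  ultimately show ?thesis unfolding tree.running_cost_tree by linarith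
qed

text \<open>The reply is not randomised, so \<open>K\<close> integrates out; it merely presents the
  reply as a random strategy.\<close>

lemma expected_payoff_reply:
  assumes K: "K \<in> E"
  shows "(\<Sum>i\<in>UNIV. p0 $ i * expected_payoff t0 T U V (l i) (\<alpha> i) (K, \<lambda>_. reply act)) = payoff_upto N"
  unfolding payoff_upto_def tt_N
proof (intro sum.cong refl arg_cong2[of _ _ _ _ "(*)"])
  fix i
  interpret Mi: prob_space "M i" by (rule M_prob)
  interpret K: prob_space K using E K by (simp add: prob_space_family_def)
  interpret MK: pair_prob_space "M i" K ..
  obtain k \<tau> where p: "time_partition t0 T k \<tau>" and a: "\<And>\<omega>. \<omega> \<in> space (M i) \<Longrightarrow> delayed_map t0 \<tau> k ctlV ctlU (snd (\<alpha> i) \<omega>)"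
    by (rule \<alpha>_delayed) blast
  let ?f = "\<lambda>\<omega>. pay i UNIV (pl i \<omega>) (reply act (pl i \<omega>))"
  have "expected_payoff t0 T U V (l i) (\<alpha> i) (K, \<lambda>_. reply act) = (LINT \<omega>|(M i \<Otimes>\<^sub>M K). ?f (fst \<omega>))"
    unfolding expected_payoff_def fst_conv snd_conv
  proof (rule Bochner_Integration.integral_cong[OF refl])
    fix \<omega> assume "\<omega> \<in> space (M i \<Otimes>\<^sub>M K)"
    then have "fst \<omega> \<in> space (M i)" by (simp add: space_pair_measure mem_Times_iff)
    from outcome_pay[of act, OF act p a[OF this]]
    show "(case outcome t0 T U V (snd (\<alpha> i) (fst \<omega>)) (reply act) of (u, v) \<Rightarrow> LINT s|timeM. l i s (u s) (v s)) = ?f (fst \<omega>)" .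
  qed
  also have "\<dots> = (LINT \<omega>|M i. ?f \<omega>)"
  proof -
    have "(\<lambda>\<omega>. ?f (fst \<omega>)) \<in> borel_measurable (M i \<Otimes>\<^sub>M K)"
      by (rule measurable_compose[OF measurable_fst pay_pl_measurable]) simp
    then have i: "integrable (M i \<Otimes>\<^sub>M K) (\<lambda>\<omega>. ?f (fst \<omega>))"
      using pay_bound[OF pl_control reply_control[of act, OF act], of _ i UNIV i]
      by (intro MK.integrable_const_bound[where B="lbound * (T - t0)"] AE_I2)
         (simp_all add: space_pair_measure mem_Times_iff)
    have e: "(\<lambda>\<omega>. ?f (fst \<omega>)) = case_prod (\<lambda>\<omega> _. ?f \<omega>)" by (simp add: fun_eq_iff)
    show ?thesis using MK.integral_fst[OF i[unfolded e]] unfolding e by (simp add: K.prob_space)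
  qed
  also have "\<dots> = (LINT \<omega>|M i. pay i {t0..<T} (pl i \<omega>) (reply act (pl i \<omega>)))"
    by (rule Bochner_Integration.integral_cong[OF refl]) (simp add: pay_drop_endpoint pl_control reply_control[of act, OF act])
  finally show "expected_payoff t0 T U V (l i) (\<alpha> i) (K, \<lambda>_. reply act) = (LINT \<omega>|M i. pay i {t0..<T} (pl i \<omega>) (reply act (pl i \<omega>)))" .
qed

end

section \<open>The value\<close>

lemma (in game) near_optimal_response:
  fixes E :: "'w measure set" and \<alpha> :: "'i \<Rightarrow> ('w, 'b, 'a) rand_strategy"
  assumes I: "isaacs T U V l" and p0: "p0 \<in> prob_simplex" and E: "prob_space_family E"
    and \<alpha>: "\<And>i. \<alpha> i \<in> rand_strategies E t0 T V U" and e: "e > 0"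
  obtains Q \<beta> where "Q \<in> martingale_measures t0 T p0" "\<beta> \<in> rand_strategies E t0 T U V"
    "(\<Sum>i\<in>UNIV. p0 $ i * expected_payoff t0 T U V (l i) (\<alpha> i) \<beta>) \<ge> running_cost T U V l t0 Q - e"
proof -
  define L where "L = T - t0"
  have L: "L > 0" using t0 by (simp add: L_def)
  \<comment> \<open>The error \<open>e\<close> is split into quarters:
    \<open>N * (\<epsilon> * \<Delta>)\<close> for the near optimality of the actions,
    \<open>N * \<eta>\<close> for the rounding, \<open>J * \<mu> / 2\<close> and
    \<open>J / (2 * \<mu> * N)\<close> for the change of beliefs.\<close>
  define \<epsilon> where "\<epsilon> = e / (4 * L)"
  have \<epsilon>: "\<epsilon> > 0" using e L by (simp add: \<epsilon>_def)
  \<comment> \<open>Chosen so that \<open>jump_bound * CARD('i) = J / N\<close> once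
    \<open>\<Delta> = L / N\<close> and \<open>\<eta> = e / (4 * N)\<close> are inserted; it is
    independent of \<open>N\<close>.\<close>
  define J where "J = (lbound * L + e / 4) * CARD('i)"
  have J: "J > 0" using lbound(1) L e by (simp add: J_def add_pos_pos)
  define \<mu> where "\<mu> = e / (2 * J)"
  have \<mu>: "\<mu> > 0" using e J by (simp add: \<mu>_def)
  obtain \<delta> where \<delta>: "\<delta> > 0" and resp: "\<And>p t. p \<in> prob_simplex \<Longrightarrow> t \<in> {0..T} \<Longrightarrow>
    \<exists>w\<in>V. \<forall>s\<in>{0..T}. \<bar>s - t\<bar> < \<delta> \<longrightarrow> (\<forall>u\<in>U. mixed s p u w \<ge> H s p - \<epsilon>)"
    by (rule isaacs_response_uniform[OF I \<epsilon>]) blast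
  \<comment> \<open>The first bound makes a period shorter than \<open>\<delta>\<close>, the second
    makes the telescoped squares small for the \<open>\<mu>\<close> already fixed.\<close>
  obtain N :: nat where N': "real N > max (L / \<delta>) (2 * J / (\<mu> * e))" using reals_Archimedean2 by blast
  have N1: "L / \<delta> < N" "2 * J / (\<mu> * e) < N" using N' by auto
  have "L / \<delta> > 0" using L \<delta> by simp
  then have N0: "real N > 0" using N1(1) by linarith
  define \<Delta> where "\<Delta> = L / N"
  define \<eta> where "\<eta> = e / (4 * N)"
  define tt where "tt n = t0 + n * \<Delta>" for n :: nat
  have \<Delta>: "\<Delta> > 0" using L N0 by (simp add: \<Delta>_def)
  have \<eta>: "\<eta> > 0" using e N0 by (simp add: \<eta>_def)
  have N\<Delta>: "N * \<Delta> = L" using N0 by (simp add: \<Delta>_def)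
  have \<Delta>\<delta>: "\<Delta> < \<delta>" using N1(1) N0 \<delta> by (simp add: \<Delta>_def field_simps)
  have part: "time_partition t0 T N tt"
    using N\<Delta> \<Delta> by (simp add: time_partition_def tt_def L_def algebra_simps)
  interpret grid l U V T t0 N tt \<eta>
    by unfold_locales (use part \<eta> in auto)
  \<comment> \<open>Formed for arbitrary sets \<open>C\<close>, so the policy can be fixed before
    any measurability is known: \<open>measure\<close> is nonnegative in any case, which already
    puts the belief into the simplex.\<close>
  define bel where "bel c C = belief_of p0 (type_mass p0 \<alpha> (restrict c {t0..T}) C)" for c :: "real \<Rightarrow> 'b" and C
  have bel: "bel c C \<in> prob_simplex" for c C
    unfolding bel_def using p0 by (intro belief_of_simplex) (auto simp: type_mass_def prob_simplex_def)
  \<comment> \<open>After the last period the only demand left is an admissible action;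
    \<open>length h < N\<close> keeps the time interval within the grid.\<close>
  define good where "good h p w \<longleftrightarrow> w \<in> V \<and> (length h < N \<longrightarrow> (\<forall>s\<in>{tt (length h)..<tt (Suc (length h))}. \<forall>u\<in>U.
     mixed s p u w \<ge> H s p - \<epsilon>))" for h :: "('i \<Rightarrow> int) list" and p w
  have ex: "\<exists>w. good h (bel c C) w" for h c C
  proof (cases "length h < N")
    case False
    then show ?thesis using V(2) by (auto simp: good_def)
  next
    case True
    then have t: "t0 \<le> tt (length h)" "tt (Suc (length h)) \<le> T" "tt (length h) \<le> T"
      using tt_bounds[of "length h"] tt_bounds[of "Suc (length h)"] by auto
    then have "tt (length h) \<in> {0..T}" using t0 by auto
    from resp[OF bel this] obtain w where w: "w \<in> V" "\<forall>s\<in>{0..T}. \<bar>s - tt (length h)\<bar> < \<delta> \<longrightarrow>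
      (\<forall>u\<in>U. mixed s (bel c C) u w \<ge> H s (bel c C) - \<epsilon>)" by blast
    have "mixed s (bel c C) u w \<ge> H s (bel c C) - \<epsilon>" if s: "s \<in> {tt (length h)..<tt (Suc (length h))}" and u: "u \<in> U" for s u
    proof -
      have "s \<in> {0..T}" using s t t0 by auto
      moreover have "\<bar>s - tt (length h)\<bar> < \<delta>" using s \<Delta>\<delta> by (auto simp: tt_def algebra_simps)
      ultimately show ?thesis using w(2) u by blast
    qed
    then show ?thesis using w(1) by (auto simp: good_def)
  qed
  obtain act where act_eq: "\<And>h. act h = (SOME w. good h (bel (plan act h) {u. run act u (length h) = h}) w)"
    using policy_exists[of "\<lambda>h c C. SOME w. good h (bel c C) w"] by blast
  have good: "good h (bel (plan act h) {u. run act u (length h) = h}) (act h)" for h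
    unfolding act_eq[of h] by (rule someI_ex[OF ex])
  have act: "act h \<in> V" for h using good[of h] by (simp add: good_def)
  interpret response l U V T t0 N tt \<eta> E \<alpha> p0 act \<epsilon> \<Delta> \<mu>
  proof unfold_locales
    show "mixed s (belief_of p0 (type_mass p0 \<alpha> (plan_ctl act h) {u. run act u (length h) = h})) u (act h)
      \<ge> H s (belief_of p0 (type_mass p0 \<alpha> (plan_ctl act h) {u. run act u (length h) = h})) - \<epsilon>"
      if "length h < N" "s \<in> {tt (length h)..<tt (Suc (length h))}" "u \<in> U" for h s u
      using good[of h] that by (simp add: good_def bel_def plan_ctl_def[of act, OF act])
    show "tt (Suc n) - tt n = \<Delta>" for n by (simp add: tt_def algebra_simps)
  qed (use E p0 \<alpha> act \<epsilon> \<Delta> \<mu> in auto)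
  obtain K where K: "K \<in> E" using E by (auto simp: prob_space_family_def)
  have loss: "N * (\<epsilon> * \<Delta> + \<eta>) + jump_bound * CARD('i) * (N * \<mu> / 2 + 1 / (2 * \<mu>)) \<le> e"
  proof -
    have "N * (\<epsilon> * \<Delta> + \<eta>) = \<epsilon> * (N * \<Delta>) + N * \<eta>" by (simp add: algebra_simps)
    also have "\<dots> = e / 2" unfolding N\<Delta> using L N0 by (simp add: \<epsilon>_def \<eta>_def)
    finally have 1: "N * (\<epsilon> * \<Delta> + \<eta>) = e / 2" .
    have jb: "jump_bound * CARD('i) = J / N"
      unfolding jump_bound_def using N0 by (simp add: J_def \<Delta>_def \<eta>_def field_simps)
    have "jump_bound * CARD('i) * (N * \<mu> / 2 + 1 / (2 * \<mu>)) = J * \<mu> / 2 + J / (2 * \<mu> * N)"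
      unfolding jb using N0 \<mu> by (simp add: field_simps)
    also have "J * \<mu> / 2 = e / 4" using J by (simp add: \<mu>_def)
    also have "J / (2 * \<mu> * N) \<le> e / 4"
    proof -
      have "2 * J < N * (\<mu> * e)" using N1(2) \<mu> e by (simp add: pos_divide_less_eq)
      then show ?thesis using \<mu> N0 by (simp add: pos_divide_le_eq algebra_simps)
    qed
    finally show ?thesis using 1 by simp
  qed
  show ?thesis
  proof (rule that[OF tree.tree_law_martingale_measure reply_strategy[of act, OF act K]])
    show "(\<Sum>i\<in>UNIV. p0 $ i * expected_payoff t0 T U V (l i) (\<alpha> i) (K, \<lambda>\<omega>. reply act)) \<ge> running_cost T U V l t0 tree.tree_law - e"
      unfolding expected_payoff_reply[OF K] using payoff_lower loss by linarith
  qed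
qed

text \<open>A closed chain of inequalities: the value is at most the best reply payoff against the
  feedback controls, this is at most the optimal running cost, and the latter is at most what Player
  2 can secure against any choice of Player 1, hence at most the value.\<close>

theorem theorem2p3:
  fixes l :: "'i::finite \<Rightarrow> real \<Rightarrow> 'a::euclidean_space \<Rightarrow> 'b::euclidean_space \<Rightarrow> real"
    and U :: "'a set" and V :: "'b set" and T t0 :: real
    and ustar :: "real \<Rightarrow> real ^ 'i \<Rightarrow> 'a"
    and E :: "'w measure set"
    and p0 :: "real ^ 'i"
    and Pbar :: "(real \<Rightarrow> real ^ 'i) measure"
    and Pbari :: "'i \<Rightarrow> (real \<Rightarrow> real ^ 'i) measure"
  assumes "CARD('i) \<ge> 2" and "T > 0"
    and "compact U" and "U \<noteq> {}" and "compact V" and "V \<noteq> {}"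
    and "\<And>i. continuous_on ({0..T} \<times> U \<times> V) (\<lambda>(t, u, v). l i t u v)"
    and "isaacs T U V l"
    and "minimizer_selection T U V l ustar"
    and "0 \<le> t0" and "t0 < T" and "p0 \<in> prob_simplex"
    and "optimal_martingale_measure T U V l t0 p0 Pbar"
    and "conditional_laws t0 T p0 Pbar Pbari"
    and "prob_space_family E" and "\<And>i. member_upto_iso (Pbari i) E"
  shows "game_value E T U V l t0 p0 =
    (SUP \<beta> \<in> rand_strategies E t0 T U V.
       \<Sum>i\<in>UNIV. p0 $ i *
         expected_payoff t0 T U V (l i)
           (strategy_of_control (Pbari i, feedback_control t0 T ustar)) \<beta>)"
proof -
  interpret feedback_game l U V T t0 ustar
    by unfold_locales (use assms in auto)
  note p0 = \<open>p0 \<in> prob_simplex\<close> and E = \<open>prob_space_family E\<close> and Q = \<open>conditional_laws t0 T p0 Pbar Pbari\<close>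
  let ?\<A> = "{\<alpha> :: 'i \<Rightarrow> ('w, 'b, 'a) rand_strategy. \<forall>i. \<alpha> i \<in> rand_strategies E t0 T V U}" and ?\<B> = "rand_strategies E t0 T U V"
  define G where "G \<alpha> \<beta> = (\<Sum>i\<in>UNIV. p0 $ i * expected_payoff t0 T U V (l i) (\<alpha> i) \<beta>)"
    for \<alpha> :: "'i \<Rightarrow> ('w, 'b, 'a) rand_strategy" and \<beta> :: "('w, 'a, 'b) rand_strategy"
  define F where "F \<beta> = (\<Sum>i\<in>UNIV. p0 $ i * expected_payoff t0 T U V (l i) (strategy_of_control (Pbari i, feedback_control t0 T ustar)) \<beta>)"
    for \<beta> :: "('w, 'a, 'b) rand_strategy"
  have P: "Pbar \<in> martingale_measures t0 T p0"
    and Popt: "running_cost T U V l t0 Pbar = (INF Q\<in>martingale_measures t0 T p0. running_cost T U V l t0 Q)"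
    using assms(13) by (auto simp: optimal_martingale_measure_def)
  have Qs: "sets (Pbari i) = sets (path_space t0 T)" for i
  proof -
    have "0 \<le> p0 $ i" using p0 by (simp add: prob_simplex_def)
    then show ?thesis using Q
      by (cases "p0 $ i = 0") (auto simp: conditional_laws_def martingale_measures_def)
  qed
  have Qp: "prob_space (Pbari i)" for i
  proof -
    obtain K f where K: "K \<in> E" and f: "f \<in> K \<rightarrow>\<^sub>M Pbari i" "distr K (Pbari i) f = Pbari i"
      using assms(16)[of i] by (auto simp: member_upto_iso_def isomorphic_measure_spaces_def)
    interpret K: prob_space K using K E by (simp add: prob_space_family_def)
    show ?thesis using K.prob_space_distr[OF f(1)] by (simp add: f(2))
  qed
  obtain K v where "K \<in> E" "v \<in> ctlV" using E ctlV_nonempty by (auto simp: prob_space_family_def)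
  \<comment> \<open>Suprema and infima of reals are informative only for nonempty bounded families;
    this and the following bounds supply that.\<close>
  then have Bne: "?\<B> \<noteq> {}" using const_strategy by blast
  have Gb: "\<bar>G \<alpha> \<beta>\<bar> \<le> lbound * (T - t0)" if "\<alpha> \<in> ?\<A>" "\<beta> \<in> ?\<B>" for \<alpha> \<beta>
    unfolding G_def using that by (intro simplex_sum_abs_le p0 expected_payoff_bound[OF _ _ E]) auto
  have bdd: "bdd_above (G \<alpha> ` ?\<B>)" if "\<alpha> \<in> ?\<A>" for \<alpha>
    using Gb[OF that] by (auto intro!: bdd_aboveI[of _ "lbound * (T - t0)"] simp: abs_le_iff)
  have F_le: "F \<beta> \<le> running_cost T U V l t0 Pbar" if "\<beta> \<in> ?\<B>" for \<beta>
    unfolding F_def using that E by (intro feedback_payoff_le[OF P Q p0 Qp that]) (auto simp: rand_strategies_def prob_space_family_def)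
  \<comment> \<open>The feedback controls do not themselves belong to the strategies over which the
    value is taken; their isomorphic copies \<open>\<alpha>0\<close> do.\<close>
  have "\<forall>i. \<exists>\<alpha>. \<alpha> \<in> rand_strategies E t0 T V U \<and> (\<forall>j. \<forall>\<beta>\<in>?\<B>.
      expected_payoff t0 T U V (l j) \<alpha> \<beta> = expected_payoff t0 T U V (l j) (strategy_of_control (Pbari i, feedback_control t0 T ustar)) \<beta>)"
    using feedback_strategy_transfer[OF Qs assms(16) E] by metis
  then obtain \<alpha>0 where \<alpha>0: "\<And>i. \<alpha>0 i \<in> rand_strategies E t0 T V U"
    and \<alpha>0_eq: "\<And>i j \<beta>. \<beta> \<in> ?\<B> \<Longrightarrow> expected_payoff t0 T U V (l j) (\<alpha>0 i) \<beta> =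
       expected_payoff t0 T U V (l j) (strategy_of_control (Pbari i, feedback_control t0 T ustar)) \<beta>"
    by metis
  have GF: "G \<alpha>0 \<beta> = F \<beta>" if "\<beta> \<in> ?\<B>" for \<beta>
    unfolding G_def F_def using \<alpha>0_eq[OF that] by simp
  have A0: "\<alpha>0 \<in> ?\<A>" using \<alpha>0 by simp
  have "(INF \<alpha>\<in>?\<A>. SUP \<beta>\<in>?\<B>. G \<alpha> \<beta>) \<le> (SUP \<beta>\<in>?\<B>. G \<alpha>0 \<beta>)"
  proof (rule cINF_lower[OF _ A0])
    have "- (lbound * (T - t0)) \<le> (SUP \<beta>\<in>?\<B>. G \<alpha> \<beta>)" if "\<alpha> \<in> ?\<A>" for \<alpha>
    proof -
      obtain \<beta> where \<beta>: "\<beta> \<in> ?\<B>" using Bne by blast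
      have "- (lbound * (T - t0)) \<le> G \<alpha> \<beta>" using Gb[OF that \<beta>] by linarith
      also have "\<dots> \<le> (SUP \<beta>\<in>?\<B>. G \<alpha> \<beta>)" by (rule cSUP_upper[OF \<beta> bdd[OF that]])
      finally show ?thesis .
    qed
    then show "bdd_below ((\<lambda>\<alpha>. SUP \<beta>\<in>?\<B>. G \<alpha> \<beta>) ` ?\<A>)" by (intro bdd_belowI2)
  qed
  also have "\<dots> = (SUP \<beta>\<in>?\<B>. F \<beta>)" by (rule SUP_cong) (simp_all add: GF)
  finally have le: "(INF \<alpha>\<in>?\<A>. SUP \<beta>\<in>?\<B>. G \<alpha> \<beta>) \<le> (SUP \<beta>\<in>?\<B>. F \<beta>)" .
  have "(SUP \<beta>\<in>?\<B>. F \<beta>) \<le> running_cost T U V l t0 Pbar"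
    by (rule cSUP_least[OF Bne F_le])
  also have "\<dots> \<le> (INF \<alpha>\<in>?\<A>. SUP \<beta>\<in>?\<B>. G \<alpha> \<beta>)"
  proof (rule cINF_greatest)
    show "?\<A> \<noteq> {}" using A0 by blast
    fix \<alpha> assume \<alpha>: "\<alpha> \<in> ?\<A>"
    show "running_cost T U V l t0 Pbar \<le> (SUP \<beta>\<in>?\<B>. G \<alpha> \<beta>)"
    proof (rule field_le_epsilon)
      fix e :: real assume "e > 0"
      then obtain Q \<beta> where Q: "Q \<in> martingale_measures t0 T p0" and \<beta>: "\<beta> \<in> ?\<B>"
        and *: "G \<alpha> \<beta> \<ge> running_cost T U V l t0 Q - e"
        using near_optimal_response[OF \<open>isaacs T U V l\<close> p0 E, of \<alpha> e] \<alpha> unfolding G_def by blast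
      have "running_cost T U V l t0 Pbar \<le> running_cost T U V l t0 Q"
        unfolding Popt
      proof (rule cINF_lower[OF _ Q])
        show "bdd_below (running_cost T U V l t0 ` martingale_measures t0 T p0)"
          by (rule bdd_belowI2[where m="- (lbound * (T - t0))"]) (rule running_cost_lower; simp add: martingale_measures_def)
      qed
      also have "\<dots> \<le> G \<alpha> \<beta> + e" using * by simp
      also have "G \<alpha> \<beta> \<le> (SUP \<beta>\<in>?\<B>. G \<alpha> \<beta>)" by (rule cSUP_upper[OF \<beta> bdd[OF \<alpha>]])
      finally show "running_cost T U V l t0 Pbar \<le> (SUP \<beta>\<in>?\<B>. G \<alpha> \<beta>) + e" by simp
    qed
  qed
  finally show ?thesis using le unfolding game_value_def G_def F_def by (rule antisym[rotated])
qed

end
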